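(* Let $n,r\geq 1$. For every pair of points $p,p'\in\mathcal{R}_{n,r}$ there exists $\psi\in\mathcal{P}_r$ such that $p.\psi=p'$.
   Context: Fix $\tau\in\mathbb{C}^*$. Let $V_{n,r}=\mathrm{Mat}_{n,n}(\mathbb{C})\oplus\mathrm{Mat}_{n,n}(\mathbb{C})\oplus\mathrm{Mat}_{n,r}(\mathbb{C})\oplus\mathrm{Mat}_{r,n}(\mathbb{C})$, with points $(X,Y,v,w)$; $\mathrm{GL}_n(\mathbb{C})$ acts by $g.(X,Y,v,w)=(gXg^{-1},gYg^{-1},gv,wg^{-1})$. Let $\mu(X,Y,v,w)=[X,Y]-vw$ and $\mathcal{C}_{n,r}=\mu^{-1}(\tau I)/\mathrm{GL}_n(\mathbb{C})$. $\mathcal{R}_{n,r}\subset\mathcal{C}_{n,r}$ is the set of orbits $[X,Y,v,w]$ such that at least one of the matrices $X$, $Y$ has $n$ distinct eigenvalues. $\mathbf{Q}_r$ is the quiver with two vertices $1,2$, two loops $a,a^*$ at $1$, $r$ arrows $b_1,\dots,b_r\colon 1\to 2$ and $r$ arrows $d_1,\dots,d_r\colon 2\to 1$. $\mathbb{C}\mathbf{Q}_r$ is its complex path algebra, with paths composed like linear maps (right to left); $e_1,e_2$ are the trivial paths. Automorphisms of $\mathbb{C}\mathbf{Q}_r$ are $\mathbb{C}$-algebra automorphisms fixing $e_1$ and $e_2$. Notation: $x_i=-d_{2i-1}$, $x_i^*=b_{2i-1}$ for $i=1,\dots,\lceil r/2\rceil$; $y_j=b_{2j}$, $y_j^*=d_{2j}$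 for $j=1,\dots,\lfloor r/2\rfloor$. Let $c_r=[a,a^*]+\sum_i[x_i,x_i^*]+\sum_j[y_j,y_j^*]$; an automorphism is symplectic if it fixes $c_r$, and $\operatorname{Aut}(\mathbb{C}\mathbf{Q}_r;c_r)$ is the group of such automorphisms. Action: a point $(X,Y,v,w)\in V_{n,r}$ is viewed as the representation of $\mathbf{Q}_r$ with dimension vector $(n,1)$ in which $a,a^*$ are represented by $X,Y$, $d_\alpha$ by the $\alpha$-th column of $v$, and $b_\alpha$ by the $\alpha$-th row of $w$. For $\psi\in\operatorname{Aut}(\mathbb{C}\mathbf{Q}_r;c_r)$, $(X,Y,v,w).\psi$ is the quadruple obtained by evaluating $\psi(a),\psi(a^* ),\psi(d_\alpha),\psi(b_\alpha)$ at this representation (giving the new $X$, $Y$, columns of $v$, rows of $w$). This induces a right action of $\operatorname{Aut}(\mathbb{C}\mathbf{Q}_r;c_r)$ on $\mathcal{C}_{n,r}$. Let $\mathcal{I}_r$ be the two-sided ideal generated by $e_2$, all $d_\alpha$ and all $b_\alpha$; then $\mathbb{C}\mathbf{Q}_r/\mathcal{I}_r\simeq\mathbb{C}\langle a,a^*\rangle=\mathbb{C}\mathbf{Q}_0$. An automorphism is reduced if it induces the identity on this quotient. Let $\operatorname{Aut}(\mathbb{C}\mathbf{Q}_0;c_0)$ be the group of $\mathbb{C}$-algebra automorphisms of $\mathbb{C}\langle a,a^*\rangle$ fixing $c_0=[a,a^*]$, embedded in $\operatorname{Aut}(\mathbb{C}\mathbf{Q}_r;c_r)$ by letting them act as the identity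 on all $b_\alpha,d_\alpha$. Then $\operatorname{Aut}(\mathbb{C}\mathbf{Q}_r;c_r)=K_{c_r}\rtimes\operatorname{Aut}(\mathbb{C}\mathbf{Q}_0;c_0)$, where $K_{c_r}$ is the normal subgroup of reduced symplectic automorphisms. An automorphism is affine if it sends each arrow to a polynomial which is at most linear in each arrow; $\mathrm{Aff}_c^{\mathrm{red}}$ is the group of reduced affine symplectic automorphisms, which consists of the automorphisms fixing $a,a^*$ and acting by $b_\alpha\mapsto\sum_\beta b_\beta T_{\beta\alpha}$, $d_\alpha\mapsto\sum_\beta (T^{-1})_{\alpha\beta}d_\beta$ for $T\in\mathrm{GL}_r(\mathbb{C})$. For $q\in\mathbb{C}[a]$ put $b_{11}=x_1y_1$ and let $\Lambda(q(a)b_{11})$ be the symplectic automorphism acting by $a^*\mapsto a^*+\frac{\partial}{\partial a}(q(a)b_{11})$, $x_1^*\mapsto x_1^*+y_1q(a)$, $y_1^*\mapsto y_1^*+q(a)x_1$ and fixing all other arrows, where $\frac{\partial}{\partial a}$ is linear and on a cyclic word $\eta_1\cdots\eta_\ell$ in the letters $a,b_{11}$ equals $\sum_{k:\eta_k=a}\eta_{k+1}\cdots\eta_\ell\eta_1\cdots\eta_{k-1}$. $P_r\subseteq K_{c_r}$ is the group generated by $\mathrm{Aff}_c^{\mathrm{red}}$ and all $\Lambda(q(a)b_{11})$, $q\in\mathbb{C}[a]$ (for $r=1$ there is no arrow $y_1$, and $P_1=\mathrm{Aff}_c^{\mathrm{red}}$). $\mathcal{P}_r$ is the subgroup of $\operatorname{Aut}(\mathbb{C}\mathbf{Q}_r;c_r)$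 obtained by replacing, in the semidirect product $K_{c_r}\rtimes\operatorname{Aut}(\mathbb{C}\mathbf{Q}_0;c_0)$, the group $K_{c_r}$ with its subgroup $P_r$; thus every element of $\mathcal{P}_r$ can be written in a unique way as $\psi_0\circ\psi$ with $\psi_0\in\operatorname{Aut}(\mathbb{C}\mathbf{Q}_0;c_0)$ and $\psi\in P_r$.
   Formalization: 𝒫_r is taken as the subgroup generated by Aut(CQ_0;c_0) and P_r; for r≥2 the products ψ_0∘ψ do not form a subgroup (P_r fixes a and is not normalised), and with only such products the claim fails for n=r=2. *)

theory Defs
  imports
    "HOL-Algebra.Bij"
    "HOL-Algebra.Generated_Groups"
    "HOL-Library.Poly_Mapping"
    "HOL-Computational_Algebra.Polynomial"
    "Graph_Theory.Arc_Walk"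
    "Jordan_Normal_Form.Spectral_Radius"
begin

section \<open>Path algebras of quivers\<close>

text \<open>
  A quiver is a directed multigraph. A path from \<open>u\<close> to \<open>v\<close> is a triple \<open>(u, p, v)\<close> such that
  \<open>p\<close> is an arc walk from \<open>u\<close> to \<open>v\<close>; the first arc of the list \<open>p\<close> is the one that is
  traversed first. Since the product of two such triples refers to their end points only, all
  path algebras over the same types of vertices and arrows are subrings (with possibly different
  units) of one ambient ring, the finitely supported functions on all triples.
\<close>

type_synonym ('v, 'e) path = "'v \<times> 'e list \<times> 'v"

typedef ('v, 'e) palg = "UNIV :: (('v, 'e) path \<Rightarrow>\<^sub>0 complex) set"
  morphisms pcoeffs Abs_palg ..

setup_lifting type_definition_palg

text \<open>
  Paths compose like linear maps: in \<open>P Q\<close> the path \<open>Q\<close> comes first, and the product is \<open>0\<close>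
  unless \<open>P\<close> starts where \<open>Q\<close> ends.
\<close>

fun path_mult :: "('v, 'e) path \<Rightarrow> ('v, 'e) path \<Rightarrow> complex \<Rightarrow> (('v, 'e) path \<Rightarrow>\<^sub>0 complex)" where
  "path_mult (m', p, v) (u, q, m) c =
     (if m = m' then Poly_Mapping.single (u, q @ p, v) c else 0)"

definition convolve ::
    "(('v, 'e) path \<Rightarrow>\<^sub>0 complex) \<Rightarrow> (('v, 'e) path \<Rightarrow>\<^sub>0 complex) \<Rightarrow> (('v, 'e) path \<Rightarrow>\<^sub>0 complex)" where
  "convolve f g = (\<Sum>P\<in>Poly_Mapping.keys f. \<Sum>Q\<in>Poly_Mapping.keys g.
     path_mult P Q (Poly_Mapping.lookup f P * Poly_Mapping.lookup g Q))"

lemma path_mult_0 [simp]: "path_mult P Q 0 = 0"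
  by (cases P; cases Q) auto

lemma path_mult_add: "path_mult P Q (c + d) = path_mult P Q c + path_mult P Q d"
  by (cases P; cases Q) (auto simp: single_add)

lemma convolve_superset:
  assumes "finite S" "finite T" "Poly_Mapping.keys f \<subseteq> S" "Poly_Mapping.keys g \<subseteq> T"
  shows "convolve f g = (\<Sum>P\<in>S. \<Sum>Q\<in>T.
     path_mult P Q (Poly_Mapping.lookup f P * Poly_Mapping.lookup g Q))"
proof -
  have "(\<Sum>P\<in>S. \<Sum>Q\<in>T. path_mult P Q (Poly_Mapping.lookup f P * Poly_Mapping.lookup g Q)) =
        (\<Sum>P\<in>Poly_Mapping.keys f. \<Sum>Q\<in>T.
           path_mult P Q (Poly_Mapping.lookup f P * Poly_Mapping.lookup g Q))"
    by (rule sum.mono_neutral_right) (use assms in \<open>auto simp: in_keys_iff\<close>)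
  also have "\<dots> = convolve f g"
    unfolding convolve_def
    by (intro sum.cong refl sum.mono_neutral_right) (use assms in \<open>auto simp: in_keys_iff\<close>)
  finally show ?thesis by simp
qed

lemma convolve_add_left: "convolve (f + f') g = convolve f g + convolve f' g"
proof -
  let ?S = "Poly_Mapping.keys f \<union> Poly_Mapping.keys f'" and ?T = "Poly_Mapping.keys g"
  have "Poly_Mapping.keys (f + f') \<subseteq> ?S" by (rule keys_add)
  then show ?thesis
    by (simp add: convolve_superset[of ?S ?T] lookup_add distrib_right path_mult_add sum.distrib)
qed

lemma convolve_add_right: "convolve f (g + g') = convolve f g + convolve f g'"
proof -
  let ?S = "Poly_Mapping.keys f" and ?T = "Poly_Mapping.keys g \<union> Poly_Mapping.keys g'"
  have "Poly_Mapping.keys (g + g') \<subseteq> ?T" by (rule keys_add)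
  then show ?thesis
    by (simp add: convolve_superset[of ?S ?T] lookup_add distrib_left path_mult_add sum.distrib)
qed

lemma convolve_0 [simp]: "convolve 0 g = 0" "convolve f 0 = 0"
  by (simp_all add: convolve_def)

lemma convolve_single:
  "convolve (Poly_Mapping.single P c) (Poly_Mapping.single Q d) = path_mult P Q (c * d)"
  by (subst convolve_superset[of "{P}" "{Q}"]) auto

lemma finsupp_induct [case_names zero single add]:
  fixes f :: "'a \<Rightarrow>\<^sub>0 'b :: comm_monoid_add"
  assumes "P 0" "\<And>k c. P (Poly_Mapping.single k c)" "\<And>f g. P f \<Longrightarrow> P g \<Longrightarrow> P (f + g)"
  shows "P f"
proof -
  have "f = (\<Sum>k\<in>Poly_Mapping.keys f. Poly_Mapping.single k (Poly_Mapping.lookup f k))"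
    by (rule poly_mapping_eqI)
       (auto simp: lookup_sum lookup_single when_def in_keys_iff sum.delta)
  moreover have "P (\<Sum>k\<in>A. Poly_Mapping.single k (h k))" for A h
    by (induction A rule: infinite_finite_induct) (auto intro: assms)
  ultimately show ?thesis by metis
qed

lemma convolve_assoc: "convolve (convolve f g) h = convolve f (convolve g h)"
proof (induction f rule: finsupp_induct)
  case f: (single P c)
  show ?case
  proof (induction g rule: finsupp_induct)
    case g: (single Q d)
    show ?case
      by (induction h rule: finsupp_induct)
         (cases P; cases Q; auto simp: convolve_single convolve_add_right mult.assoc)+
  qed (simp_all add: convolve_add_left convolve_add_right)
qed (simp_all add: convolve_add_left)

instantiation palg :: (type, type) ring
begin

lift_definition zero_palg :: "('a, 'b) palg" is 0 .
lift_definition plus_palg :: "('a, 'b) palg \<Rightarrow> ('a, 'b) palg \<Rightarrow> ('a, 'b) palg" is "(+)" .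
lift_definition minus_palg :: "('a, 'b) palg \<Rightarrow> ('a, 'b) palg \<Rightarrow> ('a, 'b) palg" is "(-)" .
lift_definition uminus_palg :: "('a, 'b) palg \<Rightarrow> ('a, 'b) palg" is uminus .
lift_definition times_palg :: "('a, 'b) palg \<Rightarrow> ('a, 'b) palg \<Rightarrow> ('a, 'b) palg" is convolve .

instance
  by (standard; transfer)
     (simp_all add: convolve_assoc convolve_add_left convolve_add_right add.assoc add.commute)

end

lift_definition scale :: "complex \<Rightarrow> ('v, 'e) palg \<Rightarrow> ('v, 'e) palg" is
  "\<lambda>c. Poly_Mapping.map ((*) c)" .

definition path_elt :: "('v, 'e) path \<Rightarrow> ('v, 'e) palg" where
  "path_elt P = Abs_palg (Poly_Mapping.single P 1)"

definition paths_of :: "('v, 'e) palg \<Rightarrow> ('v, 'e) path set" where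
  "paths_of x = Poly_Mapping.keys (pcoeffs x)"

abbreviation pcoeff :: "('v, 'e) palg \<Rightarrow> ('v, 'e) path \<Rightarrow> complex" where
  "pcoeff x \<equiv> Poly_Mapping.lookup (pcoeffs x)"

definition path_algebra :: "('v, 'e) pre_digraph \<Rightarrow> ('v, 'e) palg set" where
  "path_algebra G = {x. \<forall>(u, p, v) \<in> paths_of x. pre_digraph.awalk G u p v}"

definition triv :: "'v \<Rightarrow> ('v, 'e) palg" where
  "triv v = path_elt (v, [], v)"

text \<open>
  Automorphisms are extensional functions on the carrier, as in \<^const>\<open>BijGroup\<close>.
\<close>

definition algebra_aut :: "('v, 'e) pre_digraph \<Rightarrow> (('v, 'e) palg \<Rightarrow> ('v, 'e) palg) set" where
  "algebra_aut G = {\<psi> \<in> Bij (path_algebra G).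
     (\<forall>x \<in> path_algebra G. \<forall>y \<in> path_algebra G.
        \<psi> (x + y) = \<psi> x + \<psi> y \<and> \<psi> (x * y) = \<psi> x * \<psi> y) \<and>
     (\<forall>c. \<forall>x \<in> path_algebra G. \<psi> (scale c x) = scale c (\<psi> x)) \<and>
     \<psi> (\<Sum>v\<in>verts G. triv v) = (\<Sum>v\<in>verts G. triv v)}"

definition commutator :: "'a :: ring \<Rightarrow> 'a \<Rightarrow> 'a" where
  "commutator x y = x * y - y * x"


section \<open>The quivers \<open>Q\<^sub>r\<close>\<close>

datatype vertex = Vtx1 | Vtx2

text \<open>\<open>Arr_a'\<close> is the loop \<open>a\<^sup>*\<close>.\<close>

datatype arr = Arr_a | Arr_a' | Arr_b nat | Arr_d nat

fun src :: "arr \<Rightarrow> vertex" where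
  "src Arr_a = Vtx1" | "src Arr_a' = Vtx1" | "src (Arr_b i) = Vtx1" | "src (Arr_d i) = Vtx2"

fun tgt :: "arr \<Rightarrow> vertex" where
  "tgt Arr_a = Vtx1" | "tgt Arr_a' = Vtx1" | "tgt (Arr_b i) = Vtx2" | "tgt (Arr_d i) = Vtx1"

type_synonym qalg = "(vertex, arr) palg"

definition quiver :: "nat \<Rightarrow> (vertex, arr) pre_digraph" where
  "quiver r = \<lparr>verts = {Vtx1, Vtx2},
               arcs = {Arr_a, Arr_a'} \<union> Arr_b ` {1..r} \<union> Arr_d ` {1..r},
               tail = src, head = tgt\<rparr>"

text \<open>
  The path algebra of \<open>loop_quiver\<close> is the free algebra \<open>\<complex>\<langle>a, a\<^sup>*\<rangle>\<close>, with unit \<open>e\<^sub>1\<close>. The vertex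
  \<open>2\<close> is left out here, so this is not \<open>quiver 0\<close>.
\<close>

definition loop_quiver :: "(vertex, arr) pre_digraph" where
  "loop_quiver = \<lparr>verts = {Vtx1}, arcs = {Arr_a, Arr_a'}, tail = src, head = tgt\<rparr>"

abbreviation CQ :: "nat \<Rightarrow> qalg set" where
  "CQ r \<equiv> path_algebra (quiver r)"

abbreviation CQ_loops :: "qalg set" where
  "CQ_loops \<equiv> path_algebra loop_quiver"

definition arrow :: "arr \<Rightarrow> qalg" where
  "arrow \<eta> = path_elt (src \<eta>, [\<eta>], tgt \<eta>)"

abbreviation "e1 :: qalg \<equiv> triv Vtx1"
abbreviation "e2 :: qalg \<equiv> triv Vtx2"
abbreviation "el_a \<equiv> arrow Arr_a"
abbreviation "el_a' \<equiv> arrow Arr_a'"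
abbreviation "el_b \<alpha> \<equiv> arrow (Arr_b \<alpha>)"
abbreviation "el_d \<alpha> \<equiv> arrow (Arr_d \<alpha>)"

definition el_x :: "nat \<Rightarrow> qalg" where "el_x i = - el_d (2 * i - 1)"
definition el_x' :: "nat \<Rightarrow> qalg" where "el_x' i = el_b (2 * i - 1)"
definition el_y :: "nat \<Rightarrow> qalg" where "el_y j = el_b (2 * j)"
definition el_y' :: "nat \<Rightarrow> qalg" where "el_y' j = el_d (2 * j)"

text \<open>\<open>(r + 1) div 2\<close> and \<open>r div 2\<close> are \<open>r / 2\<close> rounded up and down.\<close>

definition c_elt :: "nat \<Rightarrow> qalg" where
  "c_elt r = commutator el_a el_a'
     + (\<Sum>i = 1..(r + 1) div 2. commutator (el_x i) (el_x' i))
     + (\<Sum>j = 1..r div 2. commutator (el_y j) (el_y' j))"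


section \<open>Symplectic automorphisms\<close>

definition Aut_sympl :: "nat \<Rightarrow> (qalg \<Rightarrow> qalg) set" where
  "Aut_sympl r = {\<psi> \<in> algebra_aut (quiver r). \<psi> e1 = e1 \<and> \<psi> e2 = e2 \<and> \<psi> (c_elt r) = c_elt r}"

definition Aut_sympl_loops :: "(qalg \<Rightarrow> qalg) set" where
  "Aut_sympl_loops = {\<phi> \<in> algebra_aut loop_quiver.
     \<phi> (commutator el_a el_a') = commutator el_a el_a'}"

text \<open>
  The copy of \<^const>\<open>Aut_sympl_loops\<close> in \<^const>\<open>Aut_sympl\<close>: the extensions that act as the
  identity on all \<open>b\<^sub>\<alpha>\<close> and \<open>d\<^sub>\<alpha>\<close>.
\<close>

definition Aut_sympl_loops_emb :: "nat \<Rightarrow> (qalg \<Rightarrow> qalg) set" where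
  "Aut_sympl_loops_emb r = {\<psi> \<in> Aut_sympl r.
     restrict \<psi> CQ_loops \<in> Aut_sympl_loops \<and>
     (\<forall>\<alpha> \<in> {1..r}. \<psi> (el_b \<alpha>) = el_b \<alpha> \<and> \<psi> (el_d \<alpha>) = el_d \<alpha>)}"

inductive_set arrow_ideal :: "nat \<Rightarrow> qalg set" for r where
  vtx: "e2 \<in> arrow_ideal r"
| b: "\<alpha> \<in> {1..r} \<Longrightarrow> el_b \<alpha> \<in> arrow_ideal r"
| d: "\<alpha> \<in> {1..r} \<Longrightarrow> el_d \<alpha> \<in> arrow_ideal r"
| add: "x \<in> arrow_ideal r \<Longrightarrow> y \<in> arrow_ideal r \<Longrightarrow> x + y \<in> arrow_ideal r"
| mult_left: "z \<in> CQ r \<Longrightarrow> x \<in> arrow_ideal r \<Longrightarrow> z * x \<in> arrow_ideal r"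
| mult_right: "z \<in> CQ r \<Longrightarrow> x \<in> arrow_ideal r \<Longrightarrow> x * z \<in> arrow_ideal r"

text \<open>\<open>grp_K r\<close> consists of the reduced automorphisms: they induce the identity on the quotient.\<close>

definition grp_K :: "nat \<Rightarrow> (qalg \<Rightarrow> qalg) set" where
  "grp_K r = {\<psi> \<in> Aut_sympl r. \<forall>x \<in> CQ r. \<psi> x - x \<in> arrow_ideal r}"

text \<open>
  Affine means of total degree at most one in the arrows, so an affine \<open>\<psi>\<close> that is also reduced
  and symplectic fixes \<open>a\<close> and \<open>a\<^sup>*\<close> and acts on the \<open>b\<^sub>\<alpha>\<close> by a matrix in \<open>GL\<^sub>r(\<complex>)\<close> and on the
  \<open>d\<^sub>\<alpha>\<close> by its inverse.
\<close>

definition affine_aut :: "nat \<Rightarrow> (qalg \<Rightarrow> qalg) \<Rightarrow> bool" where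
  "affine_aut r \<psi> \<longleftrightarrow>
     (\<forall>\<eta> \<in> arcs (quiver r). \<forall>(u, p, v) \<in> paths_of (\<psi> (arrow \<eta>)). length p \<le> 1)"

definition Aff_red :: "nat \<Rightarrow> (qalg \<Rightarrow> qalg) set" where
  "Aff_red r = {\<psi> \<in> grp_K r. affine_aut r \<psi>}"

definition word :: "qalg list \<Rightarrow> qalg" where
  "word ws = foldr (*) ws e1"

text \<open>The derivative of a cyclic word with respect to the letter \<open>z\<close>.\<close>

definition cyclic_deriv :: "qalg \<Rightarrow> qalg list \<Rightarrow> qalg" where
  "cyclic_deriv z ws = (\<Sum>k | k < length ws \<and> ws ! k = z. word (drop (Suc k) ws @ take k ws))"

definition poly_a :: "complex poly \<Rightarrow> qalg" where
  "poly_a q = (\<Sum>i\<le>degree q. scale (Polynomial.coeff q i) (word (replicate i el_a)))"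

definition b11 :: qalg where
  "b11 = el_x 1 * el_y 1"

definition deriv_poly_b11 :: "complex poly \<Rightarrow> qalg" where
  "deriv_poly_b11 q =
     (\<Sum>i\<le>degree q. scale (Polynomial.coeff q i) (cyclic_deriv el_a (replicate i el_a @ [b11])))"

text \<open>
  \<open>\<Lambda>(q(a) b\<^sub>1\<^sub>1)\<close>, as a relation because an automorphism is determined by its values on the arrows.
  Note that \<open>x\<^sub>1\<^sup>* = b\<^sub>1\<close> and \<open>y\<^sub>1\<^sup>* = d\<^sub>2\<close>.
\<close>

definition is_Lambda :: "nat \<Rightarrow> complex poly \<Rightarrow> (qalg \<Rightarrow> qalg) \<Rightarrow> bool" where
  "is_Lambda r q \<psi> \<longleftrightarrow> \<psi> \<in> Aut_sympl r \<and>
     \<psi> el_a' = el_a' + deriv_poly_b11 q \<and>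
     \<psi> (el_x' 1) = el_x' 1 + el_y 1 * poly_a q \<and>
     \<psi> (el_y' 1) = el_y' 1 + poly_a q * el_x 1 \<and>
     (\<forall>\<eta> \<in> arcs (quiver r) - {Arr_a', Arr_b 1, Arr_d 2}. \<psi> (arrow \<eta>) = arrow \<eta>)"

definition grp_P :: "nat \<Rightarrow> (qalg \<Rightarrow> qalg) set" where
  "grp_P r = generate (BijGroup (CQ r)) (Aff_red r \<union> {\<psi>. r \<ge> 2 \<and> (\<exists>q. is_Lambda r q \<psi>)})"

text \<open>
  The subgroup generated by the two factors. For \<open>r \<ge> 2\<close> the products \<open>\<psi>\<^sub>0 \<circ> \<psi>\<close> of their
  elements do not form a subgroup: all of \<open>grp_P r\<close> fixes \<open>a\<close>, so \<open>grp_P r\<close> is not normalised by the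
  automorphism \<open>a \<mapsto> a\<^sup>*\<close>, \<open>a\<^sup>* \<mapsto> -a\<close>.
\<close>

definition grp_calP :: "nat \<Rightarrow> (qalg \<Rightarrow> qalg) set" where
  "grp_calP r = generate (BijGroup (CQ r)) (Aut_sympl_loops_emb r \<union> grp_P r)"


section \<open>Representations and the action on orbits\<close>

type_synonym point = "complex mat \<times> complex mat \<times> complex mat \<times> complex mat"

definition rep_space :: "nat \<Rightarrow> nat \<Rightarrow> point set" where
  "rep_space n r = carrier_mat n n \<times> carrier_mat n n \<times> carrier_mat n r \<times> carrier_mat r n"

fun moment :: "point \<Rightarrow> complex mat" where
  "moment (X, Y, v, w) = X * Y - Y * X - v * w"

fun GL_orbit :: "nat \<Rightarrow> point \<Rightarrow> point set" where
  "GL_orbit n (X, Y, v, w) = {(g * X * h, g * Y * h, g * v, w * h) | g h.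
     g \<in> carrier_mat n n \<and> h \<in> carrier_mat n n \<and> inverts_mat g h \<and> inverts_mat h g}"

definition moment_fibre :: "complex \<Rightarrow> nat \<Rightarrow> nat \<Rightarrow> point set" where
  "moment_fibre \<tau> n r = {m \<in> rep_space n r. moment m = \<tau> \<cdot>\<^sub>m 1\<^sub>m n}"

definition calC :: "complex \<Rightarrow> nat \<Rightarrow> nat \<Rightarrow> point set set" where
  "calC \<tau> n r = GL_orbit n ` moment_fibre \<tau> n r"

definition calR :: "complex \<Rightarrow> nat \<Rightarrow> nat \<Rightarrow> point set set" where
  "calR \<tau> n r = {p \<in> calC \<tau> n r.
     \<exists>(X, Y, v, w) \<in> p. card (spectrum X) = n \<or> card (spectrum Y) = n}"

fun rep_dim :: "nat \<Rightarrow> vertex \<Rightarrow> nat" where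
  "rep_dim n Vtx1 = n" | "rep_dim n Vtx2 = 1"

text \<open>Arrows are numbered from \<open>1\<close>, rows and columns from \<open>0\<close>.\<close>

fun rep_arr :: "point \<Rightarrow> arr \<Rightarrow> complex mat" where
  "rep_arr (X, Y, v, w) Arr_a = X"
| "rep_arr (X, Y, v, w) Arr_a' = Y"
| "rep_arr (X, Y, v, w) (Arr_b \<alpha>) = mat_of_row (row w (\<alpha> - 1))"
| "rep_arr (X, Y, v, w) (Arr_d \<alpha>) = mat_of_cols (dim_row v) [col v (\<alpha> - 1)]"

fun rep_path :: "nat \<Rightarrow> point \<Rightarrow> vertex \<Rightarrow> arr list \<Rightarrow> complex mat" where
  "rep_path n m u [] = 1\<^sub>m (rep_dim n u)"
| "rep_path n m u (\<eta> # p) = rep_path n m (tgt \<eta>) p * rep_arr m \<eta>"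

text \<open>The component \<open>u \<rightarrow> v\<close> of the endomorphism by which \<open>x\<close> acts.\<close>

definition rep_elt :: "nat \<Rightarrow> point \<Rightarrow> vertex \<Rightarrow> vertex \<Rightarrow> qalg \<Rightarrow> complex mat" where
  "rep_elt n m u v x = mat (rep_dim n v) (rep_dim n u) (\<lambda>ij.
     \<Sum>p | (u, p, v) \<in> paths_of x. pcoeff x (u, p, v) * rep_path n m u p $$ ij)"

definition act :: "nat \<Rightarrow> nat \<Rightarrow> point \<Rightarrow> (qalg \<Rightarrow> qalg) \<Rightarrow> point" where
  "act n r m \<psi> =
     (rep_elt n m Vtx1 Vtx1 (\<psi> el_a),
      rep_elt n m Vtx1 Vtx1 (\<psi> el_a'),
      mat n r (\<lambda>(i, j). rep_elt n m Vtx2 Vtx1 (\<psi> (el_d (j + 1))) $$ (i, 0)),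
      mat r n (\<lambda>(i, j). rep_elt n m Vtx1 Vtx2 (\<psi> (el_b (i + 1))) $$ (0, j)))"

text \<open>
  For \<open>\<psi>\<close> in \<^const>\<open>Aut_sympl\<close>, \<^const>\<open>act\<close> commutes with \<open>GL\<^sub>n\<close>, so the image of an orbit is an orbit.
\<close>

definition orbit_act :: "nat \<Rightarrow> nat \<Rightarrow> point set \<Rightarrow> (qalg \<Rightarrow> qalg) \<Rightarrow> point set" where
  "orbit_act n r p \<psi> = (\<lambda>m. act n r m \<psi>) ` p"

end

theory Submission
  imports Defs
begin

text \<open>
  All points are moved to one base point. If \<open>X\<close> has distinct eigenvalues, diagonalise it. Conjugates
  of \<open>\<Lambda>(q(a) b\<^sub>1\<^sub>1)\<close> by permutations of the arrows act as elementary operations on the rows of \<open>v\<close> and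
  the columns of \<open>w\<close>, with coefficients that interpolation makes independent at the different
  eigenvalues, so \<open>v\<close> and \<open>w\<close> can be concentrated in the first column and row. Then the moment
  equation fixes \<open>Y\<close> off its diagonal, the diagonal is changed at will by \<open>a\<^sup>* \<mapsto> a\<^sup>* + q(a)\<close>, and the
  orbit depends on the spectrum of \<open>X\<close> only.

  For every monic \<open>\<chi>\<close> of degree \<open>n\<close> the space of polynomials of degree less than \<open>n\<close>, with \<open>X\<close>
  multiplication by \<open>z\<close> modulo \<open>\<chi>\<close> and \<open>Y = -\<tau> d/dz\<close>, is such a point with spectrum the roots of \<open>\<chi>\<close>.
  Here \<open>Y\<close> is a nilpotent Jordan block that does not depend on \<open>\<chi>\<close>. An invertible polynomial in \<open>Y\<close>
  conjugates \<open>v\<close> and \<open>w\<close> to those of another \<open>\<chi>\<close>. Afterwards the two matrices \<open>X\<close> differ by an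
  element of the commutant of \<open>Y\<close>, hence by a polynomial in \<open>Y\<close>, which \<open>a \<mapsto> a + q(a\<^sup>*)\<close> removes.
\<close>

section \<open>Linear structure of path algebras\<close>

text \<open>Permutations, the automorphisms \<open>Lambda\<close> and the shifts of a' (the starred
  loop) all fix a, so on their own they never change the spectrum of \<open>X\<close>. Points with
  different spectra are joined through a point where \<open>Y\<close> is independent of the
  spectrum: exchanging the two loops turns a shift of a' into a shift of a, which does move
  \<open>X\<close>.

  The elimination on \<open>v\<close> and \<open>w\<close> starts because tau is nonzero. For
  diagonal \<open>X\<close> the commutator [X, Y] has zero diagonal, so the diagonal of the moment
  equation says that row i of \<open>v\<close> times column i of \<open>w\<close> is -tau; neither
  can vanish.

  The nilpotent points come from the canonical pair z and -tau d/dz on C[z], whose commutator is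
  tau. Reduction modulo chi changes z only on the top basis vector, and cutting off at degree n
  makes the commutator fail only there. The defect of the moment equation is therefore confined to
  one column, which is exactly what a single pair of \<open>v\<close> and \<open>w\<close> can
  supply; its trace forces the constant -n tau.

  Every step is invertible, so reachability is an equivalence relation and it suffices to join each
  point to one base point. The moment equation survives every step because the moment is the value
  of \<open>c_elt r\<close> at vertex 1.\<close>

lemma palg_eqI: "(\<And>P. pcoeff x P = pcoeff y P) \<Longrightarrow> x = y"
  by (metis pcoeffs_inject poly_mapping_eqI)

lemma pcoeff_add [simp]: "pcoeff (x + y) P = pcoeff x P + pcoeff y P"
  by transfer (simp add: lookup_add)

lemma pcoeff_minus [simp]: "pcoeff (x - y) P = pcoeff x P - pcoeff y P"
  by transfer (simp add: lookup_minus)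

lemma pcoeff_uminus [simp]: "pcoeff (- x) P = - pcoeff x P"
  by transfer simp

lemma pcoeff_0 [simp]: "pcoeff 0 P = 0"
  by transfer simp

lemma pcoeff_scale [simp]: "pcoeff (scale c x) P = c * pcoeff x P"
  by transfer (simp add: Poly_Mapping.map.rep_eq when_def)

lemma pcoeff_path_elt [simp]: "pcoeff (path_elt P) Q = (if P = Q then 1 else 0)"
  by (simp add: path_elt_def Abs_palg_inverse lookup_single when_def)

lemma scale_simps [simp]:
  "scale c 0 = 0" "scale 0 x = 0" "scale 1 x = x" "scale c (scale d x) = scale (c * d) x"
  "scale c (- x) = - scale c x" "scale (- c) x = - scale c x"
  by (auto intro!: palg_eqI)

lemma scale_add_right: "scale c (x + y) = scale c x + scale c y"
  and scale_add_left: "scale (c + d) x = scale c x + scale d x"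
  and scale_diff_right: "scale c (x - y) = scale c x - scale c y"
  by (auto intro!: palg_eqI simp: algebra_simps)

lemma scale_sum: "scale c (sum f A) = (\<Sum>i\<in>A. scale c (f i))"
  by (induction A rule: infinite_finite_induct) (auto simp: scale_add_right)

lemma palg_induct [case_names zero path add]:
  assumes "P 0" "\<And>c Q. P (scale c (path_elt Q))" "\<And>x y. P x \<Longrightarrow> P y \<Longrightarrow> P (x + y)"
  shows "P x"
proof -
  have "P (Abs_palg f)" for f
  proof (induction f rule: finsupp_induct)
    case zero
    then show ?case using assms(1) by (simp add: zero_palg_def)
  next
    case (single k c)
    have "Abs_palg (Poly_Mapping.single k c) = scale c (path_elt k)"
      by (rule palg_eqI) (simp add: Abs_palg_inverse lookup_single when_def)
    then show ?case using assms(2) by simp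
  next
    case (add f g)
    have "Abs_palg (f + g) = Abs_palg f + Abs_palg g"
      by (rule palg_eqI) (simp add: Abs_palg_inverse lookup_add)
    then show ?case using assms(3) add by simp
  qed
  then show ?thesis by (metis pcoeffs_inverse)
qed

lemma path_elt_mult:
  "path_elt (m', p, v) * path_elt (u, q, m) = (if m = m' then path_elt (u, q @ p, v) else 0)"
  unfolding path_elt_def times_palg_def
  by (simp add: Abs_palg_inverse convolve_single zero_palg_def)

lemma scale_path_elt_mult:
  "scale c (path_elt P) * scale d (path_elt Q) = scale (c * d) (path_elt P * path_elt Q)"
proof -
  have *: "scale e (path_elt R) = Abs_palg (Poly_Mapping.single R e)" for e R
    by (rule palg_eqI) (simp add: Abs_palg_inverse lookup_single when_def)
  show ?thesis
    unfolding *
    by (cases P; cases Q) (auto simp: times_palg_def Abs_palg_inverse convolve_single path_elt_def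
        * zero_palg_def[symmetric] intro!: palg_eqI simp: lookup_single when_def)
qed

lemma scale_mult_left [simp]: "scale c x * y = scale c (x * y)"
proof (induction x rule: palg_induct)
  case (path d Q)
  show ?case
    by (induction y rule: palg_induct)
      (simp_all add: scale_path_elt_mult distrib_left scale_add_right mult.assoc)
qed (simp_all add: distrib_right scale_add_right)

lemma scale_mult_right [simp]: "x * scale c y = scale c (x * y)"
proof (induction x rule: palg_induct)
  case (path d Q)
  have *: "path_elt Q * scale e (path_elt R) = scale e (path_elt Q * path_elt R)" for e R
    using scale_path_elt_mult[of 1 Q e R] by simp
  show ?case
    by (induction y rule: palg_induct)
      (simp_all add: * distrib_left scale_add_right mult_ac)
qed (simp_all add: distrib_right scale_add_right)

lemma finite_paths_of [simp]: "finite (paths_of x)"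
  by (simp add: paths_of_def)

lemma in_paths_of: "P \<in> paths_of x \<longleftrightarrow> pcoeff x P \<noteq> 0"
  by (simp add: paths_of_def in_keys_iff)

definition lin_ext :: "(('v, 'e) path \<Rightarrow> ('w, 'f) palg) \<Rightarrow> ('v, 'e) palg \<Rightarrow> ('w, 'f) palg" where
  "lin_ext h x = (\<Sum>P\<in>paths_of x. scale (pcoeff x P) (h P))"

lemma lin_ext_superset:
  "finite S \<Longrightarrow> paths_of x \<subseteq> S \<Longrightarrow> lin_ext h x = (\<Sum>P\<in>S. scale (pcoeff x P) (h P))"
  unfolding lin_ext_def by (rule sum.mono_neutral_left) (auto simp: in_paths_of)

lemma lin_ext_add: "lin_ext h (x + y) = lin_ext h x + lin_ext h y"
proof -
  let ?S = "paths_of x \<union> paths_of y"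
  have "paths_of (x + y) \<subseteq> ?S" by (auto simp: in_paths_of)
  then show ?thesis
    by (simp add: lin_ext_superset[of ?S] scale_add_left sum.distrib)
qed

lemma lin_ext_0 [simp]: "lin_ext h 0 = 0"
  by (simp add: lin_ext_def in_paths_of)

lemma lin_ext_scale: "lin_ext h (scale c x) = scale c (lin_ext h x)"
proof -
  have "paths_of (scale c x) \<subseteq> paths_of x" by (auto simp: in_paths_of)
  then show ?thesis
    by (simp add: lin_ext_superset[of "paths_of x"] scale_sum)
qed

lemma lin_ext_path_elt [simp]: "lin_ext h (path_elt P) = h P"
  by (simp add: lin_ext_superset[of "{P}"] in_paths_of subset_iff)

section \<open>Substitution homomorphisms\<close>

definition sub_quiver :: "vertex set \<Rightarrow> arr set \<Rightarrow> (vertex, arr) pre_digraph" where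
  "sub_quiver V A = \<lparr>verts = V, arcs = A, tail = src, head = tgt\<rparr>"

lemma quiver_eq: "quiver r = sub_quiver UNIV (arcs (quiver r))"
  by (auto simp: quiver_def sub_quiver_def intro: vertex.exhaust)

lemma loop_quiver_eq: "loop_quiver = sub_quiver {Vtx1} {Arr_a, Arr_a'}"
  by (auto simp: loop_quiver_def sub_quiver_def)

text \<open>A form of the walk condition without a graph argument: it is the same predicate for all
  subquivers, which differ only in the vertices and arrows that they allow.\<close>

fun cas :: "vertex \<Rightarrow> arr list \<Rightarrow> vertex \<Rightarrow> bool" where
  "cas u [] v = (u = v)"
| "cas u (\<eta> # p) v = (src \<eta> = u \<and> cas (tgt \<eta>) p v)"

lemma cas_append: "cas u (p @ q) v \<longleftrightarrow> (\<exists>m. cas u p m \<and> cas m q v)"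
  by (induction p arbitrary: u) auto

lemma awalk_sub_quiver:
  "pre_digraph.awalk (sub_quiver V A) u p v \<longleftrightarrow> u \<in> V \<and> set p \<subseteq> A \<and> cas u p v"
proof -
  have "pre_digraph.cas (sub_quiver V A) u p v = cas u p v"
    by (induction p arbitrary: u) (simp_all add: pre_digraph.cas.simps sub_quiver_def)
  then show ?thesis
    by (simp add: pre_digraph.awalk_def) (simp add: sub_quiver_def)
qed

text \<open>One theory for both path algebras: \<open>quiver r\<close> is the instance with all
  vertices, \<open>loop_quiver\<close> the one with vertex 1 and the two loops.\<close>

locale closed_subquiver =
  fixes V :: "vertex set" and A :: "arr set"
  assumes ends: "\<eta> \<in> A \<Longrightarrow> src \<eta> \<in> V" "\<eta> \<in> A \<Longrightarrow> tgt \<eta> \<in> V"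
begin

abbreviation "PA \<equiv> path_algebra (sub_quiver V A)"

lemma in_PA: "x \<in> PA \<longleftrightarrow> (\<forall>u p v. pcoeff x (u, p, v) \<noteq> 0 \<longrightarrow> u \<in> V \<and> set p \<subseteq> A \<and> cas u p v)"
  by (fastforce simp: path_algebra_def in_paths_of awalk_sub_quiver)

lemma PA_0 [simp]: "0 \<in> PA"
  and PA_add: "x \<in> PA \<Longrightarrow> y \<in> PA \<Longrightarrow> x + y \<in> PA"
  and PA_diff: "x \<in> PA \<Longrightarrow> y \<in> PA \<Longrightarrow> x - y \<in> PA"
  and PA_uminus: "x \<in> PA \<Longrightarrow> - x \<in> PA"
  and PA_scale: "x \<in> PA \<Longrightarrow> scale c x \<in> PA"
  unfolding in_PA
  by (simp, metis pcoeff_add add.right_neutral, metis pcoeff_minus diff_0_right, simp, simp, blast)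

lemma PA_sum: "(\<And>i. i \<in> I \<Longrightarrow> f i \<in> PA) \<Longrightarrow> sum f I \<in> PA"
  by (induction I rule: infinite_finite_induct) (auto intro: PA_add)

lemma PA_path_elt: "u \<in> V \<Longrightarrow> set p \<subseteq> A \<Longrightarrow> cas u p v \<Longrightarrow> path_elt (u, p, v) \<in> PA"
  by (simp add: in_PA)

lemma PA_triv: "v \<in> V \<Longrightarrow> triv v \<in> PA"
  by (simp add: triv_def PA_path_elt)

lemma PA_arrow: "\<eta> \<in> A \<Longrightarrow> arrow \<eta> \<in> PA"
  by (simp add: arrow_def PA_path_elt ends)

lemma PA_induct [consumes 1, case_names zero path add]:
  assumes x: "x \<in> PA"
    and "P 0" "\<And>c u p v. u \<in> V \<Longrightarrow> set p \<subseteq> A \<Longrightarrow> cas u p v \<Longrightarrow> P (scale c (path_elt (u, p, v)))"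
    "\<And>x y. x \<in> PA \<Longrightarrow> y \<in> PA \<Longrightarrow> P x \<Longrightarrow> P y \<Longrightarrow> P (x + y)"
  shows "P x"
proof -
  have "x = (\<Sum>Q\<in>paths_of x. scale (pcoeff x Q) (path_elt Q))"
  proof -
    have "lin_ext path_elt x = x"
      by (induction x rule: palg_induct) (simp_all add: lin_ext_add lin_ext_scale)
    then show ?thesis by (simp add: lin_ext_def)
  qed
  moreover have "sum (\<lambda>Q. scale (pcoeff x Q) (path_elt Q)) S \<in> PA \<and>
      P (sum (\<lambda>Q. scale (pcoeff x Q) (path_elt Q)) S)" if "S \<subseteq> paths_of x" for S
    using finite_subset[OF that finite_paths_of] that
  proof (induction S rule: finite_induct)
    case empty
    then show ?case using assms(2) by simp
  next
    case (insert Q S)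
    obtain u p v where Q: "Q = (u, p, v)" by (cases Q)
    have "u \<in> V" "set p \<subseteq> A" "cas u p v"
      using insert.prems x by (auto simp: in_PA in_paths_of Q)
    then show ?case
      using insert by (auto simp: Q intro!: PA_add PA_scale PA_path_elt assms(3,4))
  qed
  ultimately show ?thesis by (metis order_refl)
qed

lemma PA_mult:
  assumes "x \<in> PA" "y \<in> PA"
  shows "x * y \<in> PA"
  using assms
proof (induction x rule: PA_induct)
  case (path c u p v)
  from path(4) path(1-3) show ?case
  proof (induction y rule: PA_induct)
    case (path d u' q v')
    then show ?case
      by (auto simp: path_elt_mult cas_append intro!: PA_scale PA_path_elt)
  qed (simp_all add: distrib_left PA_add PA_scale scale_add_right)
qed (simp_all add: distrib_right PA_add)

lemma path_elt_Cons: "src \<eta> = u \<Longrightarrow> path_elt (u, \<eta> # p, v) = path_elt (tgt \<eta>, p, v) * arrow \<eta>"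
  by (simp add: arrow_def path_elt_mult)

text \<open>Statements about homomorphisms need checking on trivial paths and arrows only. Zero has
  no case of its own because it is 0 times a trivial path.\<close>

lemma PA_gen_induct [consumes 1, case_names triv arrow add scale mult]:
  assumes x: "x \<in> PA"
    and t: "\<And>v. v \<in> V \<Longrightarrow> P (triv v)"
    and a: "\<And>\<eta>. \<eta> \<in> A \<Longrightarrow> P (arrow \<eta>)"
    and add: "\<And>x y. x \<in> PA \<Longrightarrow> y \<in> PA \<Longrightarrow> P x \<Longrightarrow> P y \<Longrightarrow> P (x + y)"
    and s: "\<And>c x. x \<in> PA \<Longrightarrow> P x \<Longrightarrow> P (scale c x)"
    and m: "\<And>x y. x \<in> PA \<Longrightarrow> y \<in> PA \<Longrightarrow> P x \<Longrightarrow> P y \<Longrightarrow> P (x * y)"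
    and "V \<noteq> {}"
  shows "P x"
  using x
proof (induction x rule: PA_induct)
  case zero
  obtain v where "v \<in> V" using \<open>V \<noteq> {}\<close> by blast
  then have "P (scale 0 (triv v))" by (intro s t PA_triv)
  then show ?case by simp
next
  case (path c u p v)
  have "P (path_elt (u, p, v))"
    using path
  proof (induction p arbitrary: u)
    case Nil
    then show ?case using t by (auto simp: triv_def)
  next
    case (Cons \<eta> p)
    then have "P (path_elt (tgt \<eta>, p, v))" by (auto simp: ends)
    with Cons.prems show ?case
      by (auto simp: path_elt_Cons ends intro!: m a PA_path_elt PA_arrow)
  qed
  with path show ?case by (intro s PA_path_elt)
qed (use add in auto)

end

section \<open>Homomorphic extension of maps on arrows\<close>

primrec path_subst :: "(arr \<Rightarrow> qalg) \<Rightarrow> vertex \<Rightarrow> arr list \<Rightarrow> qalg" where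
  "path_subst f u [] = triv u"
| "path_subst f u (\<eta> # p) = path_subst f (tgt \<eta>) p * f \<eta>"

definition subst :: "(arr \<Rightarrow> qalg) \<Rightarrow> qalg \<Rightarrow> qalg" where
  "subst f = lin_ext (\<lambda>(u, p, v). path_subst f u p)"

lemma subst_0 [simp]: "subst f 0 = 0"
  and subst_add: "subst f (x + y) = subst f x + subst f y"
  and subst_scale: "subst f (scale c x) = scale c (subst f x)"
  and subst_triv [simp]: "subst f (triv v) = triv v"
  by (simp_all add: subst_def lin_ext_add lin_ext_scale triv_def)

lemma subst_uminus: "subst f (- x) = - subst f x"
  by (metis subst_add subst_0 add.right_inverse add.inverse_unique)

lemma subst_diff: "subst f (x - y) = subst f x - subst f y"
  using subst_add[of f x "- y"] by (simp add: subst_uminus)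

lemma subst_sum: "subst f (sum g I) = (\<Sum>i\<in>I. subst f (g i))"
  by (induction I rule: infinite_finite_induct) (auto simp: subst_add)

lemma triv_mult: "triv u * triv v = (if u = v then triv u else 0)"
  by (auto simp: triv_def path_elt_mult)

lemma arrow_triv [simp]: "arrow \<eta> * triv v = (if src \<eta> = v then arrow \<eta> else 0)"
  and triv_arrow [simp]: "triv v * arrow \<eta> = (if tgt \<eta> = v then arrow \<eta> else 0)"
  by (auto simp: triv_def arrow_def path_elt_mult)

text \<open>The end point conditions make the extension multiplicative: a product of paths that do
  not compose is 0, and so must be the product of their images.\<close>

locale arrow_map = closed_subquiver +
  fixes f :: "arr \<Rightarrow> qalg"
  assumes f_PA: "\<eta> \<in> A \<Longrightarrow> f \<eta> \<in> PA"
    and f_ends: "\<eta> \<in> A \<Longrightarrow> f \<eta> * triv (src \<eta>) = f \<eta>" "\<eta> \<in> A \<Longrightarrow> triv (tgt \<eta>) * f \<eta> = f \<eta>"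
begin

lemma subst_arrow [simp]: "\<eta> \<in> A \<Longrightarrow> subst f (arrow \<eta>) = f \<eta>"
  by (simp add: subst_def arrow_def f_ends)

lemma path_subst_triv: "set p \<subseteq> A \<Longrightarrow> cas u p v \<Longrightarrow> path_subst f u p * triv u = path_subst f u p"
  by (cases p) (auto simp: triv_mult mult.assoc f_ends)

lemma path_subst_append:
  "set p \<subseteq> A \<Longrightarrow> set q \<subseteq> A \<Longrightarrow> cas u q m \<Longrightarrow> cas m p v \<Longrightarrow>
     path_subst f u (q @ p) = path_subst f m p * path_subst f u q"
  by (induction q arbitrary: u) (auto simp: path_subst_triv mult.assoc)

lemma path_subst_orth:
  assumes "set p \<subseteq> A" "set q \<subseteq> A" "cas u q m" "cas m' p v" "m \<noteq> m'"
  shows "path_subst f m' p * path_subst f u q = 0"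
proof -
  have "triv m * path_subst f u q = path_subst f u q"
    using assms(2,3)
  proof (induction q arbitrary: u)
    case (Cons \<eta> q)
    then show ?case
      by (cases q) (auto simp: triv_mult f_ends mult.assoc[symmetric])
  qed (auto simp: triv_mult)
  moreover have "path_subst f m' p * triv m' = path_subst f m' p"
    using path_subst_triv assms by blast
  ultimately have "path_subst f m' p * path_subst f u q =
      path_subst f m' p * (triv m' * triv m) * path_subst f u q"
    by (metis mult.assoc)
  then show ?thesis using assms(5) by (simp add: triv_mult)
qed

lemma subst_mult:
  assumes "x \<in> PA" "y \<in> PA"
  shows "subst f (x * y) = subst f x * subst f y"
  using assms
proof (induction x rule: PA_induct)
  case (path c u p v)
  from path(4) path(1-3) show ?case
  proof (induction y rule: PA_induct)
    case (path d u' q v')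
    then show ?case
      by (auto simp: path_elt_mult subst_scale subst_def path_subst_append path_subst_orth lin_ext_scale)
  qed (simp_all add: distrib_left subst_add scale_add_right)
qed (simp_all add: distrib_right subst_add)

lemma subst_PA: "x \<in> PA \<Longrightarrow> subst f x \<in> PA"
proof (induction x rule: PA_induct)
  case (path c u p v)
  have "path_subst f u p \<in> PA"
    using path(1-3) by (induction p arbitrary: u) (auto simp: PA_triv f_PA ends intro!: PA_mult)
  then show ?case by (simp add: subst_scale PA_scale) (simp add: subst_def PA_scale)
qed (simp_all add: subst_add PA_add)

end

text \<open>The composite is again a homomorphism, so it is the identity as soon as it fixes the
  arrows. The bijectivity of all automorphisms constructed here rests on this.\<close>

lemma (in closed_subquiver) subst_inverse:
  assumes "arrow_map V A f" "arrow_map V A g" "x \<in> PA" "V \<noteq> {}"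
    and "\<And>\<eta>. \<eta> \<in> A \<Longrightarrow> subst g (f \<eta>) = arrow \<eta>"
  shows "subst g (subst f x) = x"
proof -
  interpret F: arrow_map V A f by fact
  interpret G: arrow_map V A g by fact
  show ?thesis
    using assms(3)
    by (induction x rule: PA_gen_induct)
      (simp_all add: subst_add subst_scale F.subst_mult G.subst_mult F.subst_PA assms)
qed

lemma (in closed_subquiver) subst_in_algebra_aut:
  assumes fg: "arrow_map V A f" "arrow_map V A g" and V: "V \<noteq> {}" "finite V"
    and inv: "\<And>\<eta>. \<eta> \<in> A \<Longrightarrow> subst g (f \<eta>) = arrow \<eta>" "\<And>\<eta>. \<eta> \<in> A \<Longrightarrow> subst f (g \<eta>) = arrow \<eta>"
  shows "restrict (subst f) PA \<in> algebra_aut (sub_quiver V A)"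
proof -
  interpret F: arrow_map V A f by fact
  interpret G: arrow_map V A g by fact
  have bij: "bij_betw (subst f) PA PA"
    by (rule bij_betwI[where g = "subst g"])
      (use F.subst_PA G.subst_PA subst_inverse fg V inv in auto)
  have unit: "(\<Sum>v\<in>V. triv v) \<in> PA" by (intro PA_sum PA_triv)
  show ?thesis
    using bij unit
    by (auto simp: algebra_aut_def Bij_def PA_add PA_mult PA_scale subst_add subst_scale F.subst_mult
        subst_sum sub_quiver_def[symmetric])
      (auto simp: sub_quiver_def subst_sum)
qed

section \<open>The two quivers as instances\<close>

lemma UNIV_vertex: "UNIV = {Vtx1, Vtx2}"
  by (auto intro: vertex.exhaust)

lemma arcs_quiver: "arcs (quiver r) = {Arr_a, Arr_a'} \<union> Arr_b ` {1..r} \<union> Arr_d ` {1..r}"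
  by (simp add: quiver_def)

global_interpretation CQ: closed_subquiver UNIV "arcs (quiver r)"
  rewrites "sub_quiver UNIV (arcs (quiver r)) = quiver r"
  for r
  by unfold_locales (simp_all add: quiver_eq[symmetric])

global_interpretation CQ_loops: closed_subquiver "{Vtx1}" "{Arr_a, Arr_a'}"
  rewrites "sub_quiver {Vtx1} {Arr_a, Arr_a'} = loop_quiver"
  by unfold_locales (auto simp: loop_quiver_eq)

lemma CQ_loops_subset: "CQ_loops \<subseteq> CQ r"
  by (auto simp: CQ_loops.in_PA CQ.in_PA arcs_quiver) blast

lemma CQ_arrow [simp]:
  "el_a \<in> CQ r" "el_a' \<in> CQ r"
  "\<alpha> \<in> {1..r} \<Longrightarrow> el_b \<alpha> \<in> CQ r" "\<alpha> \<in> {1..r} \<Longrightarrow> el_d \<alpha> \<in> CQ r"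
  "triv v \<in> CQ r"
  by (auto simp: arcs_quiver intro: CQ.PA_arrow CQ.PA_triv)

text \<open>For odd indices x = -d and its partner is b, for even ones y = b and its partner is d;
  in both cases the commutator is b d - d b, so the distinction by parity disappears. In the
  induction the new pair of arrows is an x-pair if \<open>r\<close> is even and a y-pair if
  \<open>r\<close> is odd.\<close>

lemma c_elt_eq:
  "c_elt r = commutator el_a el_a' + (\<Sum>\<alpha> = 1..r. el_b \<alpha> * el_d \<alpha> - el_d \<alpha> * el_b \<alpha>)"
proof (induction r)
  case 0
  then show ?case by (simp add: c_elt_def)
next
  case (Suc r)
  show ?case
  proof (cases "even r")
    case True
    then obtain k where "r = 2 * k" by blast
    then show ?thesis
      using Suc by (simp add: c_elt_def commutator_def el_x_def el_x'_def algebra_simps)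
  next
    case False
    then obtain k where "r = 2 * k + 1" using oddE by blast
    then show ?thesis
      using Suc by (simp add: c_elt_def commutator_def el_y_def el_y'_def algebra_simps)
  qed
qed

lemma c_elt_in_CQ: "c_elt r \<in> CQ r"
  unfolding c_elt_eq commutator_def
  by (intro CQ.PA_add CQ.PA_diff CQ.PA_mult CQ.PA_sum) auto

section \<open>The group of symplectic automorphisms\<close>

lemma algebra_autD:
  assumes "\<psi> \<in> algebra_aut (quiver r)"
  shows "\<psi> \<in> Bij (CQ r)"
    and "x \<in> CQ r \<Longrightarrow> \<psi> x \<in> CQ r"
    and "x \<in> CQ r \<Longrightarrow> y \<in> CQ r \<Longrightarrow> \<psi> (x + y) = \<psi> x + \<psi> y"
    and "x \<in> CQ r \<Longrightarrow> y \<in> CQ r \<Longrightarrow> \<psi> (x * y) = \<psi> x * \<psi> y"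
    and "x \<in> CQ r \<Longrightarrow> \<psi> (scale c x) = scale c (\<psi> x)"
  using assms by (auto simp: algebra_aut_def Bij_def bij_betw_def)

text \<open>\<open>grp_P\<close> and \<open>grp_calP\<close> are generated inside the group of all
  bijections. Through this lemma their elements are known to be automorphisms that fix
  \<open>c_elt r\<close>.\<close>

lemma subgroup_Aut_sympl: "subgroup (Aut_sympl r) (BijGroup (CQ r))"
proof -
  let ?G = "BijGroup (CQ r)"
  interpret G: group ?G by (rule group_BijGroup)
  have triv_sum: "(\<Sum>v\<in>verts (quiver r). triv v) = e1 + e2"
    by (simp add: quiver_def)
  have e: "e1 + e2 \<in> CQ r" by (intro CQ.PA_add) simp_all
  show ?thesis
  proof (rule G.subgroupI)
    show "Aut_sympl r \<subseteq> carrier ?G"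
      by (auto simp: Aut_sympl_def algebra_aut_def BijGroup_def)
    have "(\<lambda>x\<in>CQ r. x) \<in> Aut_sympl r"
      using e by (auto simp: Aut_sympl_def algebra_aut_def id_Bij CQ.PA_add CQ.PA_mult CQ.PA_scale
          triv_sum c_elt_in_CQ)
    then show "Aut_sympl r \<noteq> {}" by blast
  next
    fix \<psi> \<phi> assume \<psi>: "\<psi> \<in> Aut_sympl r" and \<phi>: "\<phi> \<in> Aut_sympl r"
    then have a: "\<psi> \<in> algebra_aut (quiver r)" "\<phi> \<in> algebra_aut (quiver r)"
      by (auto simp: Aut_sympl_def)
    note D = algebra_autD[OF a(1)] algebra_autD[OF a(2)]
    have "compose (CQ r) \<psi> \<phi> \<in> Aut_sympl r"
      using \<psi> \<phi> e D
      by (auto simp: Aut_sympl_def algebra_aut_def compose_Bij compose_eq CQ.PA_add CQ.PA_mult CQ.PA_scale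
          triv_sum c_elt_in_CQ)
    then show "\<psi> \<otimes>\<^bsub>?G\<^esub> \<phi> \<in> Aut_sympl r"
      using D by (simp add: BijGroup_def)
  next
    fix \<psi> assume \<psi>: "\<psi> \<in> Aut_sympl r"
    then have a: "\<psi> \<in> algebra_aut (quiver r)"
      by (auto simp: Aut_sympl_def)
    note D = algebra_autD[OF a]
    define \<phi> where "\<phi> = restrict (inv_into (CQ r) \<psi>) (CQ r)"
    have inv: "inv\<^bsub>?G\<^esub> \<psi> = \<phi>" using D(1) by (simp add: inv_BijGroup \<phi>_def)
    have bij: "bij_betw \<psi> (CQ r) (CQ r)" using D(1) by (simp add: Bij_def)
    have \<phi>_in: "\<phi> x \<in> CQ r" "\<psi> (\<phi> x) = x" if "x \<in> CQ r" for x
      using bij that by (auto simp: \<phi>_def bij_betw_def f_inv_into_f inv_into_into)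
    have \<phi>I: "\<phi> x = y" if "y \<in> CQ r" "\<psi> y = x" for x y
      using bij that by (auto simp: \<phi>_def bij_betw_def)
    have "\<phi> \<in> Bij (CQ r)" unfolding \<phi>_def using D(1) by (rule restrict_inv_into_Bij)
    then have "\<phi> \<in> Aut_sympl r"
      using \<psi> e D
      by (auto simp: Aut_sympl_def algebra_aut_def triv_sum c_elt_in_CQ \<phi>_in
          CQ.PA_add CQ.PA_mult CQ.PA_scale intro!: \<phi>I)
    then show "inv\<^bsub>?G\<^esub> \<psi> \<in> Aut_sympl r" by (simp add: inv)
  qed
qed

lemma BijGroup_mult:
  assumes "\<psi> \<in> Aut_sympl r" "\<phi> \<in> Aut_sympl r"
  shows "\<psi> \<otimes>\<^bsub>BijGroup (CQ r)\<^esub> \<phi> = compose (CQ r) \<psi> \<phi>"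
  using assms by (simp add: BijGroup_def Aut_sympl_def algebra_aut_def)

lemma grp_P_subset: "grp_P r \<subseteq> Aut_sympl r"
  unfolding grp_P_def
  by (rule group.generate_subgroup_incl[OF group_BijGroup _ subgroup_Aut_sympl])
    (auto simp: Aff_red_def grp_K_def is_Lambda_def)

lemma grp_calP_subset: "grp_calP r \<subseteq> Aut_sympl r"
  unfolding grp_calP_def
  by (rule group.generate_subgroup_incl[OF group_BijGroup _ subgroup_Aut_sympl])
    (use grp_P_subset in \<open>auto simp: Aut_sympl_loops_emb_def\<close>)

lemma subgroup_grp_calP: "subgroup (grp_calP r) (BijGroup (CQ r))"
  unfolding grp_calP_def
proof (rule group.generate_is_subgroup[OF group_BijGroup])
  show "Aut_sympl_loops_emb r \<union> grp_P r \<subseteq> carrier (BijGroup (CQ r))"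
    using grp_P_subset[of r] subgroup.subset[OF subgroup_Aut_sympl[of r]]
    by (auto simp: Aut_sympl_loops_emb_def)
qed

lemma grp_calP_compose:
  assumes "\<psi> \<in> grp_calP r" "\<phi> \<in> grp_calP r"
  shows "compose (CQ r) \<psi> \<phi> \<in> grp_calP r"
  using subgroup.m_closed[OF subgroup_grp_calP assms] grp_calP_subset assms
  by (metis BijGroup_mult subsetD)

lemma grp_calP_inverse:
  assumes "\<psi> \<in> grp_calP r"
  obtains \<phi> where "\<phi> \<in> grp_calP r" "compose (CQ r) \<psi> \<phi> = (\<lambda>x\<in>CQ r. x)"
proof -
  let ?G = "BijGroup (CQ r)"
  interpret G: group ?G by (rule group_BijGroup)
  let ?\<phi> = "inv\<^bsub>?G\<^esub> \<psi>"
  have \<phi>: "?\<phi> \<in> grp_calP r" by (rule subgroup.m_inv_closed[OF subgroup_grp_calP assms])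
  have \<psi>: "\<psi> \<in> carrier ?G" using subgroup.mem_carrier[OF subgroup_grp_calP assms] .
  have "\<psi> \<otimes>\<^bsub>?G\<^esub> ?\<phi> = \<one>\<^bsub>?G\<^esub>" using \<psi> by auto
  moreover have "\<one>\<^bsub>?G\<^esub> = (\<lambda>x\<in>CQ r. x)" by (simp add: BijGroup_def)
  ultimately show ?thesis
    using \<phi> assms grp_calP_subset that BijGroup_mult by (metis subsetD)
qed

lemma Aff_red_in_grp_calP: "\<psi> \<in> Aff_red r \<Longrightarrow> \<psi> \<in> grp_calP r"
  unfolding grp_calP_def grp_P_def by (auto intro!: generate.incl)

lemma Lambda_in_grp_calP: "r \<ge> 2 \<Longrightarrow> is_Lambda r q \<psi> \<Longrightarrow> \<psi> \<in> grp_calP r"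
  unfolding grp_calP_def grp_P_def by (rule generate.incl, rule UnI2, rule generate.incl) blast

lemma loops_emb_in_grp_calP: "\<psi> \<in> Aut_sympl_loops_emb r \<Longrightarrow> \<psi> \<in> grp_calP r"
  unfolding grp_calP_def by (auto intro!: generate.incl)

section \<open>Automorphisms given by their values on the arrows\<close>

abbreviation CQ_map :: "nat \<Rightarrow> (arr \<Rightarrow> qalg) \<Rightarrow> bool" where
  "CQ_map r \<equiv> arrow_map UNIV (arcs (quiver r))"

lemma CQ_mapI:
  assumes "\<And>\<eta>. \<eta> \<in> arcs (quiver r) \<Longrightarrow>
    f \<eta> \<in> CQ r \<and> f \<eta> * triv (src \<eta>) = f \<eta> \<and> triv (tgt \<eta>) * f \<eta> = f \<eta>"
  shows "CQ_map r f"
  by unfold_locales (use assms in \<open>auto simp: quiver_eq[symmetric]\<close>)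

lemma CQ_mapD:
  assumes "CQ_map r f"
  shows "\<eta> \<in> arcs (quiver r) \<Longrightarrow> subst f (arrow \<eta>) = f \<eta>"
    and "x \<in> CQ r \<Longrightarrow> y \<in> CQ r \<Longrightarrow> subst f (x * y) = subst f x * subst f y"
    and "x \<in> CQ r \<Longrightarrow> subst f x \<in> CQ r"
  using arrow_map.subst_arrow[OF assms] arrow_map.subst_mult[OF assms] arrow_map.subst_PA[OF assms]
  by (auto simp: quiver_eq[symmetric])

lemma CQ_map_inverse_in_algebra_aut:
  assumes "CQ_map r f" "CQ_map r g"
    and "\<And>\<eta>. \<eta> \<in> arcs (quiver r) \<Longrightarrow> subst g (f \<eta>) = arrow \<eta> \<and> subst f (g \<eta>) = arrow \<eta>"
  shows "restrict (subst f) (CQ r) \<in> algebra_aut (quiver r)"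
  by (rule CQ.subst_in_algebra_aut[OF assms(1,2)]) (use assms(3) in \<open>auto simp: UNIV_vertex\<close>)

lemma CQ_map_in_Aut_sympl:
  assumes "CQ_map r f" "CQ_map r g"
    and "\<And>\<eta>. \<eta> \<in> arcs (quiver r) \<Longrightarrow> subst g (f \<eta>) = arrow \<eta> \<and> subst f (g \<eta>) = arrow \<eta>"
    and "subst f (c_elt r) = c_elt r"
  shows "restrict (subst f) (CQ r) \<in> Aut_sympl r"
  using CQ_map_inverse_in_algebra_aut[OF assms(1-3)] assms(4)
  by (auto simp: Aut_sympl_def c_elt_in_CQ)

lemma subst_c_elt:
  assumes "CQ_map r f"
  shows "subst f (c_elt r) = commutator (f Arr_a) (f Arr_a') +
    (\<Sum>\<alpha> = 1..r. f (Arr_b \<alpha>) * f (Arr_d \<alpha>) - f (Arr_d \<alpha>) * f (Arr_b \<alpha>))"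
  unfolding c_elt_eq commutator_def
  by (simp add: subst_add subst_diff subst_sum CQ_mapD(1,2)[OF assms] arcs_quiver)

text \<open>\<open>e1\<close> is the unit of the loop algebra, although the unit of
  \<open>CQ r\<close> is \<open>e1 + e2\<close>. This supplies the end point conditions for images
  of loops.\<close>

lemma e1_loops: "x \<in> CQ_loops \<Longrightarrow> e1 * x = x" "x \<in> CQ_loops \<Longrightarrow> x * e1 = x"
  by (induction x rule: CQ_loops.PA_gen_induct)
    (auto simp: distrib_left distrib_right triv_mult mult.assoc[symmetric], metis mult.assoc)

text \<open>As all b and d are fixed, invariance of \<open>c_elt r\<close> reduces to that of the
  commutator of the loops. The inverse \<open>g\<close> is asked to stay in the loop algebra as
  well, since the restriction has to be onto there, not only on \<open>CQ r\<close>.\<close>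

lemma loops_map_in_grp_calP:
  assumes f: "f Arr_a \<in> CQ_loops" "f Arr_a' \<in> CQ_loops"
    and fid: "\<And>\<alpha>. f (Arr_b \<alpha>) = el_b \<alpha>" "\<And>\<alpha>. f (Arr_d \<alpha>) = el_d \<alpha>"
    and g: "g Arr_a \<in> CQ_loops" "g Arr_a' \<in> CQ_loops"
    and gid: "\<And>\<alpha>. g (Arr_b \<alpha>) = el_b \<alpha>" "\<And>\<alpha>. g (Arr_d \<alpha>) = el_d \<alpha>"
    and inv: "subst g (f Arr_a) = el_a" "subst g (f Arr_a') = el_a'"
      "subst f (g Arr_a) = el_a" "subst f (g Arr_a') = el_a'"
    and comm: "commutator (f Arr_a) (f Arr_a') = commutator el_a el_a'"
  shows "CQ_map r f" "restrict (subst f) (CQ r) \<in> grp_calP r"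
proof -
  have mapI: "CQ_map r f \<and> arrow_map {Vtx1} {Arr_a, Arr_a'} f"
    if "f Arr_a \<in> CQ_loops" "f Arr_a' \<in> CQ_loops"
      "\<And>\<alpha>. f (Arr_b \<alpha>) = el_b \<alpha>" "\<And>\<alpha>. f (Arr_d \<alpha>) = el_d \<alpha>" for f
  proof
    show "CQ_map r f"
      by (rule CQ_mapI) (use that CQ_loops_subset e1_loops in \<open>auto simp: arcs_quiver\<close>)
    show "arrow_map {Vtx1} {Arr_a, Arr_a'} f"
      by unfold_locales (use that e1_loops in \<open>auto simp: loop_quiver_eq\<close>)
  qed
  note F = mapI[OF f fid] and G = mapI[OF g gid]
  show "CQ_map r f" using F by blast
  have "restrict (subst f) (CQ r) \<in> Aut_sympl r"
  proof (rule CQ_map_in_Aut_sympl)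
    show "CQ_map r f" "CQ_map r g" using F G by auto
    show "subst f (c_elt r) = c_elt r"
      by (simp add: subst_c_elt[OF \<open>CQ_map r f\<close>] fid comm) (simp add: c_elt_eq)
    show "subst g (f \<eta>) = arrow \<eta> \<and> subst f (g \<eta>) = arrow \<eta>" if "\<eta> \<in> arcs (quiver r)" for \<eta>
      using that inv fid gid CQ_mapD(1)[OF \<open>CQ_map r f\<close>] CQ_mapD(1)[OF \<open>CQ_map r g\<close>]
      by (auto simp: arcs_quiver)
  qed
  moreover have "restrict (subst f) CQ_loops \<in> algebra_aut loop_quiver"
    by (rule CQ_loops.subst_in_algebra_aut[where g = g]) (use F G inv in auto)
  moreover have "subst f (commutator el_a el_a') = commutator el_a el_a'"
    using comm CQ_mapD(1,2)[OF \<open>CQ_map r f\<close>]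
    by (auto simp: commutator_def subst_diff arcs_quiver)
  moreover have "commutator el_a el_a' \<in> CQ_loops"
    unfolding commutator_def by (intro CQ_loops.PA_diff CQ_loops.PA_mult CQ_loops.PA_arrow) auto
  moreover from this have "commutator el_a el_a' \<in> CQ r" using CQ_loops_subset by blast
  moreover have "restrict (restrict (subst f) (CQ r)) CQ_loops = restrict (subst f) CQ_loops"
    using CQ_loops_subset[of r] by (auto simp: restrict_def fun_eq_iff)
  ultimately have "restrict (subst f) (CQ r) \<in> Aut_sympl_loops_emb r"
    using fid CQ_mapD(1)[OF \<open>CQ_map r f\<close>]
    by (simp add: Aut_sympl_loops_emb_def Aut_sympl_loops_def arcs_quiver)
  then show "restrict (subst f) (CQ r) \<in> grp_calP r" by (rule loops_emb_in_grp_calP)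
qed

section \<open>Generators\<close>

definition fourier_map :: "arr \<Rightarrow> qalg" where
  "fourier_map \<eta> = (case \<eta> of Arr_a \<Rightarrow> el_a' | Arr_a' \<Rightarrow> - el_a | _ \<Rightarrow> arrow \<eta>)"

lemma fourier_map_simps [simp]:
  "fourier_map Arr_a = el_a'" "fourier_map Arr_a' = - el_a"
  "fourier_map (Arr_b \<alpha>) = el_b \<alpha>" "fourier_map (Arr_d \<alpha>) = el_d \<alpha>"
  by (simp_all add: fourier_map_def)

lemma subst_arrow_single: "triv (tgt \<eta>) * f \<eta> = f \<eta> \<Longrightarrow> subst f (arrow \<eta>) = f \<eta>"
  by (simp add: subst_def arrow_def)

text \<open>It is symplectic because [a', -a] = [a, a']. It serves twice: to treat the points where
  \<open>Y\<close> has the distinct eigenvalues, and to conjugate shifts of a' into shifts of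
  a.\<close>

lemma fourier_in_grp_calP:
  "CQ_map r fourier_map" "restrict (subst fourier_map) (CQ r) \<in> grp_calP r"
proof -
  define g :: "arr \<Rightarrow> qalg" where
    "g \<eta> = (case \<eta> of Arr_a \<Rightarrow> - el_a' | Arr_a' \<Rightarrow> el_a | _ \<Rightarrow> arrow \<eta>)" for \<eta>
  have g [simp]: "g Arr_a = - el_a'" "g Arr_a' = el_a" "g (Arr_b \<alpha>) = el_b \<alpha>" "g (Arr_d \<alpha>) = el_d \<alpha>"
    for \<alpha> by (simp_all add: g_def)
  have [simp]: "el_a \<in> CQ_loops" "el_a' \<in> CQ_loops" by (auto intro: CQ_loops.PA_arrow)
  show "CQ_map r fourier_map" "restrict (subst fourier_map) (CQ r) \<in> grp_calP r"
    by (rule loops_map_in_grp_calP[where g = g];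
        simp add: CQ_loops.PA_uminus subst_arrow_single subst_uminus commutator_def)+
qed

section \<open>Polynomials in a and the shifts by them\<close>

lemma word_simps [simp]: "word [] = e1" "word (x # xs) = x * word xs"
  by (simp_all add: word_def)

lemma word_e1 [simp]: "word ws * e1 = word ws"
  by (induction ws) (simp_all add: triv_mult mult.assoc)

lemma e1_word: "(\<And>x. x \<in> set ws \<Longrightarrow> e1 * x = x) \<Longrightarrow> e1 * word ws = word ws"
  by (cases ws) (simp_all add: triv_mult mult.assoc[symmetric])

lemma word_append: "(\<And>x. x \<in> set ys \<Longrightarrow> e1 * x = x) \<Longrightarrow> word (xs @ ys) = word xs * word ys"
  by (induction xs) (simp_all add: e1_word mult.assoc)

lemma word_in_CQ: "set ws \<subseteq> CQ r \<Longrightarrow> word ws \<in> CQ r"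
  by (induction ws) (auto intro: CQ.PA_mult)

lemma subst_word:
  "CQ_map r f \<Longrightarrow> set ws \<subseteq> CQ r \<Longrightarrow> (\<And>x. x \<in> set ws \<Longrightarrow> subst f x = x) \<Longrightarrow>
     subst f (word ws) = word ws"
  by (induction ws) (auto simp: CQ_mapD(2) word_in_CQ)

abbreviation el_a_pow :: "nat \<Rightarrow> qalg" where
  "el_a_pow i \<equiv> word (replicate i el_a)"

lemma el_a_pow_commute: "el_a_pow i * el_a = el_a * el_a_pow i"
  by (induction i) (simp_all add: mult.assoc)

lemma e1_el_a_pow [simp]: "e1 * el_a_pow i = el_a_pow i"
  by (rule e1_word) simp

lemma poly_a_bound:
  assumes "degree q \<le> N"
  shows "poly_a q = (\<Sum>i\<le>N. scale (Polynomial.coeff q i) (el_a_pow i))"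
  unfolding poly_a_def
  by (rule sum.mono_neutral_left) (use assms in \<open>auto simp: coeff_eq_0\<close>)

lemma poly_a_0 [simp]: "poly_a 0 = 0"
  by (simp add: poly_a_def)

lemma poly_a_pCons: "poly_a (pCons c q) = scale c e1 + el_a * poly_a q"
proof -
  have "poly_a (pCons c q) = (\<Sum>i\<le>Suc (degree q). scale (Polynomial.coeff (pCons c q) i) (el_a_pow i))"
    by (rule poly_a_bound) (simp add: degree_pCons_le)
  also have "\<dots> = scale c e1 + el_a * poly_a q"
    unfolding sum.atMost_Suc_shift poly_a_def by (simp add: sum_distrib_left)
  finally show ?thesis .
qed

lemma poly_a_in_loops: "poly_a q \<in> CQ_loops"
  by (induction q) (auto simp: poly_a_pCons intro!: CQ_loops.PA_add CQ_loops.PA_scale CQ_loops.PA_mult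
      CQ_loops.PA_triv CQ_loops.PA_arrow)

lemma poly_a_in_CQ [simp]: "poly_a q \<in> CQ r"
  using poly_a_in_loops CQ_loops_subset by blast

lemma e1_poly_a [simp]: "e1 * poly_a q = poly_a q" "poly_a q * e1 = poly_a q"
  using e1_loops poly_a_in_loops by auto

lemma poly_a_uminus: "poly_a (- q) = - poly_a q"
  by (simp add: poly_a_def sum_negf)

lemma poly_a_commute: "poly_a q * el_a = el_a * poly_a q"
  unfolding poly_a_def by (simp add: sum_distrib_left sum_distrib_right el_a_pow_commute)

lemma subst_poly_a:
  assumes "subst f el_a = el_a" "CQ_map r f"
  shows "subst f (poly_a q) = poly_a q"
  unfolding poly_a_def using assms
  by (auto simp: subst_sum subst_scale intro!: sum.cong arg_cong[where f = "scale _"] subst_word)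

definition shift_map :: "complex poly \<Rightarrow> arr \<Rightarrow> qalg" where
  "shift_map q \<eta> = (if \<eta> = Arr_a' then el_a' + poly_a q else arrow \<eta>)"

lemma shift_map_simps [simp]:
  "shift_map q Arr_a = el_a" "shift_map q Arr_a' = el_a' + poly_a q"
  "shift_map q (Arr_b \<alpha>) = el_b \<alpha>" "shift_map q (Arr_d \<alpha>) = el_d \<alpha>"
  by (simp_all add: shift_map_def)

text \<open>\<open>poly_a q\<close> commutes with a, so [a, a'] does not change; and a is fixed, so
  the shift by \<open>- q\<close> is the inverse.\<close>

lemma shift_in_grp_calP:
  "CQ_map r (shift_map q)" "restrict (subst (shift_map q)) (CQ r) \<in> grp_calP r"
proof -
  have [simp]: "el_a \<in> CQ_loops" "el_a' \<in> CQ_loops" by (auto intro: CQ_loops.PA_arrow)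
  have m: "CQ_map r (shift_map q)" for q
    by (rule CQ_mapI) (auto simp: arcs_quiver distrib_left distrib_right intro!: CQ.PA_add)
  then have "subst (shift_map q) (poly_a q') = poly_a q'" for q q'
    by (intro subst_poly_a) (simp_all add: subst_arrow_single)
  then show "CQ_map r (shift_map q)" "restrict (subst (shift_map q)) (CQ r) \<in> grp_calP r"
    by (rule_tac [!] loops_map_in_grp_calP[where g = "shift_map (- q)"])
      (simp_all add: poly_a_in_loops CQ_loops.PA_add CQ_loops.PA_diff subst_arrow_single subst_add subst_diff poly_a_uminus
        commutator_def algebra_simps poly_a_commute)
qed

section \<open>Permutations of the arrows\<close>

definition perm_map :: "(nat \<Rightarrow> nat) \<Rightarrow> arr \<Rightarrow> qalg" where
  "perm_map \<sigma> \<eta> = (case \<eta> of Arr_b \<alpha> \<Rightarrow> el_b (\<sigma> \<alpha>) | Arr_d \<alpha> \<Rightarrow> el_d (\<sigma> \<alpha>) | _ \<Rightarrow> arrow \<eta>)"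

lemma perm_map_simps [simp]:
  "perm_map \<sigma> Arr_a = el_a" "perm_map \<sigma> Arr_a' = el_a'"
  "perm_map \<sigma> (Arr_b \<alpha>) = el_b (\<sigma> \<alpha>)" "perm_map \<sigma> (Arr_d \<alpha>) = el_d (\<sigma> \<alpha>)"
  by (simp_all add: perm_map_def)

text \<open>The inductive definition has no rule for scalars. Each generator is reproduced by the
  idempotent at its end point, and the scalar can be put on that idempotent.\<close>

lemma arrow_ideal_scale: "x \<in> arrow_ideal r \<Longrightarrow> scale c x \<in> arrow_ideal r"
proof (induction x rule: arrow_ideal.induct)
  case (mult_left z x)
  then show ?case by (metis arrow_ideal.mult_left scale_mult_right)
next
  case (mult_right z x)
  then show ?case by (metis arrow_ideal.mult_right scale_mult_left)
next
  case (add x y)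
  then show ?case by (simp add: scale_add_right arrow_ideal.add)
next
  case vtx
  have "scale c e2 * e2 \<in> arrow_ideal r"
    by (intro arrow_ideal.mult_left arrow_ideal.vtx CQ.PA_scale CQ_arrow)
  then show ?case by (simp add: triv_mult)
next
  case (b \<alpha>)
  then have "scale c e2 * el_b \<alpha> \<in> arrow_ideal r"
    by (intro arrow_ideal.mult_left arrow_ideal.b CQ.PA_scale CQ_arrow)
  then show ?case by simp
next
  case (d \<alpha>)
  then have "scale c e1 * el_d \<alpha> \<in> arrow_ideal r"
    by (intro arrow_ideal.mult_left arrow_ideal.d CQ.PA_scale CQ_arrow)
  then show ?case by simp
qed

lemma arrow_ideal_0: "0 \<in> arrow_ideal r"
  using arrow_ideal_scale[OF arrow_ideal.vtx, of 0] by simp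

lemma arrow_ideal_diff: "x \<in> arrow_ideal r \<Longrightarrow> y \<in> arrow_ideal r \<Longrightarrow> x - y \<in> arrow_ideal r"
  using arrow_ideal.add[of x r "scale (- 1) y"] arrow_ideal_scale[of y r "- 1"] by simp

text \<open>Two homomorphisms that agree on generators modulo an ideal agree modulo it everywhere;
  here the second one is the identity.\<close>

lemma reducedI:
  assumes f: "CQ_map r f"
    and "\<And>\<eta>. \<eta> \<in> arcs (quiver r) \<Longrightarrow> f \<eta> - arrow \<eta> \<in> arrow_ideal r"
    and x: "x \<in> CQ r"
  shows "subst f x - x \<in> arrow_ideal r"
  using x
proof (induction x rule: CQ.PA_gen_induct)
  case (mult x y)
  have "subst f x * subst f y - x * y = subst f x * (subst f y - y) + (subst f x - x) * y"
    by (simp add: algebra_simps)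
  also have "\<dots> \<in> arrow_ideal r"
    using mult by (intro arrow_ideal.add arrow_ideal.mult_left arrow_ideal.mult_right CQ_mapD(3)[OF f])
  finally show ?case using mult by (simp add: CQ_mapD(2)[OF f])
next
  case (add x y)
  then show ?case using arrow_ideal.add[of "subst f x - x" r "subst f y - y"]
    by (simp add: subst_add algebra_simps)
next
  case (scale c x)
  then show ?case using arrow_ideal_scale[of "subst f x - x" r c]
    by (simp add: subst_scale scale_diff_right)
qed (use assms in \<open>auto simp: arrow_ideal_0 CQ_mapD(1)\<close>)

text \<open>This is the case of permutation matrices in GL_r. Arrows go to arrows, hence affine;
  loops are fixed and the other arrows lie in the ideal, hence reduced; the sum in
  \<open>c_elt r\<close> is merely reordered.\<close>

lemma perm_in_grp_calP:
  assumes \<sigma>: "\<sigma> permutes {1..r}"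
  shows "CQ_map r (perm_map \<sigma>)" "restrict (subst (perm_map \<sigma>)) (CQ r) \<in> grp_calP r"
proof -
  have in_r: "\<pi> \<alpha> \<in> {1..r}" if "\<pi> permutes {1..r}" "\<alpha> \<in> {1..r}" for \<pi> \<alpha>
    using permutes_in_image that by metis
  have m: "CQ_map r (perm_map \<pi>)" if "\<pi> permutes {1..r}" for \<pi>
    by (rule CQ_mapI) (use in_r[OF that] in \<open>auto simp: arcs_quiver\<close>)
  show map: "CQ_map r (perm_map \<sigma>)" by (rule m) fact
  have inv_\<sigma>: "inv_into UNIV \<sigma> permutes {1..r}" by (rule permutes_inv) fact
  have "restrict (subst (perm_map \<sigma>)) (CQ r) \<in> Aut_sympl r"
  proof (rule CQ_map_in_Aut_sympl)
    show "CQ_map r (perm_map (inv_into UNIV \<sigma>))" by (rule m) fact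
    show "subst (perm_map \<sigma>) (c_elt r) = c_elt r"
      unfolding subst_c_elt[OF map] unfolding c_elt_eq
      using sum.permute[OF \<sigma>, of "\<lambda>\<alpha>. el_b \<alpha> * el_d \<alpha> - el_d \<alpha> * el_b \<alpha>"] by (simp add: o_def)
    show "subst (perm_map (inv_into UNIV \<sigma>)) (perm_map \<sigma> \<eta>) = arrow \<eta> \<and> subst (perm_map \<sigma>) (perm_map (inv_into UNIV \<sigma>) \<eta>) = arrow \<eta>"
      for \<eta>
      using permutes_inverses[OF \<sigma>] by (cases \<eta>) (simp_all add: subst_arrow_single)
  qed (rule map)
  moreover have diff: "el_b (\<sigma> \<alpha>) - el_b \<alpha> \<in> arrow_ideal r" "el_d (\<sigma> \<alpha>) - el_d \<alpha> \<in> arrow_ideal r"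
    if "\<alpha> \<in> {1..r}" for \<alpha>
    using that in_r[OF \<sigma> that] by (auto intro!: arrow_ideal_diff arrow_ideal.b arrow_ideal.d simp del: atLeastAtMost_iff)
  moreover have "subst (perm_map \<sigma>) x - x \<in> arrow_ideal r" if "x \<in> CQ r" for x
    by (rule reducedI[OF map _ that]) (use diff in \<open>auto simp: arcs_quiver arrow_ideal_0\<close>)
  moreover have "affine_aut r (restrict (subst (perm_map \<sigma>)) (CQ r))"
  proof -
    have "length p \<le> 1" if \<eta>: "\<eta> \<in> arcs (quiver r)" and p: "(u, p, v) \<in> paths_of (restrict (subst (perm_map \<sigma>)) (CQ r) (arrow \<eta>))"
      for \<eta> u p v
    proof -
      obtain \<eta>' where "perm_map \<sigma> \<eta> = arrow \<eta>'" by (cases \<eta>) (metis perm_map_simps)+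
      then show ?thesis
        using p by (simp add: CQ.PA_arrow[OF \<eta>] CQ_mapD(1)[OF map \<eta>])
          (auto simp: in_paths_of arrow_def split: if_splits)
    qed
    then show ?thesis by (fastforce simp: affine_aut_def)
  qed
  ultimately have "restrict (subst (perm_map \<sigma>)) (CQ r) \<in> Aff_red r"
    by (simp add: Aff_red_def grp_K_def)
  then show "restrict (subst (perm_map \<sigma>)) (CQ r) \<in> grp_calP r" by (rule Aff_red_in_grp_calP)
qed

section \<open>The automorphisms \<open>Lambda\<close>\<close>

lemma b11_eq: "b11 = - (el_d 1 * el_b 2)"
  by (simp add: b11_def el_x_def el_y_def)

lemma b11_ends [simp]: "e1 * b11 = b11" "b11 * e1 = b11"
  by (simp_all add: b11_eq mult.assoc, simp add: mult.assoc[symmetric])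

text \<open>\<open>cyclic_deriv\<close> finds the letter a by comparing elements of the algebra, so
  the letter \<open>b11\<close> has to be told apart from it.\<close>

lemma b11_neq: "b11 \<noteq> el_a"
proof
  assume "b11 = el_a"
  then have "pcoeff b11 (Vtx1, [Arr_a], Vtx1) = pcoeff el_a (Vtx1, [Arr_a], Vtx1)" by simp
  then show False by (simp add: b11_eq arrow_def path_elt_mult)
qed

definition deriv_pow_b11 :: "nat \<Rightarrow> qalg" where
  "deriv_pow_b11 i = (\<Sum>k<i. el_a_pow (i - Suc k) * b11 * el_a_pow k)"

lemma cyclic_deriv_b11: "cyclic_deriv el_a (replicate i el_a @ [b11]) = deriv_pow_b11 i"
proof -
  have "{k. k < length (replicate i el_a @ [b11]) \<and> (replicate i el_a @ [b11]) ! k = el_a} = {..<i}"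
    using b11_neq by (auto simp: nth_append less_Suc_eq)
  moreover have "word (drop (Suc k) (replicate i el_a @ [b11]) @ take k (replicate i el_a @ [b11])) =
      el_a_pow (i - Suc k) * b11 * el_a_pow k" if "k < i" for k
  proof -
    have "word (replicate (i - Suc k) el_a @ b11 # replicate k el_a) =
        el_a_pow (i - Suc k) * word (b11 # replicate k el_a)"
      by (rule word_append) auto
    then show ?thesis using that by (simp add: min_def mult.assoc)
  qed
  ultimately show ?thesis by (simp add: cyclic_deriv_def deriv_pow_b11_def)
qed

lemma deriv_poly_b11_eq:
  "deriv_poly_b11 q = (\<Sum>i\<le>degree q. scale (Polynomial.coeff q i) (deriv_pow_b11 i))"
  by (simp add: deriv_poly_b11_def cyclic_deriv_b11)

text \<open>Bracketing a term with a gives the difference of two neighbours in the sequence a^i b11,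
  a^(i-1) b11 a, ..., b11 a^i, so the sum telescopes.\<close>

lemma deriv_pow_b11_comm: "commutator el_a (deriv_pow_b11 i) = el_a_pow i * b11 - b11 * el_a_pow i"
proof -
  define F where "F k = el_a_pow (i - k) * b11 * el_a_pow k" for k
  have "el_a * (el_a_pow (i - Suc k) * b11 * el_a_pow k)
      - el_a_pow (i - Suc k) * b11 * el_a_pow k * el_a = F k - F (Suc k)" if "k < i" for k
  proof -
    have "el_a * el_a_pow (i - Suc k) = el_a_pow (i - k)"
      using that by (simp add: Suc_diff_Suc flip: word_simps(2) replicate_Suc)
    then show ?thesis
      by (simp add: F_def mult.assoc el_a_pow_commute) (simp add: mult.assoc[symmetric])
  qed
  then have "commutator el_a (deriv_pow_b11 i) = (\<Sum>k<i. F k - F (Suc k))"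
    by (simp add: commutator_def deriv_pow_b11_def sum_distrib_left sum_distrib_right
        flip: sum_subtractf)
  also have "\<dots> = F 0 - F i" by (rule sum_lessThan_telescope')
  finally show ?thesis by (simp add: F_def mult.assoc)
qed

lemma deriv_poly_b11_comm: "commutator el_a (deriv_poly_b11 q) = poly_a q * b11 - b11 * poly_a q"
proof -
  have "commutator el_a (deriv_poly_b11 q) =
      (\<Sum>i\<le>degree q. scale (Polynomial.coeff q i) (commutator el_a (deriv_pow_b11 i)))"
    by (simp add: deriv_poly_b11_eq commutator_def sum_distrib_left sum_distrib_right
        scale_diff_right sum_subtractf)
  then show ?thesis
    by (simp add: deriv_pow_b11_comm poly_a_def sum_distrib_left sum_distrib_right scale_diff_right
        sum_subtractf)
qed

lemma deriv_poly_b11_uminus: "deriv_poly_b11 (- q) = - deriv_poly_b11 q"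
  by (simp add: deriv_poly_b11_def sum_negf)

lemma deriv_poly_b11_ends [simp]:
  "e1 * deriv_poly_b11 q = deriv_poly_b11 q" "deriv_poly_b11 q * e1 = deriv_poly_b11 q"
  by (simp_all add: deriv_poly_b11_eq deriv_pow_b11_def sum_distrib_left sum_distrib_right mult.assoc)
    (simp add: mult.assoc[symmetric])

lemma b11_in_CQ: "r \<ge> 2 \<Longrightarrow> b11 \<in> CQ r"
  by (auto simp: b11_eq intro!: CQ.PA_uminus CQ.PA_mult)

lemma deriv_poly_b11_in_CQ: "r \<ge> 2 \<Longrightarrow> deriv_poly_b11 q \<in> CQ r"
  unfolding deriv_poly_b11_eq deriv_pow_b11_def
  by (intro CQ.PA_sum CQ.PA_scale CQ.PA_mult word_in_CQ b11_in_CQ) auto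

lemma subst_deriv_poly_b11:
  assumes r: "r \<ge> 2" and f: "CQ_map r f" and a: "subst f el_a = el_a" and b: "subst f b11 = b11"
  shows "subst f (deriv_poly_b11 q) = deriv_poly_b11 q"
proof -
  have [simp]: "el_a_pow i \<in> CQ r" for i by (rule word_in_CQ) auto
  have [simp]: "subst f (el_a_pow i) = el_a_pow i" for i
    by (rule subst_word[OF f]) (use a in auto)
  have "subst f (deriv_pow_b11 i) = deriv_pow_b11 i" for i
    unfolding deriv_pow_b11_def
    by (simp add: subst_sum CQ_mapD(2)[OF f] b11_in_CQ[OF r] CQ.PA_mult b)
  then show ?thesis by (simp add: deriv_poly_b11_eq subst_sum subst_scale)
qed

text \<open>The minus sign comes from x_1 = -d_1. Written as arrow plus correction, the inverse is
  visible: the corrections involve only a, b_2 and d_1, which are fixed, so that \<open>- q\<close>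
  undoes \<open>q\<close>.\<close>

definition Lambda_map :: "complex poly \<Rightarrow> arr \<Rightarrow> qalg" where
  "Lambda_map q \<eta> = arrow \<eta> +
     (if \<eta> = Arr_a' then deriv_poly_b11 q
      else if \<eta> = Arr_b 1 then el_b 2 * poly_a q
      else if \<eta> = Arr_d 2 then - (poly_a q * el_d 1)
      else 0)"

text \<open>The changes to \<open>c_elt r\<close> cancel. The loops contribute q b11 - b11 q, the
  first pair of arrows b_2 q d_1 - d_1 b_2 q, the second -b_2 q d_1 + q d_1 b_2, and b11 = -d_1
  b_2.\<close>

lemma Lambda_map_in_grp_calP:
  assumes r: "r \<ge> 2"
  shows "CQ_map r (Lambda_map q)" "restrict (subst (Lambda_map q)) (CQ r) \<in> grp_calP r"
proof -
  have m: "CQ_map r (Lambda_map q)" for q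
    by (rule CQ_mapI) (use r in \<open>auto simp: arcs_quiver Lambda_map_def distrib_left distrib_right
      mult.assoc deriv_poly_b11_in_CQ intro!: CQ.PA_add CQ.PA_diff CQ.PA_mult CQ.PA_uminus; 
      simp add: mult.assoc[symmetric]\<close>)
  show "CQ_map r (Lambda_map q)" by (rule m)
  have arcs: "\<eta> \<in> arcs (quiver r)" if "\<eta> \<in> {Arr_a, Arr_a', Arr_b 1, Arr_b 2, Arr_d 1, Arr_d 2}" for \<eta>
    using that r by (auto simp: arcs_quiver)
  have sa: "subst (Lambda_map q) (arrow \<eta>) = Lambda_map q \<eta>" if "\<eta> \<in> arcs (quiver r)" for q \<eta>
    using CQ_mapD(1)[OF m that] .
  have fix_a: "subst (Lambda_map q) el_a = el_a" for q
    by (subst sa) (simp_all add: arcs Lambda_map_def)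
  have fix_db: "subst (Lambda_map q) (el_d 1) = el_d 1" "subst (Lambda_map q) (el_b 2) = el_b 2" for q
    by (subst sa; simp add: arcs[simplified] Lambda_map_def)+
  have CQ: "el_d 1 \<in> CQ r" "el_b 2 \<in> CQ r" using r by auto
  have fix_b11: "subst (Lambda_map q) b11 = b11" for q
    by (simp only: b11_eq subst_uminus CQ_mapD(2)[OF m CQ] fix_db)
  have fixed: "subst (Lambda_map q) (poly_a q') = poly_a q'"
    "subst (Lambda_map q) (deriv_poly_b11 q') = deriv_poly_b11 q'" for q q'
    using subst_poly_a[OF fix_a m] subst_deriv_poly_b11[OF r m fix_a fix_b11] by auto
  have inv: "subst (Lambda_map q') (Lambda_map q \<eta>) = arrow \<eta>"
    if "\<eta> \<in> arcs (quiver r)" "q' = - q" for q q' \<eta>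
  proof -
    have "subst (Lambda_map q') (Lambda_map q \<eta>) =
        Lambda_map q' \<eta> + (Lambda_map q \<eta> - arrow \<eta>)"
      using that(1) CQ
      by (auto simp: Lambda_map_def[of q] subst_add sa fixed subst_uminus CQ_mapD(2)[OF m] fix_db[simplified])
    then show ?thesis
      by (auto simp: Lambda_map_def that(2) poly_a_uminus deriv_poly_b11_uminus)
  qed
  have c: "subst (Lambda_map q) (c_elt r) = c_elt r"
  proof -
    \<comment> \<open>Only the first two pairs of arrows are affected, so they are separated from
      the rest of the sum.\<close>
    have split: "(\<Sum>\<alpha> = 1..r. F \<alpha>) = F 1 + F 2 + (\<Sum>\<alpha> = 3..r. F \<alpha>)" for F :: "nat \<Rightarrow> qalg"
      using r by (simp add: sum.atLeast_Suc_atMost numeral_2_eq_2 numeral_3_eq_3 add.assoc)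
    have tail: "(\<Sum>\<alpha> = 3..r. Lambda_map q (Arr_b \<alpha>) * Lambda_map q (Arr_d \<alpha>) -
          Lambda_map q (Arr_d \<alpha>) * Lambda_map q (Arr_b \<alpha>)) =
        (\<Sum>\<alpha> = 3..r. el_b \<alpha> * el_d \<alpha> - el_d \<alpha> * el_b \<alpha>)"
      by (rule sum.cong) (auto simp: Lambda_map_def)
    have "commutator el_a (el_a' + deriv_poly_b11 q) =
        commutator el_a el_a' + (poly_a q * b11 - b11 * poly_a q)"
      unfolding deriv_poly_b11_comm[symmetric] by (simp add: commutator_def algebra_simps)
    then show ?thesis
      unfolding subst_c_elt[OF m] split tail
      unfolding c_elt_eq split
      by (simp add: Lambda_map_def b11_eq algebra_simps)
  qed
  have "restrict (subst (Lambda_map q)) (CQ r) \<in> Aut_sympl r"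
    by (rule CQ_map_in_Aut_sympl[OF m m[of "- q"]]) (use inv[of _ "- q" q] inv[of _ q "- q"] c in auto)
  then have "is_Lambda r q (restrict (subst (Lambda_map q)) (CQ r))"
    using r unfolding is_Lambda_def
    by (auto simp: el_x'_def el_y'_def el_x_def el_y_def sa arcs Lambda_map_def CQ.PA_arrow)
  with r show "restrict (subst (Lambda_map q)) (CQ r) \<in> grp_calP r" by (rule Lambda_in_grp_calP)
qed

section \<open>Representations\<close>

lemma rep_space_carriers:
  assumes "(X, Y, v, w) \<in> rep_space n r"
  shows "X \<in> carrier_mat n n" "Y \<in> carrier_mat n n" "v \<in> carrier_mat n r" "w \<in> carrier_mat r n"
  using assms by (auto simp: rep_space_def)

lemma rep_arr_carrier:
  "m \<in> rep_space n r \<Longrightarrow> rep_arr m \<eta> \<in> carrier_mat (rep_dim n (tgt \<eta>)) (rep_dim n (src \<eta>))"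
  by (cases m; cases \<eta>) (auto simp: rep_space_def)

lemma rep_path_carrier:
  "m \<in> rep_space n r \<Longrightarrow> cas u p v \<Longrightarrow> rep_path n m u p \<in> carrier_mat (rep_dim n v) (rep_dim n u)"
  by (induction p arbitrary: u) (auto intro!: mult_carrier_mat rep_arr_carrier)

lemma rep_path_append:
  assumes "m \<in> rep_space n r" "cas u q t" "cas t p v"
  shows "rep_path n m u (q @ p) = rep_path n m t p * rep_path n m u q"
  using assms(2)
proof (induction q arbitrary: u)
  case Nil
  then show ?case using rep_path_carrier[OF assms(1,3)] by simp
next
  case (Cons \<eta> q)
  then show ?case
    using rep_path_carrier[OF assms(1,3)] rep_path_carrier[OF assms(1), of "tgt \<eta>" q t]
      rep_arr_carrier[OF assms(1), of \<eta>]
    by (auto simp: assoc_mult_mat)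
qed

text \<open>Entries are considered without range conditions on i and j, so that linearity in x holds
  unconditionally and carries over to \<open>rep_elt\<close>.\<close>

definition rep_entry :: "nat \<Rightarrow> point \<Rightarrow> vertex \<Rightarrow> vertex \<Rightarrow> qalg \<Rightarrow> nat \<Rightarrow> nat \<Rightarrow> complex" where
  "rep_entry n m u v x i j = (\<Sum>p | (u, p, v) \<in> paths_of x. pcoeff x (u, p, v) * rep_path n m u p $$ (i, j))"

lemma rep_elt_eq: "rep_elt n m u v x = mat (rep_dim n v) (rep_dim n u) (\<lambda>(i, j). rep_entry n m u v x i j)"
  by (auto simp: rep_elt_def rep_entry_def)

lemma rep_elt_carrier: "rep_elt n m u v x \<in> carrier_mat (rep_dim n v) (rep_dim n u)"
  by (simp add: rep_elt_def)

lemma dim_rep_elt [simp]: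
  "dim_row (rep_elt n m u v x) = rep_dim n v" "dim_col (rep_elt n m u v x) = rep_dim n u"
  by (simp_all add: rep_elt_def)

lemma index_rep_elt [simp]:
  "i < rep_dim n v \<Longrightarrow> j < rep_dim n u \<Longrightarrow> rep_elt n m u v x $$ (i, j) = rep_entry n m u v x i j"
  by (simp add: rep_elt_eq)

lemma finite_paths_between: "finite {p. (u, p, v) \<in> paths_of x}"
proof (rule finite_subset)
  show "{p. (u, p, v) \<in> paths_of x} \<subseteq> (\<lambda>(u, p, v). p) ` paths_of x" by force
qed simp

lemma rep_entry_superset:
  "finite S \<Longrightarrow> {p. (u, p, v) \<in> paths_of x} \<subseteq> S \<Longrightarrow>
     rep_entry n m u v x i j = (\<Sum>p\<in>S. pcoeff x (u, p, v) * rep_path n m u p $$ (i, j))"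
  unfolding rep_entry_def by (rule sum.mono_neutral_left) (auto simp: in_paths_of)

lemma rep_entry_add: "rep_entry n m u v (x + y) i j = rep_entry n m u v x i j + rep_entry n m u v y i j"
proof -
  let ?S = "{p. (u, p, v) \<in> paths_of x} \<union> {p. (u, p, v) \<in> paths_of y}"
  have "{p. (u, p, v) \<in> paths_of (x + y)} \<subseteq> ?S" by (auto simp: in_paths_of)
  then show ?thesis
    by (simp add: rep_entry_superset[of ?S] finite_paths_between distrib_right sum.distrib)
qed

lemma rep_entry_scale: "rep_entry n m u v (scale c x) i j = c * rep_entry n m u v x i j"
proof -
  let ?S = "{p. (u, p, v) \<in> paths_of x}"
  have "{p. (u, p, v) \<in> paths_of (scale c x)} \<subseteq> ?S" by (auto simp: in_paths_of)
  then show ?thesis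
    by (simp add: rep_entry_superset[of ?S] finite_paths_between sum_distrib_left mult.assoc)
qed

lemma rep_entry_0 [simp]: "rep_entry n m u v 0 i j = 0"
  by (simp add: rep_entry_def in_paths_of)

lemma rep_entry_uminus: "rep_entry n m u v (- x) i j = - rep_entry n m u v x i j"
  using rep_entry_scale[of n m u v "- 1" x i j] by simp

lemma rep_entry_diff: "rep_entry n m u v (x - y) i j = rep_entry n m u v x i j - rep_entry n m u v y i j"
  using rep_entry_add[of n m u v x "- y"] by (simp add: rep_entry_uminus)

lemma rep_entry_sum: "rep_entry n m u v (sum f I) i j = (\<Sum>k\<in>I. rep_entry n m u v (f k) i j)"
  by (induction I rule: infinite_finite_induct) (auto simp: rep_entry_add)

lemma rep_entry_path_elt:
  "rep_entry n m u v (path_elt (u', p, v')) i j = (if u = u' \<and> v = v' then rep_path n m u p $$ (i, j) else 0)"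
  by (subst rep_entry_superset[of "{p}"]) (auto simp: in_paths_of)

text \<open>The algebra acts on the direct sum of C^n and C, so this is a product of block matrices,
  in which the intermediate vertex t runs over both summands.\<close>

lemma rep_entry_mult:
  assumes m: "m \<in> rep_space n r" and xy: "x \<in> CQ r" "y \<in> CQ r"
    and ij: "i < rep_dim n v" "j < rep_dim n u"
  shows "rep_entry n m u v (x * y) i j =
    (\<Sum>t\<in>UNIV. \<Sum>k<rep_dim n t. rep_entry n m t v x i k * rep_entry n m u t y k j)"
  using xy
proof (induction x rule: CQ.PA_induct)
  case (path c u1 p v1)
  from path(4) path(1-3) show ?case
  proof (induction y rule: CQ.PA_induct)
    case (path d u2 q v2)
    have "rep_path n m u2 (q @ p) $$ (i, j) =
        (\<Sum>k<rep_dim n u1. rep_path n m u1 p $$ (i, k) * rep_path n m u2 q $$ (k, j))"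
      if "v2 = u1" "v1 = v" "u2 = u"
      using rep_path_carrier[OF m, of u2 q v2] rep_path_carrier[OF m, of u1 p v1] path that ij
      by (subst rep_path_append[OF m, of u2 q u1 p v1])
        (auto simp: scalar_prod_def lessThan_atLeast0)
    then show ?case
      by (cases u1; cases v2) (auto simp: path_elt_mult rep_entry_scale rep_entry_path_elt UNIV_vertex
          sum_distrib_left mult_ac)
  qed (simp_all add: distrib_left rep_entry_add scale_add_right sum.distrib)
qed (simp_all add: distrib_right rep_entry_add sum.distrib)

lemma rep_entry_triv:
  "i < rep_dim n t \<Longrightarrow> j < rep_dim n t \<Longrightarrow>
     rep_entry n m u v (triv t) i j = (if u = t \<and> v = t \<and> i = j then 1 else 0)"
  "u \<noteq> t \<or> v \<noteq> t \<Longrightarrow> rep_entry n m u v (triv t) i j = 0"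
  by (auto simp: triv_def rep_entry_path_elt)

lemma rep_elt_mult:
  assumes m: "m \<in> rep_space n r" and xy: "x \<in> CQ r" "y \<in> CQ r" and t: "triv t * y = y"
  shows "rep_elt n m u v (x * y) = rep_elt n m t v x * rep_elt n m u t y"
proof (rule eq_matI)
  fix i j assume "i < dim_row (rep_elt n m t v x * rep_elt n m u t y)"
    "j < dim_col (rep_elt n m t v x * rep_elt n m u t y)"
  then have ij: "i < rep_dim n v" "j < rep_dim n u" by simp_all
  \<comment> \<open>Since y is reproduced by \<open>triv t\<close>, it has no block that ends at
    another vertex; one summand of \<open>rep_entry_mult\<close> remains.\<close>
  have 0: "rep_entry n m u t' y k j = 0" if "t' \<noteq> t" "k < rep_dim n t'" for t' k
    using rep_entry_mult[OF m CQ_arrow(5) xy(2) that(2) ij(2), of t] that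
    by (simp add: t rep_entry_triv)
  have "rep_entry n m u v (x * y) i j =
    (\<Sum>t'\<in>UNIV. if t' = t then \<Sum>k<rep_dim n t. rep_entry n m t v x i k * rep_entry n m u t y k j else 0)"
    unfolding rep_entry_mult[OF m xy ij] by (intro sum.cong) (auto simp: 0)
  then show "rep_elt n m u v (x * y) $$ (i, j) = (rep_elt n m t v x * rep_elt n m u t y) $$ (i, j)"
    using ij by (cases t) (simp_all add: scalar_prod_def lessThan_atLeast0 UNIV_vertex)
qed auto

lemma rep_elt_add: "rep_elt n m u v (x + y) = rep_elt n m u v x + rep_elt n m u v y"
  and rep_elt_scale: "rep_elt n m u v (scale c x) = c \<cdot>\<^sub>m rep_elt n m u v x"
  and rep_elt_uminus: "rep_elt n m u v (- x) = - rep_elt n m u v x"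
  by (rule eq_matI; simp add: rep_entry_add rep_entry_scale rep_entry_uminus)+

lemma rep_elt_0: "rep_elt n m u v 0 = 0\<^sub>m (rep_dim n v) (rep_dim n u)"
  by (rule eq_matI) simp_all

lemma rep_elt_path_elt:
  assumes "m \<in> rep_space n r" "cas u' p v'"
  shows "rep_elt n m u v (path_elt (u', p, v')) =
    (if u = u' \<and> v = v' then rep_path n m u p else 0\<^sub>m (rep_dim n v) (rep_dim n u))"
  using rep_path_carrier[OF assms] by (intro eq_matI) (auto simp: rep_entry_path_elt)

lemma rep_elt_triv: "rep_elt n m v v (triv v) = 1\<^sub>m (rep_dim n v)"
  by (rule eq_matI) (simp_all add: rep_entry_triv)

lemma rep_elt_arrow:
  assumes "m \<in> rep_space n r"
  shows "rep_elt n m (src \<eta>) (tgt \<eta>) (arrow \<eta>) = rep_arr m \<eta>"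
proof -
  have "1\<^sub>m (rep_dim n (tgt \<eta>)) * rep_arr m \<eta> = rep_arr m \<eta>"
    by (rule left_mult_one_mat[OF rep_arr_carrier[OF assms]])
  then show ?thesis
    using rep_arr_carrier[OF assms, of \<eta>] by (intro eq_matI) (auto simp: arrow_def rep_entry_path_elt)
qed

lemma rep_elt_loops:
  assumes "(X, Y, v, w) \<in> rep_space n r"
  shows "rep_elt n (X, Y, v, w) Vtx1 Vtx1 el_a = X" "rep_elt n (X, Y, v, w) Vtx1 Vtx1 el_a' = Y"
  using rep_elt_arrow[OF assms, of Arr_a] rep_elt_arrow[OF assms, of Arr_a'] by simp_all

lemma rep_entry_bd:
  assumes "(X, Y, v, w) \<in> rep_space n r" "i < n" "\<alpha> \<in> {1..r}"
  shows "rep_entry n (X, Y, v, w) Vtx1 Vtx2 (el_b \<alpha>) 0 i = w $$ (\<alpha> - 1, i)"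
    and "rep_entry n (X, Y, v, w) Vtx2 Vtx1 (el_d \<alpha>) i 0 = v $$ (i, \<alpha> - 1)"
proof -
  have "rep_entry n (X, Y, v, w) Vtx1 Vtx2 (el_b \<alpha>) 0 i = rep_elt n (X, Y, v, w) Vtx1 Vtx2 (el_b \<alpha>) $$ (0, i)"
    using assms(2) by simp
  also have "rep_elt n (X, Y, v, w) Vtx1 Vtx2 (el_b \<alpha>) = mat_of_row (row w (\<alpha> - 1))"
    using rep_elt_arrow[OF assms(1), of "Arr_b \<alpha>"] by simp
  also have "\<dots> $$ (0, i) = w $$ (\<alpha> - 1, i)"
    using assms by (auto simp: rep_space_def mat_of_row_def)
  finally show "rep_entry n (X, Y, v, w) Vtx1 Vtx2 (el_b \<alpha>) 0 i = w $$ (\<alpha> - 1, i)" .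
  have "rep_entry n (X, Y, v, w) Vtx2 Vtx1 (el_d \<alpha>) i 0 = rep_elt n (X, Y, v, w) Vtx2 Vtx1 (el_d \<alpha>) $$ (i, 0)"
    using assms(2) by simp
  also have "rep_elt n (X, Y, v, w) Vtx2 Vtx1 (el_d \<alpha>) = mat_of_cols (dim_row v) [col v (\<alpha> - 1)]"
    using rep_elt_arrow[OF assms(1), of "Arr_d \<alpha>"] by simp
  also have "\<dots> $$ (i, 0) = v $$ (i, \<alpha> - 1)"
    using assms by (auto simp: rep_space_def mat_of_cols_def)
  finally show "rep_entry n (X, Y, v, w) Vtx2 Vtx1 (el_d \<alpha>) i 0 = v $$ (i, \<alpha> - 1)" .
qed

section \<open>Automorphisms acting on points\<close>

lemma act_in_rep_space: "act n r m \<psi> \<in> rep_space n r"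
  by (simp add: act_def rep_space_def rep_elt_def)

lemma Aut_symplD:
  assumes "\<psi> \<in> Aut_sympl r"
  shows "x \<in> CQ r \<Longrightarrow> \<psi> x \<in> CQ r"
    and "x \<in> CQ r \<Longrightarrow> y \<in> CQ r \<Longrightarrow> \<psi> (x + y) = \<psi> x + \<psi> y"
    and "x \<in> CQ r \<Longrightarrow> y \<in> CQ r \<Longrightarrow> \<psi> (x * y) = \<psi> x * \<psi> y"
    and "x \<in> CQ r \<Longrightarrow> \<psi> (scale c x) = scale c (\<psi> x)"
    and "\<psi> (triv t) = triv t" and "\<psi> (c_elt r) = c_elt r"
  using assms algebra_autD[of \<psi> r] by (cases t; auto simp: Aut_sympl_def)+

text \<open>The new point is the old representation composed with the automorphism. Both sides are
  representations, so they are compared on trivial paths and arrows, where the definition of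
  \<open>act\<close> gives equality.\<close>

lemma rep_entry_act:
  assumes m: "m \<in> rep_space n r" and \<psi>: "\<psi> \<in> Aut_sympl r" and x: "x \<in> CQ r"
    and "i < rep_dim n v" "j < rep_dim n u"
  shows "rep_entry n (act n r m \<psi>) u v x i j = rep_entry n m u v (\<psi> x) i j"
  using x assms(4,5)
proof (induction x arbitrary: u v i j rule: CQ.PA_gen_induct)
  case (triv t)
  then show ?case
    by (cases "u = t \<and> v = t") (auto simp: Aut_symplD(5)[OF \<psi>] rep_entry_triv)
next
  case (arrow \<eta>)
  note D = Aut_symplD[OF \<psi>]
  have \<eta>: "arrow \<eta> \<in> CQ r" using arrow(1) by (rule CQ.PA_arrow)
  \<comment> \<open>The idempotents are fixed, so the image of an arrow keeps its end points and all
    its other blocks are 0, as for the arrow itself.\<close>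
  have ends: "triv (tgt \<eta>) * \<psi> (arrow \<eta>) = \<psi> (arrow \<eta>)" "\<psi> (arrow \<eta>) * triv (src \<eta>) = \<psi> (arrow \<eta>)"
    using D(3)[OF CQ_arrow(5) \<eta>, of "tgt \<eta>"] D(3)[OF \<eta> CQ_arrow(5), of "src \<eta>"] by (simp_all add: D(5))
  show ?case
  proof (cases "u = src \<eta> \<and> v = tgt \<eta>")
    case True
    have "rep_entry n (act n r m \<psi>) u v (arrow \<eta>) i j = rep_arr (act n r m \<psi>) \<eta> $$ (i, j)"
      using rep_elt_arrow[OF act_in_rep_space, of n r m \<psi> \<eta>] True arrow.prems
      by (metis index_rep_elt)
    also have "\<dots> = rep_entry n m u v (\<psi> (arrow \<eta>)) i j"
      using arrow True by (auto simp: arcs_quiver act_def mat_of_row_def mat_of_cols_def)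
    finally show ?thesis .
  next
    case False
    have "rep_entry n m u v (triv (tgt \<eta>) * (\<psi> (arrow \<eta>) * triv (src \<eta>))) i j = 0"
      using False arrow.prems
      by (auto simp: rep_entry_mult[OF m] CQ.PA_mult D(1) \<eta> rep_entry_triv intro!: sum.neutral)
    moreover have "rep_entry n (act n r m \<psi>) u v (arrow \<eta>) i j = 0"
      using False by (auto simp: arrow_def rep_entry_path_elt)
    ultimately show ?thesis by (simp add: ends)
  qed
next
  case (mult x y)
  then show ?case
    by (simp add: rep_entry_mult[OF m] rep_entry_mult[OF act_in_rep_space] Aut_symplD(1,3)[OF \<psi>])
qed (simp_all add: rep_entry_add rep_entry_scale Aut_symplD[OF \<psi>])

lemma rep_elt_act:
  assumes "m \<in> rep_space n r" "\<psi> \<in> Aut_sympl r" "x \<in> CQ r"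
  shows "rep_elt n (act n r m \<psi>) u v x = rep_elt n m u v (\<psi> x)"
  by (rule eq_matI) (simp_all add: rep_entry_act[OF assms])

text \<open>To evaluate \<open>\<psi> (\<phi> x)\<close> at m is to evaluate \<open>\<phi> x\<close>
  at the image of m under \<open>\<psi>\<close>. This is why the action is a right action.\<close>

lemma act_compose:
  assumes m: "m \<in> rep_space n r" and "\<psi> \<in> Aut_sympl r" "\<phi> \<in> Aut_sympl r"
  shows "act n r m (compose (CQ r) \<psi> \<phi>) = act n r (act n r m \<psi>) \<phi>"
proof -
  have "rep_elt n m u v (compose (CQ r) \<psi> \<phi> x) = rep_elt n (act n r m \<psi>) u v (\<phi> x)" if "x \<in> CQ r" for x u v
    using that Aut_symplD(1)[OF assms(3)] by (simp add: compose_eq rep_elt_act[OF m assms(2)])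
  then show ?thesis unfolding act_def[of n r "act n r m \<psi>"] act_def[of n r m "compose _ _ _"]
    by (auto intro!: cong_mat)
qed

lemma act_id:
  assumes "m \<in> rep_space n r"
  shows "act n r m (\<lambda>x\<in>CQ r. x) = m"
proof (cases m)
  case (fields X Y v w)
  then show ?thesis
    using assms rep_elt_loops[of X Y v w n r]
    by (auto simp: act_def rep_entry_bd rep_space_def intro!: eq_matI)
qed

text \<open>The products b d are loops at vertex 2 and drop out of this block, while the products d
  b add up to \<open>v * w\<close>. Hence fixing \<open>c_elt r\<close> means preserving the
  moment.\<close>

lemma moment_eq:
  assumes m: "m \<in> rep_space n r"
  shows "moment m = rep_elt n m Vtx1 Vtx1 (c_elt r)"
proof (cases m)
  case (fields X Y v w)
  note c = rep_space_carriers[OF m[unfolded fields]]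
  have loops: "rep_elt n m Vtx1 Vtx1 (el_a * el_a') = X * Y" "rep_elt n m Vtx1 Vtx1 (el_a' * el_a) = Y * X"
    by (simp_all add: rep_elt_mult[OF m, where t = Vtx1] rep_elt_loops[OF m[unfolded fields], folded fields])
  have e: "rep_entry n m Vtx1 Vtx1 (el_a * el_a') i j = (X * Y) $$ (i, j)"
     "rep_entry n m Vtx1 Vtx1 (el_a' * el_a) i j = (Y * X) $$ (i, j)" if "i < n" "j < n" for i j
    using that by (simp_all flip: loops)
  have bd: "rep_entry n m Vtx1 Vtx1 (el_b \<alpha> * el_d \<alpha>) i j = 0"
    "rep_entry n m Vtx1 Vtx1 (el_d \<alpha> * el_b \<alpha>) i j = v $$ (i, \<alpha> - 1) * w $$ (\<alpha> - 1, j)"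
    if "i < n" "j < n" "\<alpha> \<in> {1..r}" for i j \<alpha>
  proof -
    show "rep_entry n m Vtx1 Vtx1 (el_b \<alpha> * el_d \<alpha>) i j = 0"
      by (simp add: arrow_def path_elt_mult rep_entry_path_elt)
    have "rep_entry n m Vtx1 Vtx1 (el_d \<alpha> * el_b \<alpha>) i j = rep_elt n m Vtx1 Vtx1 (el_d \<alpha> * el_b \<alpha>) $$ (i, j)"
      using that by simp
    also have "\<dots> = (rep_elt n m Vtx2 Vtx1 (el_d \<alpha>) * rep_elt n m Vtx1 Vtx2 (el_b \<alpha>)) $$ (i, j)"
      by (subst rep_elt_mult[OF m, where t = Vtx2]) (use that in auto)
    also have "\<dots> = v $$ (i, \<alpha> - 1) * w $$ (\<alpha> - 1, j)"
      using that m by (simp add: scalar_prod_def fields rep_entry_bd[OF m[unfolded fields]])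
    finally show "rep_entry n m Vtx1 Vtx1 (el_d \<alpha> * el_b \<alpha>) i j = v $$ (i, \<alpha> - 1) * w $$ (\<alpha> - 1, j)" .
  qed
  have vw: "(v * w) $$ (i, j) = (\<Sum>\<alpha> = 1..r. v $$ (i, \<alpha> - 1) * w $$ (\<alpha> - 1, j))" if "i < n" "j < n" for i j
  proof -
    have "(v * w) $$ (i, j) = (\<Sum>k = 0..<r. v $$ (i, k) * w $$ (k, j))"
      using c that by (auto simp: scalar_prod_def)
    also have "\<dots> = (\<Sum>\<alpha> = 1..r. v $$ (i, \<alpha> - 1) * w $$ (\<alpha> - 1, j))"
      by (rule sum.reindex_bij_witness[of _ "\<lambda>k. k - 1" Suc]) auto
    finally show ?thesis .
  qed
  show ?thesis
    unfolding c_elt_eq commutator_def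
    by (rule eq_matI)
      (use c in \<open>simp_all add: fields[symmetric] rep_entry_add rep_entry_diff rep_entry_sum e bd
          del: index_mult_mat(1)\<close>,
       simp_all add: fields vw sum_negf del: index_mult_mat(1))
qed

lemma moment_act:
  assumes "m \<in> rep_space n r" "\<psi> \<in> Aut_sympl r"
  shows "moment (act n r m \<psi>) = moment m"
  by (simp add: moment_eq[OF assms(1)] moment_eq[OF act_in_rep_space] rep_elt_act[OF assms c_elt_in_CQ]
      Aut_symplD(6)[OF assms(2)])

section \<open>Conjugation and equivariance\<close>

fun conj_point :: "complex mat \<Rightarrow> complex mat \<Rightarrow> point \<Rightarrow> point" where
  "conj_point g h (X, Y, v, w) = (g * X * h, g * Y * h, g * v, w * h)"

definition GL_pairs :: "nat \<Rightarrow> (complex mat \<times> complex mat) set" where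
  "GL_pairs n = {(g, h). g \<in> carrier_mat n n \<and> h \<in> carrier_mat n n \<and> g * h = 1\<^sub>m n \<and> h * g = 1\<^sub>m n}"

lemma GL_orbit_eq: "GL_orbit n m = (\<lambda>(g, h). conj_point g h m) ` GL_pairs n"
proof -
  have "inverts_mat g h \<longleftrightarrow> g * h = 1\<^sub>m n" if "g \<in> carrier_mat n n" for g h :: "complex mat"
    using that by (simp add: inverts_mat_def)
  then have "GL_pairs n = {(g, h). g \<in> carrier_mat n n \<and> h \<in> carrier_mat n n \<and> inverts_mat g h \<and> inverts_mat h g}"
    unfolding GL_pairs_def by blast
  moreover have "{f g h | g h. P g h} = (\<lambda>(g, h). f g h) ` {(g, h). P g h}"
    for f :: "complex mat \<Rightarrow> complex mat \<Rightarrow> point" and P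
    by auto
  from this[of "\<lambda>g h. conj_point g h m"]
  have "GL_orbit n m = (\<lambda>(g, h). conj_point g h m) `
      {(g, h). g \<in> carrier_mat n n \<and> h \<in> carrier_mat n n \<and> inverts_mat g h \<and> inverts_mat h g}"
    by (cases m) (simp only: GL_orbit.simps conj_point.simps)
  ultimately show ?thesis by simp
qed

lemma conj_point_in_rep_space: "m \<in> rep_space n r \<Longrightarrow> (g, h) \<in> GL_pairs n \<Longrightarrow> conj_point g h m \<in> rep_space n r"
  by (cases m) (auto simp: rep_space_def GL_pairs_def)

lemma conj_point_conj_point:
  assumes m: "m \<in> rep_space n r" and "(g, h) \<in> GL_pairs n" "(g', h') \<in> GL_pairs n"
  shows "conj_point g' h' (conj_point g h m) = conj_point (g' * g) (h * h') m"
proof (cases m)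
  case (fields X Y v w)
  have *: "g' * (g * Z * h) * h' = g' * g * Z * (h * h')" if "Z \<in> carrier_mat n n" for Z
  proof -
    have "g' * (g * Z * h) * h' = g' * ((g * Z * h) * h')"
      using assms that by (intro assoc_mult_mat[of _ n n _ n _ n]) (auto simp: GL_pairs_def)
    also have "(g * Z * h) * h' = g * Z * (h * h')"
      using assms that by (intro assoc_mult_mat[of _ n n _ n _ n]) (auto simp: GL_pairs_def)
    also have "g' * (g * Z * (h * h')) = g' * (g * Z) * (h * h')"
      using assms that by (intro assoc_mult_mat[of _ n n _ n _ n, symmetric]) (auto simp: GL_pairs_def)
    also have "g' * (g * Z) = g' * g * Z"
      using assms that by (intro assoc_mult_mat[of _ n n _ n _ n, symmetric]) (auto simp: GL_pairs_def)
    finally show ?thesis .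
  qed
  have c: "g \<in> carrier_mat n n" "h \<in> carrier_mat n n" "g' \<in> carrier_mat n n" "h' \<in> carrier_mat n n"
    using assms(2,3) by (auto simp: GL_pairs_def)
  note m = rep_space_carriers[OF m[unfolded fields]]
  show ?thesis
    unfolding fields conj_point.simps *[OF m(1)] *[OF m(2)]
    using assoc_mult_mat[OF c(3,1) m(3)] assoc_mult_mat[OF m(4) c(2,4)] by simp
qed

lemma GL_pairs_mult: 
  assumes "(g, h) \<in> GL_pairs n" "(g', h') \<in> GL_pairs n" 
  shows "(g' * g, h * h') \<in> GL_pairs n"
proof -
  have *: "a' * a * (b * b') = 1\<^sub>m n"
    if c: "a \<in> carrier_mat n n" "b \<in> carrier_mat n n" "a' \<in> carrier_mat n n" "b' \<in> carrier_mat n n"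
      and 1: "a * b = 1\<^sub>m n" "a' * b' = 1\<^sub>m n" for a b a' b' :: "complex mat"
  proof -
    have "a' * a * (b * b') = a' * (a * (b * b'))"
      using c by (intro assoc_mult_mat[of _ n n _ n _ n]) auto
    also have "a * (b * b') = a * b * b'"
      using c by (intro assoc_mult_mat[of _ n n _ n _ n, symmetric]) auto
    finally show ?thesis using c 1 by simp
  qed
  show ?thesis
    using assms *[of g h g' h'] *[of h' g' h g] by (auto simp: GL_pairs_def)
qed

lemma GL_orbit_conj_point:
  assumes m: "m \<in> rep_space n r" and gh: "(g, h) \<in> GL_pairs n"
  shows "GL_orbit n (conj_point g h m) = GL_orbit n m"
proof
  have sub: "GL_orbit n (conj_point g h m) \<subseteq> GL_orbit n m"
    if "m \<in> rep_space n r" "(g, h) \<in> GL_pairs n" for m g h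
    using conj_point_conj_point[OF that] GL_pairs_mult[OF that(2)]
    by (fastforce simp: GL_orbit_eq)
  show "GL_orbit n (conj_point g h m) \<subseteq> GL_orbit n m" by (rule sub) fact+
  have hg: "(h, g) \<in> GL_pairs n" using gh by (auto simp: GL_pairs_def)
  have "conj_point h g (conj_point g h m) = conj_point (1\<^sub>m n) (1\<^sub>m n) m"
    using gh by (simp add: conj_point_conj_point[OF m gh hg]) (simp add: GL_pairs_def)
  also have "\<dots> = m"
    using m by (cases m) (auto simp: rep_space_def)
  finally show "GL_orbit n m \<subseteq> GL_orbit n (conj_point g h m)"
    using sub[OF conj_point_in_rep_space[OF m gh] hg] by simp
qed

text \<open>Conjugation acts by g at vertex 1 and by 1 at vertex 2. Along a path the inner factors
  cancel in pairs, so the block of every element of the algebra is conjugated in the same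
  way.\<close>

lemma act_conj_point:
  assumes m: "m \<in> rep_space n r" and gh: "(g, h) \<in> GL_pairs n" and \<psi>: "\<psi> \<in> Aut_sympl r"
  shows "act n r (conj_point g h m) \<psi> = conj_point g h (act n r m \<psi>)"
proof -
  define G where "G t = (case t of Vtx1 \<Rightarrow> g | Vtx2 \<Rightarrow> 1\<^sub>m 1)" for t
  define H where "H t = (case t of Vtx1 \<Rightarrow> h | Vtx2 \<Rightarrow> 1\<^sub>m 1)" for t
  have GH: "G t \<in> carrier_mat (rep_dim n t) (rep_dim n t)" "H t \<in> carrier_mat (rep_dim n t) (rep_dim n t)"
    "H t * G t = 1\<^sub>m (rep_dim n t)" "G t * H t = 1\<^sub>m (rep_dim n t)" for t
    using gh by (cases t; simp add: G_def H_def GL_pairs_def)+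
  let ?m = "conj_point g h m"
  have m': "?m \<in> rep_space n r" by (rule conj_point_in_rep_space) fact+
  have arr: "rep_arr ?m \<eta> = G (tgt \<eta>) * rep_arr m \<eta> * H (src \<eta>)" if \<eta>: "\<eta> \<in> arcs (quiver r)" for \<eta>
  proof (cases m)
    case (fields X Y v w)
    note c = rep_space_carriers[OF m[unfolded fields]]
    have g: "g \<in> carrier_mat n n" "h \<in> carrier_mat n n" using gh by (auto simp: GL_pairs_def)
    show ?thesis
    proof (cases \<eta>)
      case (Arr_b \<alpha>)
      with \<eta> have "\<alpha> - 1 < r" by (auto simp: arcs_quiver)
      moreover have "1\<^sub>m 1 * mat_of_row (row w (\<alpha> - 1)) = mat_of_row (row w (\<alpha> - 1))"
        using c by (intro left_mult_one_mat[of _ 1 n]) auto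
      ultimately show ?thesis
        using c g by (auto simp: fields Arr_b G_def H_def intro!: eq_matI)
    next
      case (Arr_d \<alpha>)
      with \<eta> have "\<alpha> - 1 < r" by (auto simp: arcs_quiver)
      moreover have "g * mat_of_cols n [col v (\<alpha> - 1)] * 1\<^sub>m 1 = g * mat_of_cols n [col v (\<alpha> - 1)]"
        using g by (intro right_mult_one_mat) auto
      moreover have "vec n (($) (col v (\<alpha> - 1))) = col v (\<alpha> - 1)"
        using c by (intro eq_vecI) auto
      ultimately show ?thesis
        using c g by (auto simp: fields Arr_d G_def H_def mat_of_cols_def intro!: eq_matI)
    qed (simp_all add: fields G_def H_def)
  qed
  have path_conj: "rep_path n ?m u p = G v * rep_path n m u p * H u"
    if "cas u p v" "set p \<subseteq> arcs (quiver r)" for u p v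
    using that
  proof (induction p arbitrary: u)
    case Nil
    then show ?case using GH[of u] by simp
  next
    case (Cons \<eta> p)
    then have u: "src \<eta> = u" and IH: "rep_path n ?m (tgt \<eta>) p = G v * rep_path n m (tgt \<eta>) p * H (tgt \<eta>)"
      and c: "cas (tgt \<eta>) p v" and \<eta>: "\<eta> \<in> arcs (quiver r)" by auto
    note car = GH[of v] GH[of u] GH[of "tgt \<eta>"] rep_path_carrier[OF m c] rep_arr_carrier[OF m, of \<eta>, unfolded u]
    let ?P = "rep_path n m (tgt \<eta>) p" and ?A = "rep_arr m \<eta>"
    have "G (tgt \<eta>) * ?A * H u = G (tgt \<eta>) * (?A * H u)"
      using car by (intro assoc_mult_mat) auto
    then have "H (tgt \<eta>) * (G (tgt \<eta>) * ?A * H u) = H (tgt \<eta>) * G (tgt \<eta>) * (?A * H u)"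
      using car by (subst assoc_mult_mat) (auto intro!: mult_carrier_mat)
    then have *: "H (tgt \<eta>) * (G (tgt \<eta>) * ?A * H u) = ?A * H u" using car by simp
    have "G v * ?P * H (tgt \<eta>) * (G (tgt \<eta>) * ?A * H u) = G v * ?P * (H (tgt \<eta>) * (G (tgt \<eta>) * ?A * H u))"
      using car by (intro assoc_mult_mat) (auto intro!: mult_carrier_mat)
    also have "\<dots> = G v * ?P * ?A * H u"
      unfolding * using car by (intro assoc_mult_mat[symmetric]) (auto intro!: mult_carrier_mat)
    also have "\<dots> = G v * (?P * ?A) * H u"
      using car by (subst assoc_mult_mat[of "G v"]) auto
    finally show ?case by (simp add: IH arr[OF \<eta>] u)
  qed
  have elt: "rep_elt n ?m u v x = G v * rep_elt n m u v x * H u" if "x \<in> CQ r" for u v x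
    using that
  proof (induction x rule: CQ.PA_induct)
    case zero
    then show ?case using GH[of u] GH[of v] by (simp add: rep_elt_0)
  next
    case (add x y)
    note car = GH[of v] GH[of u] rep_elt_carrier[of n m u v x] rep_elt_carrier[of n m u v y]
    have "G v * (rep_elt n m u v x + rep_elt n m u v y) * H u =
        (G v * rep_elt n m u v x + G v * rep_elt n m u v y) * H u"
      using car by (subst mult_add_distrib_mat) auto
    also have "\<dots> = G v * rep_elt n m u v x * H u + G v * rep_elt n m u v y * H u"
      using car by (subst add_mult_distrib_mat[of _ "rep_dim n v" "rep_dim n u"]) (auto intro!: mult_carrier_mat)
    finally show ?case using add by (simp add: rep_elt_add)
  next
    case (path c u' p v')
    show ?case
    proof (cases "u = u' \<and> v = v'")
      case True
      have "G v * (c \<cdot>\<^sub>m rep_path n m u p) = c \<cdot>\<^sub>m (G v * rep_path n m u p)"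
        using True rep_path_carrier[OF m path(3)] GH(1)[of v] by (intro mult_smult_distrib) auto
      moreover have "c \<cdot>\<^sub>m (G v * rep_path n m u p) * H u = c \<cdot>\<^sub>m (G v * rep_path n m u p * H u)"
        using True rep_path_carrier[OF m path(3)] GH(1)[of v] GH(2)[of u]
        by (intro mult_smult_assoc_mat[of _ "rep_dim n v" "rep_dim n u" _ "rep_dim n u"]) auto
      moreover have "rep_path n ?m u p = G v * rep_path n m u p * H u"
        using path_conj path True by simp
      moreover have "rep_elt n m u v (path_elt (u', p, v')) = rep_path n m u p"
        "rep_elt n ?m u v (path_elt (u', p, v')) = rep_path n ?m u p"
        unfolding rep_elt_path_elt[OF m path(3)] rep_elt_path_elt[OF m' path(3)] if_P[OF True] by simp_all
      ultimately show ?thesis by (simp only: rep_elt_scale)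
    next
      case False
      have "rep_elt n m u v (path_elt (u', p, v')) = 0\<^sub>m (rep_dim n v) (rep_dim n u)"
        "rep_elt n ?m u v (path_elt (u', p, v')) = 0\<^sub>m (rep_dim n v) (rep_dim n u)"
        unfolding rep_elt_path_elt[OF m path(3)] rep_elt_path_elt[OF m' path(3)] if_not_P[OF False] by simp_all
      then show ?thesis
        using GH[of u] GH[of v] by (simp add: rep_elt_scale smult_zero_mat)
    qed
  qed
  have g: "g \<in> carrier_mat n n" "h \<in> carrier_mat n n" using gh by (auto simp: GL_pairs_def)
  have loops: "rep_elt n ?m Vtx1 Vtx1 x = g * rep_elt n m Vtx1 Vtx1 x * h" if "x \<in> CQ r" for x
    using elt[OF that, of Vtx1 Vtx1] by (simp only: G_def H_def vertex.case)
  have d: "rep_elt n ?m Vtx2 Vtx1 x = g * rep_elt n m Vtx2 Vtx1 x" if "x \<in> CQ r" for x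
  proof -
    have "g * rep_elt n m Vtx2 Vtx1 x \<in> carrier_mat n 1"
      using g rep_elt_carrier[of n m Vtx2 Vtx1 x] by simp
    then show ?thesis
      using elt[OF that, of Vtx2 Vtx1] by (simp only: G_def H_def vertex.case right_mult_one_mat)
  qed
  have b: "rep_elt n ?m Vtx1 Vtx2 x = rep_elt n m Vtx1 Vtx2 x * h" if "x \<in> CQ r" for x
  proof -
    have "rep_elt n m Vtx1 Vtx2 x \<in> carrier_mat 1 n"
      using rep_elt_carrier[of n m Vtx1 Vtx2 x] by simp
    then show ?thesis
      using elt[OF that, of Vtx1 Vtx2] by (simp only: G_def H_def vertex.case left_mult_one_mat)
  qed
  note in_CQ = Aut_symplD(1)[OF \<psi>]
  have v: "mat n r (\<lambda>(i, j). rep_elt n ?m Vtx2 Vtx1 (\<psi> (el_d (j + 1))) $$ (i, 0)) =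
      g * mat n r (\<lambda>(i, j). rep_elt n m Vtx2 Vtx1 (\<psi> (el_d (j + 1))) $$ (i, 0))"
    (is "_ = g * ?M")
  proof (rule eq_matI)
    fix i j assume "i < dim_row (g * ?M)" "j < dim_col (g * ?M)"
    then have ij: "i < n" "j < r" using g by auto
    let ?R = "rep_elt n m Vtx2 Vtx1 (\<psi> (el_d (j + 1)))"
    have CQ: "\<psi> (el_d (j + 1)) \<in> CQ r" using ij by (intro in_CQ CQ_arrow) auto
    have "col ?R 0 = col ?M j" using ij by (intro eq_vecI) (auto simp del: index_rep_elt)
    then have "(g * ?R) $$ (i, 0) = (g * ?M) $$ (i, j)" using ij g by simp
    then show "mat n r (\<lambda>(i, j). rep_elt n ?m Vtx2 Vtx1 (\<psi> (el_d (j + 1))) $$ (i, 0)) $$ (i, j) =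
        (g * ?M) $$ (i, j)"
      using ij by (simp only: index_mat d[OF CQ] prod.case)
  qed (use g in auto)
  have w: "mat r n (\<lambda>(i, j). rep_elt n ?m Vtx1 Vtx2 (\<psi> (el_b (i + 1))) $$ (0, j)) =
      mat r n (\<lambda>(i, j). rep_elt n m Vtx1 Vtx2 (\<psi> (el_b (i + 1))) $$ (0, j)) * h"
    (is "_ = ?M * h")
  proof (rule eq_matI)
    fix i j assume "i < dim_row (?M * h)" "j < dim_col (?M * h)"
    then have ij: "i < r" "j < n" using g by auto
    let ?R = "rep_elt n m Vtx1 Vtx2 (\<psi> (el_b (i + 1)))"
    have CQ: "\<psi> (el_b (i + 1)) \<in> CQ r" using ij by (intro in_CQ CQ_arrow) auto
    have "row ?R 0 = row ?M i" using ij by (intro eq_vecI) (auto simp del: index_rep_elt)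
    then have "(?R * h) $$ (0, j) = (?M * h) $$ (i, j)" using ij g by simp
    then show "mat r n (\<lambda>(i, j). rep_elt n ?m Vtx1 Vtx2 (\<psi> (el_b (i + 1))) $$ (0, j)) $$ (i, j) =
        (?M * h) $$ (i, j)"
      using ij by (simp only: index_mat b[OF CQ] prod.case)
  qed (use g in auto)
  show ?thesis
    unfolding act_def conj_point.simps v w loops[OF in_CQ[OF CQ_arrow(1)]] loops[OF in_CQ[OF CQ_arrow(2)]] ..
qed

section \<open>Orbits\<close>

text \<open>Stated for points although it compares orbits: conjugation is built in, and on
  \<open>rep_space n r\<close> it is an equivalence relation, so the normal forms can be computed
  with representatives.\<close>

definition reach :: "nat \<Rightarrow> nat \<Rightarrow> point \<Rightarrow> point \<Rightarrow> bool" where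
  "reach n r m m' \<longleftrightarrow> m \<in> rep_space n r \<and> m' \<in> rep_space n r \<and>
     (\<exists>\<psi> \<in> grp_calP r. orbit_act n r (GL_orbit n m) \<psi> = GL_orbit n m')"

lemma orbit_act_GL_orbit:
  assumes "m \<in> rep_space n r" "\<psi> \<in> Aut_sympl r"
  shows "orbit_act n r (GL_orbit n m) \<psi> = GL_orbit n (act n r m \<psi>)"
  unfolding orbit_act_def GL_orbit_eq image_image
  by (rule image_cong) (auto simp: act_conj_point[OF assms(1) _ assms(2)])

lemma GL_orbit_in_rep_space: "m \<in> rep_space n r \<Longrightarrow> GL_orbit n m \<subseteq> rep_space n r"
  by (auto simp: GL_orbit_eq conj_point_in_rep_space)

lemma orbit_act_compose:
  assumes "p \<subseteq> rep_space n r" "\<psi> \<in> Aut_sympl r" "\<phi> \<in> Aut_sympl r"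
  shows "orbit_act n r p (compose (CQ r) \<psi> \<phi>) = orbit_act n r (orbit_act n r p \<psi>) \<phi>"
  using assms unfolding orbit_act_def image_image by (intro image_cong refl act_compose) auto

lemma orbit_act_id: "p \<subseteq> rep_space n r \<Longrightarrow> orbit_act n r p (\<lambda>x\<in>CQ r. x) = p"
  unfolding orbit_act_def by (subst image_cong[OF refl act_id]) auto

lemma reach_trans:
  assumes "reach n r m m'" "reach n r m' m''"
  shows "reach n r m m''"
proof -
  from assms obtain \<psi> \<phi> where m: "m \<in> rep_space n r" "m'' \<in> rep_space n r"
    and c: "\<psi> \<in> grp_calP r" "\<phi> \<in> grp_calP r"
    and o: "orbit_act n r (GL_orbit n m) \<psi> = GL_orbit n m'"
      "orbit_act n r (GL_orbit n m') \<phi> = GL_orbit n m''"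
    unfolding reach_def by blast
  have "\<psi> \<in> Aut_sympl r" "\<phi> \<in> Aut_sympl r" using c grp_calP_subset by blast+
  then have "orbit_act n r (GL_orbit n m) (compose (CQ r) \<psi> \<phi>) = GL_orbit n m''"
    by (simp add: orbit_act_compose[OF GL_orbit_in_rep_space[OF m(1)]] o)
  then show ?thesis using m grp_calP_compose[OF c] unfolding reach_def by blast
qed

lemma reach_sym:
  assumes "reach n r m m'"
  shows "reach n r m' m"
proof -
  from assms obtain \<psi> where m: "m \<in> rep_space n r" "m' \<in> rep_space n r"
    and c: "\<psi> \<in> grp_calP r" and o: "orbit_act n r (GL_orbit n m) \<psi> = GL_orbit n m'"
    unfolding reach_def by blast
  obtain \<phi> where \<phi>: "\<phi> \<in> grp_calP r" "compose (CQ r) \<psi> \<phi> = (\<lambda>x\<in>CQ r. x)"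
    using grp_calP_inverse[OF c] by blast
  have "\<psi> \<in> Aut_sympl r" "\<phi> \<in> Aut_sympl r" using c \<phi>(1) grp_calP_subset by blast+
  then have "orbit_act n r (GL_orbit n m') \<phi> = GL_orbit n m"
    using orbit_act_compose[OF GL_orbit_in_rep_space[OF m(1)], of \<psi> \<phi>]
    by (simp add: o \<phi>(2) orbit_act_id[OF GL_orbit_in_rep_space[OF m(1)]])
  then show ?thesis using m \<phi>(1) unfolding reach_def by blast
qed

lemma reach_act:
  assumes m: "m \<in> rep_space n r" and \<psi>: "\<psi> \<in> grp_calP r" and m': "act n r m \<psi> = m'"
  shows "reach n r m m'"
proof -
  have "\<psi> \<in> Aut_sympl r" using \<psi> grp_calP_subset by blast
  then have "orbit_act n r (GL_orbit n m) \<psi> = GL_orbit n m'"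
    by (simp add: orbit_act_GL_orbit[OF m] m')
  then show ?thesis using m \<psi> act_in_rep_space[of n r m \<psi>] unfolding reach_def m' by blast
qed

lemma reach_refl: "m \<in> rep_space n r \<Longrightarrow> reach n r m m"
  using subgroup.one_closed[OF subgroup_grp_calP[of r]]
  by (intro reach_act[of _ _ _ "\<lambda>x\<in>CQ r. x"]) (simp_all add: BijGroup_def act_id)

lemma reach_GL:
  assumes "m \<in> rep_space n r" "(g, h) \<in> GL_pairs n"
  shows "reach n r m (conj_point g h m)"
  using reach_refl[OF assms(1)] GL_orbit_conj_point[OF assms] conj_point_in_rep_space[OF assms]
  by (simp add: reach_def)

section \<open>The action of the generators\<close>

lemma act_subst:
  assumes "CQ_map r f" "m \<in> rep_space n r"
  shows "act n r m (restrict (subst f) (CQ r)) =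
    (rep_elt n m Vtx1 Vtx1 (f Arr_a), rep_elt n m Vtx1 Vtx1 (f Arr_a'),
     mat n r (\<lambda>(i, j). rep_entry n m Vtx2 Vtx1 (f (Arr_d (j + 1))) i 0),
     mat r n (\<lambda>(i, j). rep_entry n m Vtx1 Vtx2 (f (Arr_b (i + 1))) 0 j))"
  unfolding act_def
  by (auto simp: CQ_mapD(1)[OF assms(1)] arcs_quiver intro!: cong_mat)

lemma mat_rep_entry_bd:
  assumes "(X, Y, v, w) \<in> rep_space n r"
  shows "mat n r (\<lambda>(i, j). rep_entry n (X, Y, v, w) Vtx2 Vtx1 (el_d (Suc j)) i 0) = v"
    and "mat r n (\<lambda>(i, j). rep_entry n (X, Y, v, w) Vtx1 Vtx2 (el_b (Suc i)) 0 j) = w"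
  using assms rep_space_carriers[OF assms] by (auto simp: rep_entry_bd[OF assms] intro!: eq_matI)

lemma reach_fourier:
  assumes m: "(X, Y, v, w) \<in> rep_space n r"
  shows "reach n r (X, Y, v, w) (Y, - X, v, w)"
  by (rule reach_act[OF m fourier_in_grp_calP(2)])
    (simp add: act_subst[OF fourier_in_grp_calP(1) m] mat_rep_entry_bd[OF m] rep_elt_loops[OF m] rep_elt_uminus)

lemma reach_shift:
  assumes m: "(X, Y, v, w) \<in> rep_space n r"
  shows "reach n r (X, Y, v, w) (X, Y + rep_elt n (X, Y, v, w) Vtx1 Vtx1 (poly_a q), v, w)"
  by (rule reach_act[OF m shift_in_grp_calP(2)[of q r]])
    (simp add: act_subst[OF shift_in_grp_calP(1) m] mat_rep_entry_bd[OF m] rep_elt_loops[OF m] rep_elt_add)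

lemma rep_elt_poly_a_pCons:
  assumes m: "(X, Y, v, w) \<in> rep_space n r"
  shows "rep_elt n (X, Y, v, w) Vtx1 Vtx1 (poly_a (pCons c q)) =
    c \<cdot>\<^sub>m 1\<^sub>m n + X * rep_elt n (X, Y, v, w) Vtx1 Vtx1 (poly_a q)"
  using rep_elt_mult[OF m, where t = Vtx1, of el_a "poly_a q" Vtx1 Vtx1] rep_elt_triv[of n _ Vtx1]
  by (simp add: poly_a_pCons rep_elt_add rep_elt_scale rep_elt_loops[OF m])

section \<open>Diagonal \<open>X\<close>\<close>

definition dmat :: "nat \<Rightarrow> (nat \<Rightarrow> complex) \<Rightarrow> complex mat" where
  "dmat n x = mat n n (\<lambda>(i, j). if i = j then x i else 0)"

lemma dmat_carrier [simp]: "dmat n x \<in> carrier_mat n n"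
  and dim_dmat [simp]: "dim_row (dmat n x) = n" "dim_col (dmat n x) = n"
  and index_dmat [simp]: "i < n \<Longrightarrow> j < n \<Longrightarrow> dmat n x $$ (i, j) = (if i = j then x i else 0)"
  by (simp_all add: dmat_def)

lemma index_dmat_mult [simp]:
  assumes "dim_row B = n" "i < n" "j < dim_col B"
  shows "(dmat n x * B) $$ (i, j) = x i * B $$ (i, j)"
proof -
  have "(dmat n x * B) $$ (i, j) = (\<Sum>k = 0..<n. (if i = k then x i else 0) * B $$ (k, j))"
    using assms by (simp add: scalar_prod_def)
  also have "\<dots> = (\<Sum>k = 0..<n. if k = i then x i * B $$ (i, j) else 0)"
    by (intro sum.cong) auto
  finally show ?thesis using assms by simp
qed

lemma index_mult_dmat [simp]:
  assumes "dim_col B = n" "i < dim_row B" "j < n"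
  shows "(B * dmat n x) $$ (i, j) = B $$ (i, j) * x j"
proof -
  have "(B * dmat n x) $$ (i, j) = (\<Sum>k = 0..<n. B $$ (i, k) * (if k = j then x k else 0))"
    using assms by (simp add: scalar_prod_def)
  also have "\<dots> = (\<Sum>k = 0..<n. if k = j then B $$ (i, j) * x j else 0)"
    by (intro sum.cong) auto
  finally show ?thesis using assms by simp
qed

lemma rep_elt_poly_a_dmat:
  assumes m: "(dmat n x, Y, v, w) \<in> rep_space n r"
  shows "rep_elt n (dmat n x, Y, v, w) Vtx1 Vtx1 (poly_a q) = dmat n (\<lambda>i. poly q (x i))"
proof (induction q)
  case 0
  then show ?case by (auto simp: rep_elt_0 intro!: eq_matI)
next
  case (pCons c q)
  show ?case
    unfolding rep_elt_poly_a_pCons[OF m] pCons.IH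
    by (rule eq_matI) (simp_all del: index_mult_mat(1))
qed

lemma reach_shift_dmat:
  assumes m: "(dmat n x, Y, v, w) \<in> rep_space n r"
  shows "reach n r (dmat n x, Y, v, w) (dmat n x, Y + dmat n (\<lambda>i. poly q (x i)), v, w)"
  using reach_shift[OF m, of q] by (simp add: rep_elt_poly_a_dmat[OF m])

section \<open>Polynomials in a nilpotent Jordan block\<close>

definition shift_mat :: "nat \<Rightarrow> complex mat" where
  "shift_mat n = mat n n (\<lambda>(i, j). if j = Suc i then 1 else 0)"

lemma shift_mat_carrier [simp]: "shift_mat n \<in> carrier_mat n n"
  and dim_shift_mat [simp]: "dim_row (shift_mat n) = n" "dim_col (shift_mat n) = n"
  by (simp_all add: shift_mat_def)

lemma index_shift_mat_mult [simp]:
  assumes "dim_row B = n" "i < n" "j < dim_col B"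
  shows "(shift_mat n * B) $$ (i, j) = (if Suc i < n then B $$ (Suc i, j) else 0)"
proof -
  have "(shift_mat n * B) $$ (i, j) = (\<Sum>k = 0..<n. (if k = Suc i then 1 else 0) * B $$ (k, j))"
    using assms by (simp add: scalar_prod_def shift_mat_def)
  also have "\<dots> = (\<Sum>k = 0..<n. if k = Suc i then B $$ (Suc i, j) else 0)"
    by (intro sum.cong) auto
  finally show ?thesis by simp
qed

lemma index_mult_shift_mat [simp]:
  assumes "dim_col B = n" "i < dim_row B" "j < n"
  shows "(B * shift_mat n) $$ (i, j) = (if j = 0 then 0 else B $$ (i, j - 1))"
proof -
  have "(B * shift_mat n) $$ (i, j) = (\<Sum>k = 0..<n. B $$ (i, k) * (if j = Suc k then 1 else 0))"
    using assms by (simp add: scalar_prod_def shift_mat_def)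
  also have "\<dots> = (\<Sum>k = 0..<n. if k = j - 1 then (if j = 0 then 0 else B $$ (i, j - 1)) else 0)"
    by (intro sum.cong) auto
  finally show ?thesis using assms by (cases j) auto
qed

text \<open>The polynomials in \<open>shift_mat n\<close>, with \<open>c k\<close> as the
  coefficient of the k-th power.\<close>

definition toep :: "nat \<Rightarrow> (nat \<Rightarrow> complex) \<Rightarrow> complex mat" where
  "toep n c = mat n n (\<lambda>(i, j). if i \<le> j then c (j - i) else 0)"

lemma toep_carrier [simp]: "toep n c \<in> carrier_mat n n"
  and dim_toep [simp]: "dim_row (toep n c) = n" "dim_col (toep n c) = n"
  and index_toep [simp]: "i < n \<Longrightarrow> j < n \<Longrightarrow> toep n c $$ (i, j) = (if i \<le> j then c (j - i) else 0)"
  by (simp_all add: toep_def)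

lemma toep_commute: "toep n c * shift_mat n = shift_mat n * toep n c"
  by (rule eq_matI) (auto simp del: index_mult_mat(1) simp: Suc_diff_Suc less_Suc_eq_le
      Suc_le_eq le_diff_conv split: nat.splits)

text \<open>Entrywise, commuting with the shift says that moving one step down a diagonal does not
  change an entry, and that the part of column 0 below row 0 vanishes. So row 0 determines
  everything.\<close>

lemma commute_shift_mat_imp_toep:
  assumes Z: "Z \<in> carrier_mat n n" and comm: "Z * shift_mat n = shift_mat n * Z"
  shows "Z = toep n (\<lambda>k. Z $$ (0, k))"
proof -
  have eq: "(if j = 0 then 0 else Z $$ (i, j - 1)) = (if Suc i < n then Z $$ (Suc i, j) else 0)"
    if "i < n" "j < n" for i j
    using arg_cong[OF comm, of "\<lambda>M. M $$ (i, j)"] Z that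
    by (simp del: index_mult_mat(1))
  have "Z $$ (i, j) = (if i \<le> j then Z $$ (0, j - i) else 0)" if "i < n" "j < n" for i j
    using that
  proof (induction i arbitrary: j)
    case (Suc i)
    have "Z $$ (Suc i, j) = (if j = 0 then 0 else Z $$ (i, j - 1))"
      using eq[of i j] Suc.prems by simp
    also have "\<dots> = (if Suc i \<le> j then Z $$ (0, j - Suc i) else 0)"
      using Suc by (cases j) auto
    finally show ?case .
  qed simp
  then show ?thesis using Z by (intro eq_matI) auto
qed

lemma rep_elt_poly_a_shift_mat:
  assumes m: "(shift_mat n, Y, v, w) \<in> rep_space n r"
  shows "rep_elt n (shift_mat n, Y, v, w) Vtx1 Vtx1 (poly_a q) = toep n (Polynomial.coeff q)"
proof (induction q)
  case 0
  then show ?case by (auto simp: rep_elt_0 intro!: eq_matI)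
next
  case (pCons c q)
  show ?case
    unfolding rep_elt_poly_a_pCons[OF m] pCons.IH
    by (rule eq_matI) (auto simp: coeff_pCons simp del: index_mult_mat(1) split: nat.splits
      simp: Suc_diff_le diff_Suc)
qed

text \<open>A shift of a' conjugated by the exchange of the loops: (X, N) goes to (N, -X), then to
  (N, -X + q(N)), and back.\<close>

lemma reach_shift_toep:
  assumes m: "(X, shift_mat n, v, w) \<in> rep_space n r"
  shows "reach n r (X, shift_mat n, v, w) (X + toep n c, shift_mat n, v, w)"
proof -
  note car = rep_space_carriers[OF m]
  \<comment> \<open>The sign compensates the -X produced by the exchange; coefficients from degree n
    on are irrelevant because the n-th power of the block is 0.\<close>
  define q where "q = Poly (map (\<lambda>k. - c k) [0..<n])"
  have q: "toep n (Polynomial.coeff q) = - toep n c"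
    by (rule eq_matI) (auto simp: q_def nth_default_def)
  have m2: "(shift_mat n, - X, v, w) \<in> rep_space n r"
    "(X + toep n c, shift_mat n, v, w) \<in> rep_space n r"
    using car by (auto simp: rep_space_def)
  have "reach n r (shift_mat n, - X, v, w) (shift_mat n, - X + - toep n c, v, w)"
    using reach_shift[OF m2(1), of q] by (simp add: rep_elt_poly_a_shift_mat[OF m2(1)] q)
  moreover have "- X + - toep n c = - (X + toep n c)"
    using car by (intro eq_matI) auto
  ultimately have "reach n r (shift_mat n, - X, v, w) (shift_mat n, - (X + toep n c), v, w)" by simp
  then show ?thesis
    by (rule reach_trans[OF reach_fourier[OF m] reach_trans[OF _ reach_sym[OF reach_fourier[OF m2(2)]]]])
qed

section \<open>Elementary operations on \<open>v\<close> and \<open>w\<close>\<close>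

lemma reach_perm:
  assumes m: "(X, Y, v, w) \<in> rep_space n r" and \<sigma>: "\<sigma> permutes {1..r}"
  shows "reach n r (X, Y, v, w) (X, Y, mat n r (\<lambda>(i, j). v $$ (i, \<sigma> (j + 1) - 1)),
    mat r n (\<lambda>(i, j). w $$ (\<sigma> (i + 1) - 1, j)))"
proof (rule reach_act[OF m perm_in_grp_calP(2)[OF \<sigma>]])
  have in_r: "\<sigma> (Suc j) \<in> {1..r}" if "j < r" for j
    using permutes_in_image[OF \<sigma>, of "Suc j"] that by auto
  show "act n r (X, Y, v, w) (restrict (subst (perm_map \<sigma>)) (CQ r)) =
     (X, Y, mat n r (\<lambda>(i, j). v $$ (i, \<sigma> (j + 1) - 1)), mat r n (\<lambda>(i, j). w $$ (\<sigma> (i + 1) - 1, j)))"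
    unfolding act_subst[OF perm_in_grp_calP(1)[OF \<sigma>] m] perm_map_simps rep_elt_loops[OF m]
    by (auto intro!: cong_mat simp: rep_entry_bd[OF m _ in_r])
qed

text \<open>For diagonal \<open>X\<close> the matrix q(X) multiplies row i of \<open>v\<close> and
  column i of \<open>w\<close> by q(x_i). The new \<open>Y\<close> is left open: the moment equation
  recovers it off the diagonal, and its diagonal is adjustable.\<close>

lemma reach_Lambda_dmat:
  assumes m: "(dmat n x, Y, v, w) \<in> rep_space n r" and r: "r \<ge> 2"
  shows "\<exists>Y'. reach n r (dmat n x, Y, v, w) (dmat n x, Y',
    mat n r (\<lambda>(i, j). v $$ (i, j) - (if j = 1 then poly q (x i) * v $$ (i, 0) else 0)),
    mat r n (\<lambda>(i, j). w $$ (i, j) + (if i = 0 then w $$ (1, j) * poly q (x j) else 0)))"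
proof -
  let ?m = "(dmat n x, Y, v, w)"
  have d: "el_d 1 \<in> CQ r" and b: "el_b 2 \<in> CQ r" using r by auto
  have pd: "rep_entry n ?m Vtx2 Vtx1 (poly_a q * el_d 1) i 0 = poly q (x i) * v $$ (i, 0)" if "i < n" for i
  proof -
    have "rep_entry n ?m Vtx2 Vtx1 (poly_a q * el_d 1) i 0 = rep_elt n ?m Vtx2 Vtx1 (poly_a q * el_d 1) $$ (i, 0)"
      using that by simp
    also have "\<dots> = (dmat n (\<lambda>i. poly q (x i)) * rep_elt n ?m Vtx2 Vtx1 (el_d 1)) $$ (i, 0)"
      by (subst rep_elt_mult[OF m _ d, where t = Vtx1]) (simp_all add: rep_elt_poly_a_dmat[OF m])
    also have "\<dots> = poly q (x i) * v $$ (i, 0)"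
      using that r rep_entry_bd(2)[OF m that, of 1] by (simp del: index_mult_mat(1))
    finally show ?thesis .
  qed
  have bp: "rep_entry n ?m Vtx1 Vtx2 (el_b 2 * poly_a q) 0 j = w $$ (1, j) * poly q (x j)" if "j < n" for j
  proof -
    have "rep_entry n ?m Vtx1 Vtx2 (el_b 2 * poly_a q) 0 j = rep_elt n ?m Vtx1 Vtx2 (el_b 2 * poly_a q) $$ (0, j)"
      using that by simp
    also have "\<dots> = (rep_elt n ?m Vtx1 Vtx2 (el_b 2) * dmat n (\<lambda>i. poly q (x i))) $$ (0, j)"
      by (subst rep_elt_mult[OF m b, where t = Vtx1]) (simp_all add: rep_elt_poly_a_dmat[OF m])
    also have "\<dots> = w $$ (1, j) * poly q (x j)"
      using that r rep_entry_bd(1)[OF m that, of 2] by (simp del: index_mult_mat(1))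
    finally show ?thesis .
  qed
  have "act n r ?m (restrict (subst (Lambda_map q)) (CQ r)) =
     (dmat n x, rep_elt n ?m Vtx1 Vtx1 (Lambda_map q Arr_a'),
      mat n r (\<lambda>(i, j). v $$ (i, j) - (if j = 1 then poly q (x i) * v $$ (i, 0) else 0)),
      mat r n (\<lambda>(i, j). w $$ (i, j) + (if i = 0 then w $$ (1, j) * poly q (x j) else 0)))"
    unfolding act_subst[OF Lambda_map_in_grp_calP(1)[OF r] m]
    by (auto intro!: cong_mat simp: Lambda_map_def rep_entry_add rep_entry_uminus rep_entry_bd[OF m]
        rep_elt_loops[OF m] pd[simplified] bp[simplified])
  then show ?thesis
    using reach_act[OF m Lambda_map_in_grp_calP(2)[OF r]] by blast
qed

text \<open>Newton interpolation: a new node is corrected by a multiple of a product that vanishes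
  at the old ones. The degree bound is recorded as well, since later the coefficients serve as
  coordinates of polynomials of degree less than n.\<close>

lemma interpolate:
  assumes "inj_on x {..<n}"
  shows "\<exists>q :: complex poly. (\<forall>i<n. poly q (x i) = y i) \<and> (\<forall>k\<ge>n. Polynomial.coeff q k = 0)"
  using assms
proof (induction n)
  case 0
  show ?case by (rule exI[of _ 0]) simp
next
  case (Suc n)
  then obtain q where q: "\<forall>i<n. poly q (x i) = y i" "\<forall>k\<ge>n. Polynomial.coeff q k = 0"
    by (auto simp: lessThan_Suc)
  define p where "p = (\<Prod>k<n. [:- x k, 1:])"
  have p: "poly p (x i) = 0" if "i < n" for i
    using that by (auto simp: p_def poly_prod)
  have pn: "poly p (x n) \<noteq> 0"
    using inj_onD[OF Suc.prems, of n] by (fastforce simp: p_def poly_prod)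
  have "degree p \<le> n"
    using degree_prod_sum_le[of "{..<n}" "\<lambda>k. [:- x k, 1:]"] by (simp add: p_def)
  then have "Polynomial.coeff p k = 0" if "k \<ge> Suc n" for k
    using that by (intro coeff_eq_0) simp
  then show ?case
    using q p pn by (intro exI[of _ "q + Polynomial.smult ((y n - poly q (x n)) / poly p (x n)) p"])
      (auto simp: less_Suc_eq)
qed

lemma ex_permutes_pair:
  assumes "k < r" "l < r" "k \<noteq> l"
  shows "\<exists>\<sigma>. \<sigma> permutes {1..r} \<and> \<sigma> 1 = Suc k \<and> \<sigma> 2 = Suc l"
proof -
  let ?t = "transpose 1 (Suc k)"
  \<comment> \<open>The inner transposition sends 2 to the preimage of \<open>Suc l\<close> under
    \<open>?t\<close>; it leaves 1 alone because k and l differ.\<close>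
  let ?\<sigma> = "?t \<circ> transpose 2 (?t (Suc l))"
  have "?\<sigma> permutes {1..r}"
    by (intro permutes_compose permutes_swap_id) (use assms in \<open>auto simp: transpose_def\<close>)
  moreover have "?\<sigma> 1 = Suc k" "?\<sigma> 2 = Suc l"
    using assms by (auto simp: transpose_def)
  ultimately show ?thesis by blast
qed

text \<open>Conjugating \<open>\<Lambda>\<close> by a permutation of the arrows and interpolating at the eigenvalues of \<open>X\<close>
  gives all elementary operations, independently at every eigenvalue.\<close>

lemma reach_elementary:
  assumes m: "(dmat n x, Y, v, w) \<in> rep_space n r" and x: "inj_on x {..<n}"
    and kl: "k < r" "l < r" "k \<noteq> l"
  shows "\<exists>Y'. reach n r (dmat n x, Y, v, w) (dmat n x, Y',
    mat n r (\<lambda>(i, j). v $$ (i, j) - (if j = l then c i * v $$ (i, k) else 0)),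
    mat r n (\<lambda>(i, j). w $$ (i, j) + (if i = k then w $$ (l, j) * c j else 0)))"
proof -
  obtain q where q: "\<And>i. i < n \<Longrightarrow> poly q (x i) = c i" using interpolate[OF x] by blast
  have r: "r \<ge> 2" using kl by linarith
  obtain \<sigma> where \<sigma>: "\<sigma> permutes {1..r}" "\<sigma> 1 = Suc k" "\<sigma> 2 = Suc l"
    using ex_permutes_pair[OF kl] by blast
  let ?i = "inv_into UNIV \<sigma>"
  have \<sigma>': "?i permutes {1..r}" by (rule permutes_inv) fact
  have i: "\<sigma> (?i j) = j" "?i (\<sigma> j) = j" for j using permutes_inverses[OF \<sigma>(1)] by auto
  have i1: "?i j = 1 \<longleftrightarrow> j = Suc k" "?i j = 2 \<longleftrightarrow> j = Suc l" for j using i \<sigma>(2,3) by metis+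
  have range: "?i (Suc j) \<in> {1..r}" if "j < r" for j
    using permutes_in_image[OF \<sigma>', of "Suc j"] that by auto
  define v1 where "v1 = mat n r (\<lambda>(i, j). v $$ (i, \<sigma> (j + 1) - 1))"
  define w1 where "w1 = mat r n (\<lambda>(i, j). w $$ (\<sigma> (i + 1) - 1, j))"
  define v2 where "v2 = mat n r (\<lambda>(i, j). v1 $$ (i, j) - (if j = 1 then poly q (x i) * v1 $$ (i, 0) else 0))"
  define w2 where "w2 = mat r n (\<lambda>(i, j). w1 $$ (i, j) + (if i = 0 then w1 $$ (1, j) * poly q (x j) else 0))"
  have r1: "reach n r (dmat n x, Y, v, w) (dmat n x, Y, v1, w1)"
    using reach_perm[OF m \<sigma>(1)] by (simp add: v1_def w1_def)
  then have m1: "(dmat n x, Y, v1, w1) \<in> rep_space n r" by (simp add: reach_def)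
  obtain Y' where r2: "reach n r (dmat n x, Y, v1, w1) (dmat n x, Y', v2, w2)"
    using reach_Lambda_dmat[OF m1 r, of q] unfolding v2_def w2_def by blast
  then have m2: "(dmat n x, Y', v2, w2) \<in> rep_space n r" by (simp add: reach_def)
  have "mat n r (\<lambda>(i, j). v2 $$ (i, ?i (j + 1) - 1)) =
      mat n r (\<lambda>(i, j). v $$ (i, j) - (if j = l then c i * v $$ (i, k) else 0))"
  proof (rule cong_mat)
    fix a j assume a: "a < n" and j: "j < r"
    then obtain s where s: "?i (Suc j) = Suc s" "s < r" using range[OF j] by (cases "?i (Suc j)") auto
    have "s = 1 \<longleftrightarrow> j = l" using i1(2)[of "Suc j"] s by auto
    moreover have "\<sigma> (Suc s) = Suc j" using i s by metis
    ultimately show "(\<lambda>(i, j). v2 $$ (i, ?i (j + 1) - 1)) (a, j) =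
        (\<lambda>(i, j). v $$ (i, j) - (if j = l then c i * v $$ (i, k) else 0)) (a, j)"
      using a j s r \<sigma>(2) by (auto simp: v2_def v1_def q)
  qed auto
  moreover have "mat r n (\<lambda>(i, j). w2 $$ (?i (i + 1) - 1, j)) =
      mat r n (\<lambda>(i, j). w $$ (i, j) + (if i = k then w $$ (l, j) * c j else 0))"
  proof (rule cong_mat)
    fix a j assume j: "j < n" and a: "a < r"
    then obtain s where s: "?i (Suc a) = Suc s" "s < r" using range[OF a] by (cases "?i (Suc a)") auto
    have "s = 0 \<longleftrightarrow> a = k" using i1(1)[of "Suc a"] s by auto
    moreover have "\<sigma> (Suc s) = Suc a" using i s by metis
    moreover have "\<sigma> (Suc (Suc 0)) = Suc l" using \<sigma>(3) by (simp add: numeral_2_eq_2)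
    ultimately show "(\<lambda>(i, j). w2 $$ (?i (i + 1) - 1, j)) (a, j) =
        (\<lambda>(i, j). w $$ (i, j) + (if i = k then w $$ (l, j) * c j else 0)) (a, j)"
      using a j s r by (auto simp: w2_def w1_def q)
  qed auto
  ultimately show ?thesis
    using reach_trans[OF reach_trans[OF r1 r2] reach_perm[OF m2 \<sigma>']] by (intro exI[of _ Y']) simp
qed

section \<open>Reduction to diagonal \<open>X\<close>\<close>

lemma jordan_matrix_dmat:
  assumes "\<forall>(k, a) \<in> set n_as. k = Suc 0"
  shows "jordan_matrix n_as = dmat (length n_as) (\<lambda>i. snd (n_as ! i))"
  using assms
proof (induction n_as)
  case (Cons ka n_as)
  obtain a where ka: "ka = (Suc 0, a)" using Cons.prems by (cases ka) auto
  have "sum_list (map fst n_as) = length n_as"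
    using Cons.prems by (induction n_as) auto
  then show ?case
    using Cons unfolding ka jordan_matrix_Cons
    by (intro eq_matI) (auto simp: jordan_block_def nth_Cons split: nat.splits)
qed (auto simp: jordan_matrix_def intro!: eq_matI)

text \<open>Counting: there are n eigenvalues, at most as many as Jordan blocks, and the sizes of
  the blocks add up to n. Hence all blocks have size 1 and their eigenvalues are distinct.\<close>

lemma diagonalize:
  assumes X: "X \<in> carrier_mat n n" and card: "card (spectrum X) = n"
  shows "\<exists>g h x. (g, h) \<in> GL_pairs n \<and> g * X * h = dmat n x \<and> inj_on x {..<n}"
proof -
  obtain as where "char_poly X = (\<Prod>a\<leftarrow>as. [:- a, 1:])"
    using char_poly_factorized[OF X] by blast
  then obtain n_as where jnf: "jordan_nf X n_as"
    using jordan_nf_exists[OF X] by blast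
  then obtain P Q where "similar_mat_wit X (jordan_matrix n_as) P Q"
    by (auto simp: jordan_nf_def similar_mat_def)
  note sim = similar_mat_witD2[OF X this]
  have sum: "sum_list (map fst n_as) = n"
    using sim(5) by (metis jordan_matrix_dim(1) carrier_matD(1))
  have spec: "spectrum X \<subseteq> snd ` set n_as"
  proof
    fix a assume "a \<in> spectrum X"
    then have "poly (char_poly X) a = 0" by (simp add: spectrum_root_char_poly[OF X])
    then have "poly (\<Prod>(k, b)\<leftarrow>n_as. [:- b, 1:] ^ k) a = 0"
      by (simp add: jordan_nf_char_poly[OF jnf])
    then show "a \<in> snd ` set n_as"
      by (induction n_as) (auto split: if_splits)
  qed
  then have "n \<le> card (snd ` set n_as)"
    using card_mono[OF _ spec] card by simp
  then have c: "n \<le> card (set (map snd n_as))" by simp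
  have pos: "\<forall>ka \<in> set n_as. Suc 0 \<le> fst ka" using jnf by (force simp: jordan_nf_def)
  have "length n_as \<le> sum_list (map fst n_as)" using pos by (induction n_as) auto
  with c sum have len: "length n_as = n" and dist: "distinct (map snd n_as)"
    using card_length[of "map snd n_as"] by (auto intro: card_distinct)
  have "\<forall>(k, a) \<in> set n_as. k = Suc 0"
  proof (rule ccontr)
    assume "\<not> ?thesis"
    then have "length n_as < sum_list (map fst n_as)"
      using pos
    proof (induction n_as)
      case (Cons ka n_as)
      have "length n_as \<le> sum_list (map fst n_as)" using Cons.prems(2) by (induction n_as) auto
      then show ?case using Cons by (cases "fst ka = Suc 0") auto
    qed simp
    then show False using sum len by simp
  qed
  then have J: "jordan_matrix n_as = dmat n (\<lambda>i. snd (n_as ! i))"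
    using jordan_matrix_dmat len by blast
  have "Q * X * P = dmat n (\<lambda>i. snd (n_as ! i))"
  proof -
    note c = sim(5-7)
    have "Q * X * P = Q * (P * (jordan_matrix n_as * Q)) * P"
      using sim(3) c by (simp add: assoc_mult_mat[of _ n n _ n _ n])
    also have "\<dots> = Q * P * (jordan_matrix n_as * Q) * P"
      using c by (subst assoc_mult_mat[of Q n n P n _ n]) auto
    also have "\<dots> = jordan_matrix n_as * Q * P" 
      unfolding sim(2) using c left_mult_one_mat[of "jordan_matrix n_as * Q" n n] by (simp del: assoc_mult_mat)
    also have "\<dots> = jordan_matrix n_as"
      using c sim(2) by (subst assoc_mult_mat[of _ n n _ n _ n]) auto
    finally show ?thesis by (simp add: J)
  qed
  moreover have "(Q, P) \<in> GL_pairs n" using sim by (auto simp: GL_pairs_def)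
  moreover have "inj_on (\<lambda>i. snd (n_as ! i)) {..<n}"
    using dist len by (auto simp: inj_on_def distinct_conv_nth)
  ultimately show ?thesis by blast
qed

section \<open>The moment fibre\<close>

lemma index_mult_mat_sum:
  assumes "A \<in> carrier_mat n m" "B \<in> carrier_mat m p" "i < n" "j < p"
  shows "(A * B) $$ (i, j) = (\<Sum>k<m. A $$ (i, k) * B $$ (k, j))"
  using assms by (auto simp: scalar_prod_def lessThan_atLeast0)

lemma moment_fibre_iff:
  "(X, Y, v, w) \<in> moment_fibre \<tau> n r \<longleftrightarrow>
     (X, Y, v, w) \<in> rep_space n r \<and>
     (\<forall>i<n. \<forall>j<n. (X * Y) $$ (i, j) - (Y * X) $$ (i, j) - (\<Sum>k<r. v $$ (i, k) * w $$ (k, j)) =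
       (if i = j then \<tau> else 0))"
proof (cases "(X, Y, v, w) \<in> rep_space n r")
  case True
  note c = rep_space_carriers[OF True]
  have "(X * Y - Y * X - v * w = \<tau> \<cdot>\<^sub>m 1\<^sub>m n) \<longleftrightarrow>
      (\<forall>i<n. \<forall>j<n. (X * Y - Y * X - v * w) $$ (i, j) = (\<tau> \<cdot>\<^sub>m 1\<^sub>m n) $$ (i, j))"
    using c by (auto simp del: index_mult_mat(1) index_minus_mat(1) index_smult_mat(1))
  also have "\<dots> \<longleftrightarrow> (\<forall>i<n. \<forall>j<n. (X * Y) $$ (i, j) - (Y * X) $$ (i, j) - (\<Sum>k<r. v $$ (i, k) * w $$ (k, j)) =
       (if i = j then \<tau> else 0))"
  proof -
    have "(v * w) $$ (i, j) = (\<Sum>k<r. v $$ (i, k) * w $$ (k, j))" if "i < n" "j < n" for i j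
      by (rule index_mult_mat_sum[OF c(3,4) that])
    then show ?thesis using c by (auto simp del: index_mult_mat(1))
  qed
  finally show ?thesis using True by (simp add: moment_fibre_def)
qed (simp add: moment_fibre_def)

lemma moment_conj_point:
  assumes m: "m \<in> moment_fibre \<tau> n r" and gh: "(g, h) \<in> GL_pairs n"
  shows "conj_point g h m \<in> moment_fibre \<tau> n r"
proof (cases m)
  case (fields X Y v w)
  have rep: "m \<in> rep_space n r" using m by (simp add: moment_fibre_def)
  note c = rep_space_carriers[OF rep[unfolded fields]]
  have g: "g \<in> carrier_mat n n" "h \<in> carrier_mat n n" and hg: "h * g = 1\<^sub>m n" "g * h = 1\<^sub>m n"
    using gh by (auto simp: GL_pairs_def)
  have mult: "(g * A * h) * (g * B * h) = g * (A * B) * h"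
    if "A \<in> carrier_mat n n" "B \<in> carrier_mat n n" for A B
  proof -
    have "h * (g * B * h) = h * (g * (B * h))"
      using g that by (simp add: assoc_mult_mat[of _ n n _ n _ n])
    also have "\<dots> = h * g * (B * h)"
      using g that by (intro assoc_mult_mat[of _ n n _ n _ n, symmetric]) auto
    finally have *: "h * (g * B * h) = B * h" using hg g that by simp
    have "(g * A * h) * (g * B * h) = g * A * (h * (g * B * h))"
      using g that by (intro assoc_mult_mat[of _ n n _ n _ n]) auto
    also have "\<dots> = g * A * B * h"
      unfolding * using g that by (intro assoc_mult_mat[of _ n n _ n _ n, symmetric]) auto
    also have "\<dots> = g * (A * B) * h"
      using g that by (simp add: assoc_mult_mat[of g n n A n B n])
    finally show ?thesis .
  qed
  have vw: "(g * v) * (w * h) = g * (v * w) * h"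
  proof -
    have "(g * v) * (w * h) = g * v * w * h"
      using g c by (intro assoc_mult_mat[of _ n r _ n _ n, symmetric]) auto
    also have "g * v * w = g * (v * w)"
      using g c by (intro assoc_mult_mat[of _ n n _ r _ n]) auto
    finally show ?thesis .
  qed
  have minus: "g * A * h - g * B * h = g * (A - B) * h"
    if "A \<in> carrier_mat n n" "B \<in> carrier_mat n n" for A B
    using g that by (simp add: mult_minus_distrib_mat[of _ n n _ n] minus_mult_distrib_mat[of _ n n _ _ n])
  have "moment (conj_point g h m) = g * moment m * h"
  proof -
    have XY: "X * Y \<in> carrier_mat n n" "Y * X \<in> carrier_mat n n" "v * w \<in> carrier_mat n n"
      using c by auto
    show ?thesis
      unfolding fields conj_point.simps moment.simps mult[OF c(1,2)] mult[OF c(2,1)] vw minus[OF XY(1,2)]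
      by (rule minus[OF minus_carrier_mat[OF XY(2)] XY(3)])
  qed
  also have "\<dots> = \<tau> \<cdot>\<^sub>m 1\<^sub>m n"
    using m g hg by (simp add: moment_fibre_def mult_smult_distrib[of _ n n _ n] mult_smult_assoc_mat[of _ n n _ n])
  finally show ?thesis
    using conj_point_in_rep_space[OF rep gh] by (simp add: moment_fibre_def)
qed

lemma GL_orbit_self: "m \<in> rep_space n r \<Longrightarrow> m \<in> GL_orbit n m"
  unfolding GL_orbit_eq by (rule image_eqI[of _ _ "(1\<^sub>m n, 1\<^sub>m n)"])
    (cases m; auto simp: rep_space_def GL_pairs_def)+

text \<open>\<open>reach\<close> only relates orbits, so m' is the image of some conjugate of m
  rather than of m itself; conjugation and symplectic automorphisms both preserve the fibre.\<close>

lemma reach_moment_fibre: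
  assumes r: "reach n r m m'" and m: "m \<in> moment_fibre \<tau> n r"
  shows "m' \<in> moment_fibre \<tau> n r"
proof -
  from r obtain \<psi> where m': "m' \<in> rep_space n r" and \<psi>: "\<psi> \<in> grp_calP r"
    and o: "orbit_act n r (GL_orbit n m) \<psi> = GL_orbit n m'" unfolding reach_def by blast
  have "m' \<in> orbit_act n r (GL_orbit n m) \<psi>" using GL_orbit_self[OF m'] o by simp
  then obtain g h where gh: "(g, h) \<in> GL_pairs n" "m' = act n r (conj_point g h m) \<psi>"
    unfolding orbit_act_def GL_orbit_eq by auto
  have "conj_point g h m \<in> moment_fibre \<tau> n r" by (rule moment_conj_point) fact+
  moreover have "\<psi> \<in> Aut_sympl r" using \<psi> grp_calP_subset by blast
  ultimately show ?thesis
    using act_in_rep_space[of n r] moment_act[of "conj_point g h m" n r \<psi>]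
    by (simp add: gh(2) moment_fibre_def)
qed

text \<open>On the diagonal the term with \<open>Y\<close> vanishes, which leaves a condition on
  \<open>v\<close> and \<open>w\<close> alone. Off the diagonal, for distinct x_i, the equation
  determines \<open>Y\<close> from \<open>v\<close> and \<open>w\<close>.\<close>

lemma moment_fibre_dmat:
  assumes "(dmat n x, Y, v, w) \<in> moment_fibre \<tau> n r" "i < n" "j < n"
  shows "(x i - x j) * Y $$ (i, j) - (\<Sum>k<r. v $$ (i, k) * w $$ (k, j)) = (if i = j then \<tau> else 0)"
proof -
  have "Y \<in> carrier_mat n n" using assms(1) by (auto simp: moment_fibre_def rep_space_def)
  then show ?thesis
    using assms by (auto simp: moment_fibre_iff algebra_simps simp del: index_mult_mat(1))
qed

section \<open>Concentrating \<open>v\<close> and \<open>w\<close> in one pair of arrows\<close>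

definition rank_one :: "nat \<Rightarrow> nat \<Rightarrow> complex mat \<Rightarrow> complex mat \<Rightarrow> bool" where
  "rank_one n r v w \<longleftrightarrow> (\<forall>i<n. \<forall>k<r. k \<noteq> 0 \<longrightarrow> v $$ (i, k) = 0 \<and> w $$ (k, i) = 0)"

text \<open>Gaussian elimination at all eigenvalues at once, in three rounds: make column 0 of
  \<open>v\<close> free of zeros, use it to clear the other columns, then clear the rows of
  \<open>w\<close>. Each operation changes both matrices, and in the last round the change to
  \<open>v\<close> is invisible because the column that is added is already 0.\<close>

lemma reach_rank_one:
  assumes m: "(dmat n x, Y, v, w) \<in> moment_fibre \<tau> n r" and x: "inj_on x {..<n}"
    and \<tau>: "\<tau> \<noteq> 0" and r: "r \<ge> 1"
  shows "\<exists>Y' v' w'. reach n r (dmat n x, Y, v, w) (dmat n x, Y', v', w') \<and> rank_one n r v' w'"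
proof -
  let ?m = "(dmat n x, Y, v, w)"
  have m0: "?m \<in> rep_space n r" using m by (simp add: moment_fibre_def)
  have step: "\<exists>Y''. reach n r ?m (dmat n x, Y'',
      mat n r (\<lambda>(i, j). v' $$ (i, j) - (if j = l then c i * v' $$ (i, k) else 0)),
      mat r n (\<lambda>(i, j). w' $$ (i, j) + (if i = k then w' $$ (l, j) * c j else 0)))"
    if "reach n r ?m (dmat n x, Y', v', w')" "k < r" "l < r" "k \<noteq> l" for Y' v' w' k l c
  proof -
    have "(dmat n x, Y', v', w') \<in> rep_space n r" using that(1) by (simp add: reach_def)
    from reach_elementary[OF this x that(2-4), of c] show ?thesis
      by (elim exE) (rule exI, rule reach_trans[OF that(1)])
  qed
  \<comment> \<open>If row i of \<open>v\<close> were 0, the diagonal moment equation would read 0 =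
    tau.\<close>
  have diag: "\<exists>k<r. v' $$ (i, k) \<noteq> 0" if "reach n r ?m (dmat n x, Y', v', w')" "i < n" for Y' v' w' i
  proof (rule ccontr)
    assume "\<not> ?thesis"
    then show False
      using moment_fibre_dmat[OF reach_moment_fibre[OF that(1) m] that(2,2)] \<tau> by simp
  qed
  have 1: "\<exists>Y' v' w'. reach n r ?m (dmat n x, Y', v', w') \<and>
      (\<forall>i<n. (\<exists>k<L. v' $$ (i, k) \<noteq> 0) \<longrightarrow> v' $$ (i, 0) \<noteq> 0)" if "L \<le> r" for L
    using that
  proof (induction L)
    case 0
    then show ?case using reach_refl[OF m0] by blast
  next
    case (Suc L)
    obtain Y' v' w' where IH: "reach n r ?m (dmat n x, Y', v', w')"
      "\<forall>i<n. (\<exists>k<L. v' $$ (i, k) \<noteq> 0) \<longrightarrow> v' $$ (i, 0) \<noteq> 0" using Suc.IH[OF Suc_leD[OF Suc.prems]] by blast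
    show ?case
    proof (cases "L = 0")
      case True
      then show ?thesis using IH by auto
    next
      case False
      \<comment> \<open>Column L is added to column 0 only in the rows where the pivot is still 0,
        so no existing pivot can be cancelled.\<close>
      define c where "c i = (if v' $$ (i, 0) = 0 then - 1 else 0 :: complex)" for i
      define v'' where "v'' = mat n r (\<lambda>(i, j). v' $$ (i, j) - (if j = 0 then c i * v' $$ (i, L) else 0))"
      have "v'' $$ (i, 0) \<noteq> 0" if "i < n" "k < Suc L" "v'' $$ (i, k) \<noteq> 0" for i k
        using that False Suc.prems IH(2) by (cases "k = L"; cases "k = 0") (auto simp: v''_def c_def)
      moreover obtain Y'' w'' where "reach n r ?m (dmat n x, Y'', v'', w'')"
        using step[OF IH(1), of L 0 c] False Suc.prems unfolding v''_def by auto
      ultimately show ?thesis by blast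
    qed
  qed
  have 2: "\<exists>Y' v' w'. reach n r ?m (dmat n x, Y', v', w') \<and>
      (\<forall>i<n. v' $$ (i, 0) \<noteq> 0) \<and> (\<forall>i<n. \<forall>k<L. k \<noteq> 0 \<longrightarrow> v' $$ (i, k) = 0)" if "L \<le> r" for L
    using that
  proof (induction L)
    case 0
    obtain Y' v' w' where v': "reach n r ?m (dmat n x, Y', v', w')"
      "\<forall>i<n. (\<exists>k<r. v' $$ (i, k) \<noteq> 0) \<longrightarrow> v' $$ (i, 0) \<noteq> 0" using 1[OF order_refl] by blast
    have "v' $$ (i, 0) \<noteq> 0" if "i < n" for i
      using diag[OF v'(1) that] v'(2) that by blast
    with v'(1) show ?case by (intro exI[of _ Y'] exI[of _ v'] exI[of _ w']) simp
  next
    case (Suc L)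
    obtain Y' v' w' where IH: "reach n r ?m (dmat n x, Y', v', w')"
      "\<forall>i<n. v' $$ (i, 0) \<noteq> 0" "\<forall>i<n. \<forall>k<L. k \<noteq> 0 \<longrightarrow> v' $$ (i, k) = 0" using Suc.IH[OF Suc_leD[OF Suc.prems]] by blast
    show ?case
    proof (cases "L = 0")
      case True
      then show ?thesis using IH by auto
    next
      case False
      define c where "c i = v' $$ (i, L) / v' $$ (i, 0)" for i
      define v'' where "v'' = mat n r (\<lambda>(i, j). v' $$ (i, j) - (if j = L then c i * v' $$ (i, 0) else 0))"
      have "v'' $$ (i, 0) \<noteq> 0" "k < Suc L \<Longrightarrow> k \<noteq> 0 \<Longrightarrow> v'' $$ (i, k) = 0" if "i < n" for i k
        using that False Suc.prems IH(2,3) by (auto simp: v''_def c_def less_Suc_eq)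
      moreover obtain Y'' w'' where "reach n r ?m (dmat n x, Y'', v'', w'')"
        using step[OF IH(1), of 0 L c] False Suc.prems unfolding v''_def by auto
      ultimately show ?thesis by blast
    qed
  qed
  have 3: "\<exists>Y' v' w'. reach n r ?m (dmat n x, Y', v', w') \<and>
      (\<forall>i<n. \<forall>k<r. k \<noteq> 0 \<longrightarrow> v' $$ (i, k) = 0) \<and>
      (\<forall>i<n. \<forall>k<L. k \<noteq> 0 \<longrightarrow> w' $$ (k, i) = 0)" if "L \<le> r" for L
    using that
  proof (induction L)
    case 0
    then show ?case using 2[OF order_refl] by blast
  next
    case (Suc L)
    obtain Y' v' w' where IH: "reach n r ?m (dmat n x, Y', v', w')"
      "\<forall>i<n. \<forall>k<r. k \<noteq> 0 \<longrightarrow> v' $$ (i, k) = 0" "\<forall>i<n. \<forall>k<L. k \<noteq> 0 \<longrightarrow> w' $$ (k, i) = 0" using Suc.IH[OF Suc_leD[OF Suc.prems]] by blast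
    show ?case
    proof (cases "L = 0")
      case True
      then show ?thesis using IH by auto
    next
      case False
      \<comment> \<open>With \<open>v\<close> concentrated in column 0, the diagonal moment equation
        has the single product \<open>v' $$ (i, 0) * w' $$ (0, i)\<close>, which equals
        -tau.\<close>
      have w0: "w' $$ (0, i) \<noteq> 0" if "i < n" for i
      proof
        assume "w' $$ (0, i) = 0"
        then have "v' $$ (i, k) * w' $$ (k, i) = 0" if "k < r" for k
          using IH(2) \<open>i < n\<close> that by (cases "k = 0") auto
        then have "(\<Sum>k<r. v' $$ (i, k) * w' $$ (k, i)) = 0" by (intro sum.neutral) auto
        then show False
          using moment_fibre_dmat[OF reach_moment_fibre[OF IH(1) m] that that] \<tau> by simp
      qed
      define c where "c i = - w' $$ (L, i) / w' $$ (0, i)" for i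
      define v'' where "v'' = mat n r (\<lambda>(i, j). v' $$ (i, j) - (if j = 0 then c i * v' $$ (i, L) else 0))"
      define w'' where "w'' = mat r n (\<lambda>(i, j). w' $$ (i, j) + (if i = L then w' $$ (0, j) * c j else 0))"
      have "k < r \<Longrightarrow> k \<noteq> 0 \<Longrightarrow> v'' $$ (i, k) = 0" "k < Suc L \<Longrightarrow> k \<noteq> 0 \<Longrightarrow> w'' $$ (k, i) = 0"
        if "i < n" for i k
        using that False Suc.prems IH(2,3) w0 by (auto simp: v''_def w''_def c_def less_Suc_eq)
      moreover obtain Y'' where "reach n r ?m (dmat n x, Y'', v'', w'')"
        using step[OF IH(1), of L 0 c] False Suc.prems unfolding v''_def w''_def by auto
      ultimately show ?thesis by blast
    qed
  qed
  show ?thesis using 3[OF order_refl] unfolding rank_one_def by blast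
qed

text \<open>The moment equation determines the entries of \<open>Y\<close> off the diagonal, and the automorphisms
  \<open>a\<^sup>* \<mapsto> a\<^sup>* + q(a)\<close> change its diagonal arbitrarily.\<close>

lemma reach_same_dmat:
  assumes m: "(dmat n x, Y, v, w) \<in> moment_fibre \<tau> n r" "rank_one n r v w"
    and m': "(dmat n x, Y', v', w') \<in> moment_fibre \<tau> n r" "rank_one n r v' w'"
    and x: "inj_on x {..<n}" and \<tau>: "\<tau> \<noteq> 0" and r: "r \<ge> 1"
  shows "reach n r (dmat n x, Y, v, w) (dmat n x, Y', v', w')"
proof -
  have entry: "(x i - x j) * Y $$ (i, j) - v $$ (i, 0) * w $$ (0, j) = (if i = j then \<tau> else 0)"
    if "(dmat n x, Y, v, w) \<in> moment_fibre \<tau> n r" "rank_one n r v w" "i < n" "j < n" for Y v w i j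
  proof -
    have "(\<Sum>k<r. v $$ (i, k) * w $$ (k, j)) = (\<Sum>k\<in>{0}. v $$ (i, k) * w $$ (k, j))"
      by (rule sum.mono_neutral_right) (use that(2-4) r in \<open>auto simp: rank_one_def\<close>)
    then show ?thesis using moment_fibre_dmat[OF that(1,3,4)] by simp
  qed
  have rep: "(dmat n x, Y, v, w) \<in> rep_space n r" "(dmat n x, Y', v', w') \<in> rep_space n r"
    using m m' by (auto simp: moment_fibre_def)
  note c = rep_space_carriers[OF rep(1)] rep_space_carriers[OF rep(2)]
  have vw: "v $$ (i, 0) * w $$ (0, i) = - \<tau>" "v' $$ (i, 0) * w' $$ (0, i) = - \<tau>" if "i < n" for i
    using entry[OF m that that] entry[OF m' that that] by (auto simp: minus_equation_iff)
  have v0: "v $$ (i, 0) \<noteq> 0" "v' $$ (i, 0) \<noteq> 0" if "i < n" for i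
    using vw[OF that] \<tau> by auto
  \<comment> \<open>The diagonal matrices commute with \<open>X\<close>, and one of them carries
    column 0 of \<open>v\<close> to that of \<open>v'\<close>. Row 0 of \<open>w\<close> then
    follows by itself, as both products on the diagonal equal -tau.\<close>
  define t where "t i = v' $$ (i, 0) / v $$ (i, 0)" for i
  define g where "g = dmat n t"
  define h where "h = dmat n (\<lambda>i. inverse (t i))"
  have t0: "t i \<noteq> 0" if "i < n" for i using v0[OF that] by (simp add: t_def)
  have gh: "(g, h) \<in> GL_pairs n"
    using t0 by (auto simp: GL_pairs_def g_def h_def simp del: index_mult_mat(1) intro!: eq_matI)
  have D: "g * dmat n x * h = dmat n x"
    using t0 by (auto simp: g_def h_def simp del: index_mult_mat(1) intro!: eq_matI)
  have tv: "t i * v $$ (i, 0) = v' $$ (i, 0)" if "i < n" for i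
    using v0[OF that] by (simp add: t_def)
  have v: "g * v = v'"
  proof (rule eq_matI)
    fix i j assume "i < dim_row v'" "j < dim_col v'"
    then show "(g * v) $$ (i, j) = v' $$ (i, j)"
      using c m(2) m'(2) tv by (cases "j = 0") (auto simp: g_def rank_one_def simp del: index_mult_mat(1))
  qed (use c in \<open>auto simp: g_def\<close>)
  have w0: "w $$ (0, j) * inverse (t j) = w' $$ (0, j)" if "j < n" for j
  proof -
    have "w $$ (0, j) * inverse (t j) = v $$ (j, 0) * w $$ (0, j) / v' $$ (j, 0)"
      by (simp add: t_def)
    also have "\<dots> = v' $$ (j, 0) * w' $$ (0, j) / v' $$ (j, 0)"
      by (simp only: vw[OF that])
    finally show ?thesis using v0[OF that] by simp
  qed
  have w: "w * h = w'"
  proof (rule eq_matI)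
    fix i j assume "i < dim_row w'" "j < dim_col w'"
    then show "(w * h) $$ (i, j) = w' $$ (i, j)"
      using c m(2) m'(2) w0 by (cases "i = 0") (auto simp: h_def rank_one_def simp del: index_mult_mat(1))
  qed (use c in \<open>auto simp: h_def\<close>)
  define Y1 where "Y1 = g * Y * h"
  have conj: "conj_point g h (dmat n x, Y, v, w) = (dmat n x, Y1, v', w')"
    by (simp add: D v w Y1_def)
  have Y1: "(dmat n x, Y1, v', w') \<in> moment_fibre \<tau> n r"
    using moment_conj_point[OF m(1) gh] unfolding conj .
  then have rep1: "(dmat n x, Y1, v', w') \<in> rep_space n r" by (simp add: moment_fibre_def)
  have off: "Y1 $$ (i, j) = Y' $$ (i, j)" if "i < n" "j < n" "i \<noteq> j" for i j
  proof -
    have "x i - x j \<noteq> 0" using inj_onD[OF x, of i j] that by auto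
    moreover have "(x i - x j) * Y1 $$ (i, j) = (x i - x j) * Y' $$ (i, j)"
      using entry[OF Y1 m'(2) that(1,2)] entry[OF m' that(1,2)] by (simp add: algebra_simps)
    ultimately show ?thesis by simp
  qed
  obtain q where q: "\<And>i. i < n \<Longrightarrow> poly q (x i) = Y' $$ (i, i) - Y1 $$ (i, i)"
    using interpolate[OF x, of "\<lambda>i. Y' $$ (i, i) - Y1 $$ (i, i)"] by blast
  have "Y1 + dmat n (\<lambda>i. poly q (x i)) = Y'"
    using c off q rep_space_carriers[OF rep1] by (intro eq_matI) auto
  then have "reach n r (dmat n x, Y1, v', w') (dmat n x, Y', v', w')"
    using reach_shift_dmat[OF rep1, of q] by simp
  then show ?thesis
    using reach_GL[OF rep(1) gh] reach_trans unfolding conj by blast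
qed

section \<open>A base point\<close>

definition sub_mat :: "complex \<Rightarrow> nat \<Rightarrow> complex mat" where
  "sub_mat \<tau> n = mat n n (\<lambda>(i, j). if i = Suc j then - \<tau> * of_nat i else 0)"

definition last_col :: "nat \<Rightarrow> (nat \<Rightarrow> complex) \<Rightarrow> complex mat" where
  "last_col n u = mat n n (\<lambda>(i, j). if Suc j = n then u i else 0)"

definition base_v :: "nat \<Rightarrow> nat \<Rightarrow> (nat \<Rightarrow> complex) \<Rightarrow> complex mat" where
  "base_v n r c = mat n r (\<lambda>(i, k). if k = 0 then c i else 0)"

definition base_w :: "nat \<Rightarrow> nat \<Rightarrow> complex mat" where
  "base_w n r = mat r n (\<lambda>(k, j). if k = 0 \<and> Suc j = n then 1 else 0)"

text \<open>The last column of [X, N] - tau I for X = \<open>sub_mat \<tau> n + last_col n u\<close>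
  and N = \<open>shift_mat n\<close>; the other columns are 0. The commutator has trace 0, which
  accounts for the bottom entry -n tau, the same for every u.\<close>

definition nil_v :: "complex \<Rightarrow> nat \<Rightarrow> (nat \<Rightarrow> complex) \<Rightarrow> nat \<Rightarrow> complex" where
  "nil_v \<tau> n u i = (if Suc i = n then - of_nat n * \<tau> else - u (Suc i))"

text \<open>With respect to the basis \<open>z\<^sup>j / (j! (-\<tau>)\<^sup>j)\<close> of \<open>\<complex>[z] / (\<chi>)\<close>, where \<open>\<chi>\<close> is monic of degree \<open>n\<close>,
  the matrix \<open>shift_mat n\<close> is \<open>-\<tau> d/dz\<close>, and multiplication by \<open>z\<close> is \<open>sub_mat \<tau> n + last_col n u\<close>
  for some \<open>u\<close> that depends on \<open>\<chi>\<close>.\<close>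

definition nil_point :: "complex \<Rightarrow> nat \<Rightarrow> nat \<Rightarrow> (nat \<Rightarrow> complex) \<Rightarrow> point" where
  "nil_point \<tau> n r u = (sub_mat \<tau> n + last_col n u, shift_mat n, base_v n r (nil_v \<tau> n u), base_w n r)"

lemma sum_base_vw:
  assumes "r \<ge> 1" "i < n" "j < n"
  shows "(\<Sum>k<r. base_v n r c $$ (i, k) * base_w n r $$ (k, j)) = (if Suc j = n then c i else 0)"
proof -
  have "(\<Sum>k<r. base_v n r c $$ (i, k) * base_w n r $$ (k, j)) =
      (\<Sum>k<r. if k = 0 then (if Suc j = n then c i else 0) else 0)"
    using assms by (intro sum.cong) (auto simp: base_v_def base_w_def)
  then show ?thesis using assms by simp
qed

lemma nil_point_in_fibre:
  assumes r: "r \<ge> 1"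
  shows "nil_point \<tau> n r u \<in> moment_fibre \<tau> n r"
proof -
  have c: "sub_mat \<tau> n \<in> carrier_mat n n" "last_col n u \<in> carrier_mat n n"
    by (simp_all add: sub_mat_def last_col_def)
  have "(sub_mat \<tau> n + last_col n u) $$ (i, j) =
      (if i = Suc j then - \<tau> * of_nat i else 0) + (if Suc j = n then u i else 0)"
    if "i < n" "j < n" for i j
    using that by (simp add: sub_mat_def last_col_def)
  then have "((sub_mat \<tau> n + last_col n u) * shift_mat n) $$ (i, j) -
      (shift_mat n * (sub_mat \<tau> n + last_col n u)) $$ (i, j) -
      (if Suc j = n then nil_v \<tau> n u i else 0) = (if i = j then \<tau> else 0)"
    if "i < n" "j < n" for i j
    using that c by (cases j) (auto simp: nil_v_def algebra_simps simp del: index_mult_mat(1) index_add_mat(1))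
  moreover have "nil_point \<tau> n r u \<in> rep_space n r"
    using c by (simp add: nil_point_def rep_space_def base_v_def base_w_def)
  ultimately show ?thesis
    using r unfolding nil_point_def moment_fibre_iff by (simp add: sum_base_vw)
qed

lemma invertible_upper_triangular:
  assumes G: "(G :: complex mat) \<in> carrier_mat n n" and "upper_triangular G" "\<And>i. i < n \<Longrightarrow> G $$ (i, i) = 1"
  shows "\<exists>H. (G, H) \<in> GL_pairs n"
proof -
  have "diag_mat G = map (\<lambda>_. 1) [0..<n]" using assms by (auto simp: diag_mat_def)
  then have "prod_list (diag_mat G) = 1" by (simp add: prod_list_replicate map_replicate_const)
  then have "det G \<noteq> 0" using det_upper_triangular[OF assms(2) G] by simp
  from det_non_zero_imp_unit[OF G this, of "()"] show ?thesis
    using G unfolding Units_def ring_mat_def GL_pairs_def by auto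
qed

lemma reach_nil_point:
  assumes \<tau>: "\<tau> \<noteq> 0" and n: "n \<ge> 1" and r: "r \<ge> 1"
  shows "reach n r (nil_point \<tau> n r u) (nil_point \<tau> n r (\<lambda>_. 0))"
proof -
  let ?N = "shift_mat n" and ?S = "sub_mat \<tau> n" and ?w = "base_w n r"
  define v0 where "v0 = base_v n r (nil_v \<tau> n (\<lambda>_. 0))"
  define V where "V = base_v n r (nil_v \<tau> n u)"
  define X where "X = ?S + last_col n u"
  have X: "X \<in> carrier_mat n n" and S: "?S \<in> carrier_mat n n" and vc: "v0 \<in> carrier_mat n r" "V \<in> carrier_mat n r"
    and wc: "?w \<in> carrier_mat r n"
    by (simp_all add: X_def sub_mat_def last_col_def v0_def V_def base_v_def base_w_def)
  \<comment> \<open>For u = 0 only the bottom entry -n tau of the vector is nonzero, so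
    \<open>G * v0\<close> is a multiple of the last column of G; c is read off from
    \<open>G * v0 = V\<close>. The bottom entry of \<open>nil_v\<close> does not depend on u, hence
    \<open>c 0 = 1\<close> and G is unitriangular.\<close>
  define c where "c k = nil_v \<tau> n u (n - Suc k) / (- of_nat n * \<tau>)" for k
  define G where "G = toep n c"
  have c0: "c 0 = 1" using \<tau> n by (simp add: c_def nil_v_def)
  have Gc: "G \<in> carrier_mat n n" by (simp add: G_def)
  obtain H where "(G, H) \<in> GL_pairs n"
    using invertible_upper_triangular[OF Gc] by (auto simp: G_def c0 upper_triangular_def)
  then have HG: "(H, G) \<in> GL_pairs n" and Hc: "H \<in> carrier_mat n n" and 1: "H * G = 1\<^sub>m n"
    by (auto simp: GL_pairs_def)
  have "G * v0 = V"
  proof (rule eq_matI)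
    fix i k assume "i < dim_row V" "k < dim_col V"
    then have ik: "i < n" "k < r" using vc by auto
    have "(G * v0) $$ (i, k) = (\<Sum>j<n. G $$ (i, j) * v0 $$ (j, k))"
      by (rule index_mult_mat_sum[OF Gc vc(1) ik])
    also have "\<dots> = (\<Sum>j<n. if j = n - 1 then (if k = 0 then c (n - 1 - i) * (- of_nat n * \<tau>) else 0) else 0)"
      using ik n by (intro sum.cong) (auto simp: v0_def base_v_def nil_v_def G_def)
    also have "\<dots> = V $$ (i, k)"
      using ik n \<tau> by (auto simp: V_def base_v_def c_def)
    finally show "(G * v0) $$ (i, k) = V $$ (i, k)" .
  qed (use vc Gc in auto)
  then have Hv: "H * V = v0"
    using assoc_mult_mat[OF Hc Gc vc(1)] 1 vc by simp
  \<comment> \<open>The nonzero row of \<open>?w\<close> picks out the last row of G, which is a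
    unit vector because G is unitriangular.\<close>
  have wG: "?w * G = ?w"
  proof (rule eq_matI)
    fix k j assume "k < dim_row ?w" "j < dim_col ?w"
    then have ik: "k < r" "j < n" using wc by auto
    have "(?w * G) $$ (k, j) = (\<Sum>i<n. ?w $$ (k, i) * G $$ (i, j))"
      by (rule index_mult_mat_sum[OF wc Gc ik])
    also have "\<dots> = (\<Sum>i<n. if i = n - 1 then (if k = 0 \<and> j = n - 1 then 1 else 0) else 0)"
      using ik n by (intro sum.cong) (auto simp: base_w_def G_def c0)
    also have "\<dots> = ?w $$ (k, j)"
      using ik n by (auto simp: base_w_def)
    finally show "(?w * G) $$ (k, j) = ?w $$ (k, j)" .
  qed (use wc Gc in auto)
  have HNG: "H * ?N * G = ?N"
  proof -
    have "H * ?N * G = H * (?N * G)" using Hc Gc by (intro assoc_mult_mat[of _ n n _ n _ n]) auto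
    also have "\<dots> = H * (G * ?N)" by (simp add: G_def toep_commute)
    also have "\<dots> = H * G * ?N" using Hc Gc by (intro assoc_mult_mat[of _ n n _ n _ n, symmetric]) auto
    finally show ?thesis using 1 by simp
  qed
  define X1 where "X1 = H * X * G"
  have conj: "conj_point H G (nil_point \<tau> n r u) = (X1, ?N, v0, ?w)"
    by (simp add: nil_point_def X1_def HNG Hv wG flip: X_def V_def)
  have fib0: "nil_point \<tau> n r u \<in> moment_fibre \<tau> n r" by (rule nil_point_in_fibre) fact
  have fib1: "(X1, ?N, v0, ?w) \<in> moment_fibre \<tau> n r"
    using moment_conj_point[OF fib0 HG] unfolding conj .
  have zero: "?S + last_col n (\<lambda>_. 0) = ?S"
    by (rule eq_matI) (auto simp: sub_mat_def last_col_def)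
  have fib2: "(?S, ?N, v0, ?w) \<in> moment_fibre \<tau> n r"
    using nil_point_in_fibre[OF r, of \<tau> n "\<lambda>_. 0"] by (simp add: nil_point_def zero v0_def)
  have X1: "X1 \<in> carrier_mat n n" using Hc Gc X by (simp add: X1_def)
  \<comment> \<open>Both points satisfy the moment equation with the same \<open>Y\<close>,
    \<open>v\<close> and \<open>w\<close>, so \<open>?S\<close> and \<open>X1\<close> have the same
    commutator with the block and their difference commutes with it.\<close>
  define Z where "Z = ?S - X1"
  have Z: "Z \<in> carrier_mat n n" unfolding Z_def by (rule minus_carrier_mat[OF X1])
  have comm: "Z * ?N = ?N * Z"
  proof (rule eq_matI)
    fix i j assume "i < dim_row (?N * Z)" "j < dim_col (?N * Z)"
    then have ij: "i < n" "j < n" using Z by auto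
    have "(?S * ?N) $$ (i, j) - (?N * ?S) $$ (i, j) = (X1 * ?N) $$ (i, j) - (?N * X1) $$ (i, j)"
    proof -
      let ?s = "\<Sum>k<r. v0 $$ (i, k) * ?w $$ (k, j)" and ?t = "if i = j then \<tau> else 0"
      have "(X1 * ?N) $$ (i, j) - (?N * X1) $$ (i, j) - ?s = ?t"
        using fib1 ij unfolding moment_fibre_iff by blast
      moreover have "(?S * ?N) $$ (i, j) - (?N * ?S) $$ (i, j) - ?s = ?t"
        using fib2 ij unfolding moment_fibre_iff by blast
      ultimately show ?thesis by (metis diff_add_cancel)
    qed
    then have "(?S * ?N) $$ (i, j) - (X1 * ?N) $$ (i, j) = (?N * ?S) $$ (i, j) - (?N * X1) $$ (i, j)"
      by (simp add: algebra_simps)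
    then show "(Z * ?N) $$ (i, j) = (?N * Z) $$ (i, j)"
      using ij S X1 Z by (auto simp: Z_def simp del: index_mult_mat(1) split: if_splits)
  qed (use Z in auto)
  have "X1 + toep n (\<lambda>k. Z $$ (0, k)) = ?S"
    using commute_shift_mat_imp_toep[OF Z comm] X1 S
    by (intro eq_matI) (auto simp: Z_def)
  then have "reach n r (X1, ?N, v0, ?w) (?S, ?N, v0, ?w)"
    using reach_shift_toep[of X1 n v0 ?w r "\<lambda>k. Z $$ (0, k)"] fib1 by (simp add: moment_fibre_def)
  moreover have "reach n r (nil_point \<tau> n r u) (X1, ?N, v0, ?w)"
    using reach_GL[OF _ HG, of "nil_point \<tau> n r u" r] fib0 unfolding conj by (simp add: moment_fibre_def)
  ultimately show ?thesis
    unfolding nil_point_def[of \<tau> n r "\<lambda>_. 0"] zero v0_def[symmetric] by (rule reach_trans[rotated])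
qed

text \<open>Let chi be the monic polynomial with roots x_i. Passing from coefficients to values at
  the roots turns multiplication by z modulo chi into the diagonal matrix of the x_i. The change of
  basis is a Vandermonde matrix with rescaled columns.\<close>

lemma nil_point_diagonalizable:
  assumes \<tau>: "\<tau> \<noteq> 0" and n: "n \<ge> 1" and x: "inj_on x {..<n}"
  shows "\<exists>u g h Y v w. (g, h) \<in> GL_pairs n \<and> conj_point g h (nil_point \<tau> n r u) = (dmat n x, Y, v, w) \<and>
    rank_one n r v w"
proof -
  \<comment> \<open>The normalisation of z^j for which -tau d/dz lowers the basis index with
    coefficient 1; multiplication by z then has the entries -tau (j + 1) of
    \<open>sub_mat\<close>.\<close>
  define \<kappa> :: "nat \<Rightarrow> complex" where "\<kappa> j = inverse (fact j * (- \<tau>) ^ j)" for j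
  have \<kappa>0: "\<kappa> j \<noteq> 0" for j using \<tau> by (simp add: \<kappa>_def)
  have \<kappa>: "\<kappa> (Suc j) * (- \<tau> * of_nat (Suc j)) = \<kappa> j" for j
    using \<tau> by (simp add: \<kappa>_def field_simps del: of_nat_Suc)
  define P where "P = mat n n (\<lambda>(i, j). x i ^ j * \<kappa> j)"
  have P: "P \<in> carrier_mat n n" by (simp add: P_def)
  have poly_sum: "(\<Sum>k<n. x i ^ k * \<kappa> k * (Polynomial.coeff q k / \<kappa> k)) = poly q (x i)"
    if "\<forall>k\<ge>n. Polynomial.coeff q k = 0" for q i
  proof -
    have "poly q (x i) = (\<Sum>k<n. Polynomial.coeff q k * x i ^ k)"
      unfolding poly_altdef
      by (rule sum.mono_neutral_cong) (use that in \<open>auto simp: coeff_eq_0 not_less\<close>)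
    then show ?thesis using \<kappa>0 by (simp add: mult.commute)
  qed
  have "\<exists>q. (\<forall>i<n. poly q (x i) = (if i = j then 1 else 0)) \<and> (\<forall>k\<ge>n. Polynomial.coeff q k = 0)" for j
    by (rule interpolate[OF x])
  then obtain L where L: "\<And>j i. i < n \<Longrightarrow> poly (L j) (x i) = (if i = j then 1 else 0)"
    "\<And>j. \<forall>k\<ge>n. Polynomial.coeff (L j) k = 0" by metis
  \<comment> \<open>The columns are the coordinates of the Lagrange polynomials, so Q turns values
    back into coefficients.\<close>
  define Q where "Q = mat n n (\<lambda>(k, j). Polynomial.coeff (L j) k / \<kappa> k)"
  have Q: "Q \<in> carrier_mat n n" by (simp add: Q_def)
  have PQ: "P * Q = 1\<^sub>m n"
  proof (rule eq_matI)
    fix i j assume "i < dim_row (1\<^sub>m n :: complex mat)" "j < dim_col (1\<^sub>m n :: complex mat)"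
    then have ij: "i < n" "j < n" by auto
    then have "(P * Q) $$ (i, j) = (\<Sum>k<n. x i ^ k * \<kappa> k * (Polynomial.coeff (L j) k / \<kappa> k))"
      by (simp add: P_def Q_def scalar_prod_def lessThan_atLeast0)
    also have "\<dots> = poly (L j) (x i)" by (rule poly_sum) (rule L(2))
    finally show "(P * Q) $$ (i, j) = 1\<^sub>m n $$ (i, j)"
      using ij by (simp add: L(1))
  qed (simp_all add: P_def Q_def)
  have gl: "(P, Q) \<in> GL_pairs n"
    using P Q PQ mat_mult_left_right_inverse[OF P Q PQ] by (simp add: GL_pairs_def)
  \<comment> \<open>s is the remainder modulo chi of z times the top basis vector, given by its
    values at the roots; its coordinates form the last column of multiplication by z.\<close>
  obtain s where s: "\<And>i. i < n \<Longrightarrow> poly s (x i) = x i ^ n * \<kappa> (n - 1)" "\<forall>k\<ge>n. Polynomial.coeff s k = 0"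
    using interpolate[OF x, of "\<lambda>i. x i ^ n * \<kappa> (n - 1)"] by blast
  define u where "u k = Polynomial.coeff s k / \<kappa> k" for k
  let ?X = "sub_mat \<tau> n + last_col n u"
  have X: "?X \<in> carrier_mat n n" by (simp add: sub_mat_def last_col_def)
  have "P * ?X = dmat n x * P"
  proof (rule eq_matI)
    fix i j assume "i < dim_row (dmat n x * P)" "j < dim_col (dmat n x * P)"
    then have ij: "i < n" "j < n" using P by auto
    have "(P * ?X) $$ (i, j) = (\<Sum>k<n. P $$ (i, k) * ?X $$ (k, j))"
      by (rule index_mult_mat_sum[OF P X ij])
    also have "\<dots> = x i * P $$ (i, j)"
    \<comment> \<open>Only the top basis vector meets the reduction modulo chi; on the others
      multiplication by z just raises the degree.\<close>
    proof (cases "Suc j = n")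
      case True
      then have "(\<Sum>k<n. P $$ (i, k) * ?X $$ (k, j)) = (\<Sum>k<n. x i ^ k * \<kappa> k * (Polynomial.coeff s k / \<kappa> k))"
        using ij by (intro sum.cong) (auto simp: P_def sub_mat_def last_col_def u_def)
      also have "\<dots> = x i ^ Suc j * \<kappa> j"
        unfolding poly_sum[OF s(2)] s(1)[OF ij(1)] using True by auto
      finally show ?thesis using ij by (simp add: P_def)
    next
      case False
      then have "(\<Sum>k<n. P $$ (i, k) * ?X $$ (k, j)) =
          (\<Sum>k<n. if k = Suc j then x i ^ Suc j * (\<kappa> (Suc j) * (- \<tau> * of_nat (Suc j))) else 0)"
        using ij by (intro sum.cong) (auto simp: P_def sub_mat_def last_col_def)
      also have "\<dots> = x i ^ Suc j * \<kappa> j"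
        unfolding \<kappa> using ij False by simp
      finally show ?thesis using ij by (simp add: P_def)
    qed
    finally show "(P * ?X) $$ (i, j) = (dmat n x * P) $$ (i, j)"
      using ij P by (simp del: index_mult_mat(1))
  qed (use P X in auto)
  then have D: "P * ?X * Q = dmat n x"
    using assoc_mult_mat[OF dmat_carrier P Q, of x] PQ by simp
  have "rank_one n r (P * base_v n r c) (base_w n r * Q)" for c
    using P Q by (auto simp: rank_one_def base_v_def base_w_def scalar_prod_def)
  then show ?thesis
    using gl D unfolding nil_point_def conj_point.simps by blast
qed

section \<open>Joining every point to the base point\<close>

lemma reach_dmat_base:
  assumes m: "(dmat n x, Y, v, w) \<in> moment_fibre \<tau> n r" and x: "inj_on x {..<n}"
    and \<tau>: "\<tau> \<noteq> 0" and n: "n \<ge> 1" and r: "r \<ge> 1"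
  shows "reach n r (dmat n x, Y, v, w) (nil_point \<tau> n r (\<lambda>_. 0))"
proof -
  obtain Y1 v1 w1 where 1: "reach n r (dmat n x, Y, v, w) (dmat n x, Y1, v1, w1)" "rank_one n r v1 w1"
    using reach_rank_one[OF m x \<tau> r] by blast
  obtain u g h Y2 v2 w2 where 2: "(g, h) \<in> GL_pairs n"
    "conj_point g h (nil_point \<tau> n r u) = (dmat n x, Y2, v2, w2)" "rank_one n r v2 w2"
    using nil_point_diagonalizable[OF \<tau> n x] by blast
  have fib: "nil_point \<tau> n r u \<in> moment_fibre \<tau> n r" by (rule nil_point_in_fibre) fact
  have "reach n r (nil_point \<tau> n r u) (dmat n x, Y2, v2, w2)"
    using reach_GL[OF _ 2(1), of "nil_point \<tau> n r u" r] fib unfolding 2(2) by (simp add: moment_fibre_def)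
  \<comment> \<open>The given point and the nilpotent point built for its spectrum meet here: both
    have been brought to the same diagonal \<open>X\<close> with concentrated \<open>v\<close> and
    \<open>w\<close>.\<close>
  moreover have "reach n r (dmat n x, Y1, v1, w1) (dmat n x, Y2, v2, w2)"
  proof (rule reach_same_dmat)
    show "(dmat n x, Y1, v1, w1) \<in> moment_fibre \<tau> n r" by (rule reach_moment_fibre[OF 1(1) m])
    show "(dmat n x, Y2, v2, w2) \<in> moment_fibre \<tau> n r" using moment_conj_point[OF fib 2(1)] unfolding 2(2) .
  qed fact+
  ultimately show ?thesis
    by (rule_tac reach_trans[OF 1(1)], rule_tac reach_trans[OF _ reach_nil_point[OF \<tau> n r]],
        rule_tac reach_trans[OF _ reach_sym])
qed

lemma reach_base:
  assumes m: "(X, Y, v, w) \<in> moment_fibre \<tau> n r" and X: "card (spectrum X) = n"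
    and \<tau>: "\<tau> \<noteq> 0" and n: "n \<ge> 1" and r: "r \<ge> 1"
  shows "reach n r (X, Y, v, w) (nil_point \<tau> n r (\<lambda>_. 0))"
proof -
  have rep: "(X, Y, v, w) \<in> rep_space n r" using m by (simp add: moment_fibre_def)
  obtain g h x where gh: "(g, h) \<in> GL_pairs n" "g * X * h = dmat n x" and x: "inj_on x {..<n}"
    using diagonalize[OF rep_space_carriers(1)[OF rep] X] by blast
  have conj: "conj_point g h (X, Y, v, w) = (dmat n x, g * Y * h, g * v, w * h)" by (simp add: gh(2))
  show ?thesis
    using reach_trans[OF reach_GL[OF rep gh(1)], unfolded conj] moment_conj_point[OF m gh(1), unfolded conj]
      reach_dmat_base[OF _ x \<tau> n r] by blast
qed

lemma calR_reach_base:
  assumes p: "p \<in> calR \<tau> n r" and \<tau>: "\<tau> \<noteq> 0" and n: "n \<ge> 1" and r: "r \<ge> 1"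
  shows "\<exists>m. p = GL_orbit n m \<and> reach n r m (nil_point \<tau> n r (\<lambda>_. 0))"
proof -
  obtain m0 X Y v w where m0: "m0 \<in> moment_fibre \<tau> n r" "p = GL_orbit n m0"
    and m: "(X, Y, v, w) \<in> p" and card: "card (spectrum X) = n \<or> card (spectrum Y) = n"
    using p by (auto simp: calR_def calC_def)
  have rep0: "m0 \<in> rep_space n r" using m0 by (simp add: moment_fibre_def)
  \<comment> \<open>The eigenvalue condition is known for some point of the orbit only, so that
    point replaces m0 as the representative.\<close>
  obtain g h where gh: "(g, h) \<in> GL_pairs n" "(X, Y, v, w) = conj_point g h m0"
    using m m0(2) by (auto simp: GL_orbit_eq)
  have fib: "(X, Y, v, w) \<in> moment_fibre \<tau> n r"
    using moment_conj_point[OF m0(1) gh(1)] by (simp add: gh(2))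
  then have rep: "(X, Y, v, w) \<in> rep_space n r" by (simp add: moment_fibre_def)
  have "reach n r (X, Y, v, w) (nil_point \<tau> n r (\<lambda>_. 0))"
    using card
  proof
    assume "card (spectrum X) = n"
    then show ?thesis using reach_base[OF fib _ \<tau> n r] by blast
  next
    assume Y: "card (spectrum Y) = n"
    \<comment> \<open>The exchange of the loops puts \<open>Y\<close> in the first place, which
      reduces to the case already treated.\<close>
    note f = reach_fourier[OF rep]
    show ?thesis
      using reach_trans[OF f reach_base[OF reach_moment_fibre[OF f fib] Y \<tau> n r]] .
  qed
  moreover have "p = GL_orbit n (X, Y, v, w)"
    using GL_orbit_conj_point[OF rep0 gh(1)] m0(2) gh(2) by simp
  ultimately show ?thesis by blast
qed

theorem theorem7:
  fixes \<tau> :: complex and n r :: nat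
  assumes "\<tau> \<noteq> 0" and "n \<ge> 1" and "r \<ge> 1"
    and "p \<in> calR \<tau> n r" and "p' \<in> calR \<tau> n r"
  shows "\<exists>\<psi> \<in> grp_calP r. orbit_act n r p \<psi> = p'"
proof -
  obtain m m' where m: "p = GL_orbit n m" "reach n r m (nil_point \<tau> n r (\<lambda>_. 0))"
    and m': "p' = GL_orbit n m'" "reach n r m' (nil_point \<tau> n r (\<lambda>_. 0))"
    using calR_reach_base[OF assms(4,1-3)] calR_reach_base[OF assms(5,1-3)] by blast
  have "reach n r m m'" by (rule reach_trans[OF m(2) reach_sym[OF m'(2)]])
  then show ?thesis unfolding reach_def m(1) m'(1) by blast
qed

end
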